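(* Let $A$ be a unital $C^*$-algebra and let $\alpha:A\to A$ be an injective unital $*$-endomorphism. If $(\pi,T)$ is a contractive covariant representation of $(A,\alpha)$ on a Hilbert space $H$, then there exists a coisometric covariant representation $(\rho,V)$ of $(A,\alpha)$ on a Hilbert space $K$ containing $H$ (as a closed subspace) that extends $(\pi,T)$; that is, $\rho(a)H\subseteq H$ and $\rho(a)|_H=\pi(a)$ for all $a\in A$, while $VH\subseteq H$ and $V|_H=T$.
   Context: A representation of $A$ on a Hilbert space $H$ means a unital $*$-homomorphism $A\to B(H)$. A (contractive) covariant representation of $(A,\alpha)$ on a Hilbert space $H$ is a pair $(\pi,T)$ consisting of a representation $\pi:A\to B(H)$ and a contraction $T\in B(H)$ ($\|T\|\le 1$) such that $T\pi(\alpha(a))=\pi(a)T$ for all $a\in A$. It is called coisometric if $T$ is a coisometry, i.e. $TT^*=I$. *)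

theory Defs
  imports "HOL-Analysis.Analysis" "HOL-Algebra.Module" "HOL-Decision_Procs.Algebra_Aux"
begin

section \<open>Unital C*-algebras\<close>

text \<open>The class \<^class>\<open>monoid_mult\<close> supplies the unit.  We do not build on
  \<^class>\<open>real_normed_algebra_1\<close>, because its axiom that the unit has norm 1 would exclude the
  zero algebra; for every other algebra that equation follows from the C*-identity.\<close>

class cstar_algebra = real_normed_algebra + banach + monoid_mult +
  fixes scaleC :: "complex \<Rightarrow> 'a \<Rightarrow> 'a"
    and cstar :: "'a \<Rightarrow> 'a"
  assumes scaleR_scaleC: "scaleR r x = scaleC (complex_of_real r) x"
    and scaleC_add_right: "scaleC c (x + y) = scaleC c x + scaleC c y"
    and scaleC_add_left: "scaleC (c + d) x = scaleC c x + scaleC d x"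
    and scaleC_scaleC: "scaleC c (scaleC d x) = scaleC (c * d) x"
    and mult_scaleC_left: "scaleC c x * y = scaleC c (x * y)"
    and mult_scaleC_right: "x * scaleC c y = scaleC c (x * y)"
    and norm_scaleC: "norm (scaleC c x) = cmod c * norm x"
    and cstar_cstar: "cstar (cstar x) = x"
    and cstar_add: "cstar (x + y) = cstar x + cstar y"
    and cstar_scaleC: "cstar (scaleC c x) = scaleC (cnj c) (cstar x)"
    and cstar_mult: "cstar (x * y) = cstar y * cstar x"
    and cstar_identity: "norm (cstar x * x) = (norm x)\<^sup>2"

definition unital_star_endomorphism :: "('a::cstar_algebra \<Rightarrow> 'a) \<Rightarrow> bool" where
  "unital_star_endomorphism \<alpha> \<longleftrightarrow>
     (\<forall>a b. \<alpha> (a + b) = \<alpha> a + \<alpha> b) \<and>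
     (\<forall>c a. \<alpha> (scaleC c a) = scaleC c (\<alpha> a)) \<and>
     (\<forall>a b. \<alpha> (a * b) = \<alpha> a * \<alpha> b) \<and>
     (\<forall>a. \<alpha> (cstar a) = cstar (\<alpha> a)) \<and>
     \<alpha> 1 = 1"


section \<open>Complex Hilbert spaces on a carrier set\<close>

text \<open>A theorem asserting that some Hilbert space exists cannot quantify over types, so Hilbert
  spaces are structures with an explicit carrier.  The scalars are the ring
  \<^term>\<open>cring_class_ops :: complex ring\<close>.  The ring multiplication and unit that every
  \<^type>\<open>module\<close> record carries play no role.\<close>

record 'v hilbert = "(complex, 'v) module" +
  hinner :: "'v \<Rightarrow> 'v \<Rightarrow> complex"

text \<open>The inner product is linear in the first argument.\<close>

locale complex_inner_space = module "cring_class_ops :: complex ring" H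
  for H :: "('v, 'm) hilbert_scheme" (structure) +
  assumes hinner_add_left:
      "\<lbrakk>x \<in> carrier H; y \<in> carrier H; z \<in> carrier H\<rbrakk>
        \<Longrightarrow> hinner H (x \<oplus> y) z = hinner H x z + hinner H y z"
    and hinner_smult_left:
      "\<lbrakk>x \<in> carrier H; y \<in> carrier H\<rbrakk> \<Longrightarrow> hinner H (c \<odot> x) y = c * hinner H x y"
    and hinner_commute:
      "\<lbrakk>x \<in> carrier H; y \<in> carrier H\<rbrakk> \<Longrightarrow> hinner H x y = cnj (hinner H y x)"
    and hinner_ge_zero: "x \<in> carrier H \<Longrightarrow> 0 \<le> Re (hinner H x x)"
    and hinner_eq_zero: "\<lbrakk>x \<in> carrier H; hinner H x x = 0\<rbrakk> \<Longrightarrow> x = \<zero>"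

definition hnorm :: "('v, 'm) hilbert_scheme \<Rightarrow> 'v \<Rightarrow> real" where
  "hnorm H x = sqrt (Re (hinner H x x))"

text \<open>\<^locale>\<open>Metric_space\<close> asks for nonnegativity and symmetry off the carrier, too; hence
  the case distinction.\<close>

definition hdist :: "('v, 'm) hilbert_scheme \<Rightarrow> 'v \<Rightarrow> 'v \<Rightarrow> real" where
  "hdist H x y = (if x \<in> carrier H \<and> y \<in> carrier H then hnorm H (x \<ominus>\<^bsub>H\<^esub> y) else 0)"

locale hilbert_space = complex_inner_space +
  assumes complete: "Metric_space.mcomplete (carrier H) (hdist H)"


section \<open>Operators\<close>

text \<open>Operators are functions on the ambient type of which only the values on the carrier matter;
  equality of operators means agreement on the carrier.\<close>

definition hlinear ::
    "('v, 'm) hilbert_scheme \<Rightarrow> ('w, 'n) hilbert_scheme \<Rightarrow> ('v \<Rightarrow> 'w) \<Rightarrow> bool" where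
  "hlinear H K f \<longleftrightarrow>
     f \<in> carrier H \<rightarrow> carrier K \<and>
     (\<forall>x\<in>carrier H. \<forall>y\<in>carrier H. f (x \<oplus>\<^bsub>H\<^esub> y) = f x \<oplus>\<^bsub>K\<^esub> f y) \<and>
     (\<forall>c. \<forall>x\<in>carrier H. f (c \<odot>\<^bsub>H\<^esub> x) = c \<odot>\<^bsub>K\<^esub> f x)"

definition bounded_ops :: "('v, 'm) hilbert_scheme \<Rightarrow> ('v \<Rightarrow> 'v) set" where
  "bounded_ops H =
     {T. hlinear H H T \<and> (\<exists>C. \<forall>x\<in>carrier H. hnorm H (T x) \<le> C * hnorm H x)}"

definition op_norm :: "('v, 'm) hilbert_scheme \<Rightarrow> ('v \<Rightarrow> 'v) \<Rightarrow> real" where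
  "op_norm H T = (SUP x\<in>{x \<in> carrier H. hnorm H x \<le> 1}. hnorm H (T x))"

definition is_adjoint :: "('v, 'm) hilbert_scheme \<Rightarrow> ('v \<Rightarrow> 'v) \<Rightarrow> ('v \<Rightarrow> 'v) \<Rightarrow> bool" where
  "is_adjoint H T S \<longleftrightarrow>
     T \<in> bounded_ops H \<and> S \<in> bounded_ops H \<and>
     (\<forall>x\<in>carrier H. \<forall>y\<in>carrier H. hinner H (T x) y = hinner H x (S y))"

definition contraction :: "('v, 'm) hilbert_scheme \<Rightarrow> ('v \<Rightarrow> 'v) \<Rightarrow> bool" where
  "contraction H T \<longleftrightarrow> T \<in> bounded_ops H \<and> op_norm H T \<le> 1"

definition coisometry :: "('v, 'm) hilbert_scheme \<Rightarrow> ('v \<Rightarrow> 'v) \<Rightarrow> bool" where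
  "coisometry H T \<longleftrightarrow> (\<exists>S. is_adjoint H T S \<and> (\<forall>x\<in>carrier H. T (S x) = x))"

text \<open>An embedding identifies \<open>H\<close> with a closed subspace of \<open>K\<close>.\<close>

definition hilbert_embedding ::
    "('v, 'm) hilbert_scheme \<Rightarrow> ('w, 'n) hilbert_scheme \<Rightarrow> ('v \<Rightarrow> 'w) \<Rightarrow> bool" where
  "hilbert_embedding H K J \<longleftrightarrow>
     hlinear H K J \<and>
     (\<forall>x\<in>carrier H. \<forall>y\<in>carrier H. hinner K (J x) (J y) = hinner H x y) \<and>
     closedin (Metric_space.mtopology (carrier K) (hdist K)) (J ` carrier H)"


section \<open>Covariant representations\<close>

definition representation ::
    "('v, 'm) hilbert_scheme \<Rightarrow> ('a::cstar_algebra \<Rightarrow> 'v \<Rightarrow> 'v) \<Rightarrow> bool" where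
  "representation H \<pi> \<longleftrightarrow>
     (\<forall>a. \<pi> a \<in> bounded_ops H) \<and>
     (\<forall>a b. \<forall>x\<in>carrier H. \<pi> (a + b) x = \<pi> a x \<oplus>\<^bsub>H\<^esub> \<pi> b x) \<and>
     (\<forall>c a. \<forall>x\<in>carrier H. \<pi> (scaleC c a) x = c \<odot>\<^bsub>H\<^esub> \<pi> a x) \<and>
     (\<forall>a b. \<forall>x\<in>carrier H. \<pi> (a * b) x = \<pi> a (\<pi> b x)) \<and>
     (\<forall>a. is_adjoint H (\<pi> a) (\<pi> (cstar a))) \<and>
     (\<forall>x\<in>carrier H. \<pi> 1 x = x)"

definition covariant_representation ::
    "('a::cstar_algebra \<Rightarrow> 'a) \<Rightarrow> ('v, 'm) hilbert_scheme \<Rightarrow> ('a \<Rightarrow> 'v \<Rightarrow> 'v) \<Rightarrow> ('v \<Rightarrow> 'v) \<Rightarrow> bool"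
  where
  "covariant_representation \<alpha> H \<pi> T \<longleftrightarrow>
     representation H \<pi> \<and> contraction H T \<and>
     (\<forall>a. \<forall>x\<in>carrier H. T (\<pi> (\<alpha> a) x) = \<pi> a (T x))"

definition coisometric_covariant_representation ::
    "('a::cstar_algebra \<Rightarrow> 'a) \<Rightarrow> ('v, 'm) hilbert_scheme \<Rightarrow> ('a \<Rightarrow> 'v \<Rightarrow> 'v) \<Rightarrow> ('v \<Rightarrow> 'v) \<Rightarrow> bool"
  where
  "coisometric_covariant_representation \<alpha> H \<pi> T \<longleftrightarrow>
     covariant_representation \<alpha> H \<pi> T \<and> coisometry H T"

text \<open>\<open>(\<rho>, V)\<close> on \<open>K\<close> extends \<open>(\<pi>, T)\<close> on \<open>H\<close>, where \<open>H\<close> sits in \<open>K\<close> via \<open>J\<close>.\<close>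

definition extends_via ::
    "('v \<Rightarrow> 'w) \<Rightarrow> ('v, 'm) hilbert_scheme \<Rightarrow> ('a \<Rightarrow> 'w \<Rightarrow> 'w) \<Rightarrow> ('w \<Rightarrow> 'w) \<Rightarrow>
      ('a \<Rightarrow> 'v \<Rightarrow> 'v) \<Rightarrow> ('v \<Rightarrow> 'v) \<Rightarrow> bool" where
  "extends_via J H \<rho> V \<pi> T \<longleftrightarrow>
     (\<forall>a. \<rho> a ` J ` carrier H \<subseteq> J ` carrier H) \<and>
     (\<forall>a. \<forall>x\<in>carrier H. \<rho> a (J x) = J (\<pi> a x)) \<and>
     V ` J ` carrier H \<subseteq> J ` carrier H \<and>
     (\<forall>x\<in>carrier H. V (J x) = J (T x))"

text \<open>The elements of the larger space have to live in some type fixed in advance.  The following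
  one is large enough, and it does not constrain the space beyond its cardinality: if the family
  \<open>e\<close>, indexed by a subset of \<open>'v \<times> 'a list\<close>, has dense span in a Hilbert space \<open>K\<close>, then
  \<open>k \<mapsto> (\<lambda>i. \<langle>k, e i\<rangle>)\<close> is injective and transports \<open>K\<close> to this type.  The index
  \<open>(x, [a1, \<dots>, an])\<close> is meant for a vector obtained from \<open>x\<close> by applying, in \<open>n\<close> successive
  enlargements, the operators that represent \<open>a1\<close>, \dots, \<open>an\<close>.\<close>

type_synonym ('v, 'a) extension_vector = "'v \<times> 'a list \<Rightarrow> complex"


section \<open>The metric of an inner product space\<close>

context complex_inner_space
begin

lemma hinner_add_right:
  assumes "x \<in> carrier H" "y \<in> carrier H" "z \<in> carrier H"
  shows "hinner H x (y \<oplus> z) = hinner H x y + hinner H x z"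
proof -
  have "hinner H x (y \<oplus> z) = cnj (hinner H (y \<oplus> z) x)"
    using assms by (intro hinner_commute) auto
  also have "\<dots> = cnj (hinner H y x) + cnj (hinner H z x)"
    using assms by (simp add: hinner_add_left)
  also have "\<dots> = hinner H x y + hinner H x z"
    using assms hinner_commute by metis
  finally show ?thesis .
qed

lemma smult_closed_complex: "x \<in> carrier H \<Longrightarrow> c \<odot> x \<in> carrier H"
  by (rule smult_closed) (simp_all add: carrier_class)

lemma hinner_smult_right:
  assumes "x \<in> carrier H" "y \<in> carrier H"
  shows "hinner H x (c \<odot> y) = cnj c * hinner H x y"
proof -
  have "hinner H x (c \<odot> y) = cnj (hinner H (c \<odot> y) x)"
    using assms by (intro hinner_commute) (auto intro: smult_closed_complex)
  also have "\<dots> = cnj c * cnj (hinner H y x)"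
    using assms by (simp add: hinner_smult_left)
  also have "\<dots> = cnj c * hinner H x y"
    using assms hinner_commute by metis
  finally show ?thesis .
qed

lemma hinner_self_Re:
  assumes "x \<in> carrier H"
  shows "hinner H x x = complex_of_real (Re (hinner H x x))"
proof -
  have "hinner H x x = cnj (hinner H x x)"
    using assms by (intro hinner_commute) auto
  then show ?thesis
    by (metis Reals_cnj_iff of_real_Re)
qed

lemma hinner_zero_left:
  assumes "x \<in> carrier H" shows "hinner H \<zero> x = 0"
proof -
  have "hinner H (\<zero> \<oplus> \<zero>) x = hinner H \<zero> x + hinner H \<zero> x"
    using assms by (intro hinner_add_left) auto
  then show ?thesis by simp
qed

lemma hinner_minus_left:
  assumes "x \<in> carrier H" "y \<in> carrier H"
  shows "hinner H (\<ominus> x) y = - hinner H x y"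
proof -
  have "hinner H (\<ominus> x \<oplus> x) y = hinner H (\<ominus> x) y + hinner H x y"
    using assms by (intro hinner_add_left) auto
  then show ?thesis
    using assms by (simp add: M.l_neg hinner_zero_left add_eq_0_iff2)
qed

lemma hnorm_ge_zero: "x \<in> carrier H \<Longrightarrow> 0 \<le> hnorm H x"
  by (simp add: hnorm_def hinner_ge_zero)

lemma hnorm_square: "x \<in> carrier H \<Longrightarrow> (hnorm H x)\<^sup>2 = Re (hinner H x x)"
  by (simp add: hnorm_def hinner_ge_zero)

lemma hnorm_minus: "x \<in> carrier H \<Longrightarrow> hnorm H (\<ominus> x) = hnorm H x"
proof -
  assume x: "x \<in> carrier H"
  have "hinner H (\<ominus> x) (\<ominus> x) = - hinner H x (\<ominus> x)"
    using x by (intro hinner_minus_left) auto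
  also have "hinner H x (\<ominus> x) = cnj (hinner H (\<ominus> x) x)"
    using x by (intro hinner_commute) auto
  also have "\<dots> = - cnj (hinner H x x)"
    using x by (simp add: hinner_minus_left)
  finally show ?thesis by (simp add: hnorm_def)
qed

lemma hnorm_square_add:
  assumes "x \<in> carrier H" "y \<in> carrier H"
  shows "(hnorm H (x \<oplus> y))\<^sup>2 = (hnorm H x)\<^sup>2 + 2 * Re (hinner H x y) + (hnorm H y)\<^sup>2"
proof -
  have "Re (hinner H y x) = Re (hinner H x y)"
    using hinner_commute[OF assms(2,1)] by simp
  then show ?thesis
    using assms by (simp add: hnorm_square hinner_add_left hinner_add_right)
qed

lemma Re_hinner_le:
  assumes x: "x \<in> carrier H" and y: "y \<in> carrier H"
  shows "Re (hinner H x y) \<le> hnorm H x * hnorm H y"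
proof -
  let ?a = "Re (hinner H x x)" and ?b = "Re (hinner H x y)" and ?c = "Re (hinner H y y)"
  have quad: "0 \<le> ?a + 2 * t * ?b + t\<^sup>2 * ?c" for t :: real
  proof -
    have ty: "complex_of_real t \<odot> y \<in> carrier H"
      using y by (rule smult_closed_complex)
    have "0 \<le> (hnorm H (x \<oplus> complex_of_real t \<odot> y))\<^sup>2" by simp
    also have "\<dots> = ?a + 2 * t * ?b + t\<^sup>2 * ?c"
      unfolding hnorm_square_add[OF x ty] hnorm_square[OF x] hnorm_square[OF ty]
      using x y ty by (simp add: hinner_smult_left hinner_smult_right monoid_mult_class.power2_eq_square)
    finally show ?thesis .
  qed
  have c: "0 \<le> ?c" using y by (rule hinner_ge_zero)
  have "?b\<^sup>2 \<le> ?a * ?c"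
  proof (cases "?c = 0")
    case True
    then have "hinner H y y = 0" using hinner_self_Re[OF y] by simp
    then have "y = \<zero>" using y by (rule hinner_eq_zero[rotated])
    then have "hinner H x y = 0"
      using x hinner_commute[OF x, of \<zero>] by (simp add: hinner_zero_left)
    then show ?thesis using True by simp
  next
    case False
    then have "0 < ?c" using c by simp
    have "?a + 2 * (- ?b / ?c) * ?b + (- ?b / ?c)\<^sup>2 * ?c = ?a - ?b\<^sup>2 / ?c"
      using False by (simp add: monoid_mult_class.power2_eq_square)
    moreover have "0 \<le> ?a + 2 * (- ?b / ?c) * ?b + (- ?b / ?c)\<^sup>2 * ?c"
      by (rule quad)
    ultimately have "?b\<^sup>2 / ?c \<le> ?a" by linarith
    then show ?thesis using \<open>0 < ?c\<close> by (simp add: pos_divide_le_eq)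
  qed
  then have "\<bar>?b\<bar> \<le> sqrt (?a * ?c)"
    by (rule real_le_rsqrt[of "\<bar>?b\<bar>", simplified])
  then show ?thesis by (simp add: hnorm_def real_sqrt_mult)
qed

lemma hnorm_triangle:
  assumes "x \<in> carrier H" "y \<in> carrier H"
  shows "hnorm H (x \<oplus> y) \<le> hnorm H x + hnorm H y"
proof (rule power2_le_imp_le)
  show "(hnorm H (x \<oplus> y))\<^sup>2 \<le> (hnorm H x + hnorm H y)\<^sup>2"
    using Re_hinner_le[OF assms] assms by (simp add: hnorm_square_add power2_sum)
qed (simp add: assms hnorm_ge_zero)

lemma Metric_space_hdist: "Metric_space (carrier H) (hdist H)"
proof
  fix x y
  show "0 \<le> hdist H x y"
    by (simp add: hdist_def hnorm_ge_zero)
  show "hdist H x y = hdist H y x"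
  proof (cases "x \<in> carrier H \<and> y \<in> carrier H")
    case True
    then have "y \<ominus> x = \<ominus> (x \<ominus> y)"
      by (simp add: a_minus_def M.minus_add M.a_comm)
    with True show ?thesis by (simp add: hdist_def hnorm_minus)
  qed (auto simp: hdist_def)
next
  fix x y assume xy: "x \<in> carrier H" "y \<in> carrier H"
  show "hdist H x y = 0 \<longleftrightarrow> x = y"
  proof
    assume "hdist H x y = 0"
    then have "Re (hinner H (x \<ominus> y) (x \<ominus> y)) = 0"
      using xy by (simp add: hdist_def hnorm_def)
    then have "hinner H (x \<ominus> y) (x \<ominus> y) = 0"
      using hinner_self_Re[of "x \<ominus> y"] xy by simp
    then have "x \<ominus> y = \<zero>"
      using xy by (intro hinner_eq_zero) auto
    moreover have "x = (x \<ominus> y) \<oplus> y"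
      using xy by (simp add: a_minus_def M.a_assoc M.l_neg)
    ultimately show "x = y" using xy by simp
  next
    assume "x = y"
    then show "hdist H x y = 0"
      using xy by (simp add: hdist_def hnorm_def a_minus_def M.r_neg hinner_zero_left)
  qed
next
  fix x y z assume xyz: "x \<in> carrier H" "y \<in> carrier H" "z \<in> carrier H"
  then have "x \<ominus> z = (x \<ominus> y) \<oplus> (y \<ominus> z)"
    by (simp add: a_minus_def M.a_assoc M.r_neg2 M.r_neg1)
  then show "hdist H x z \<le> hdist H x y + hdist H y z"
    using xyz hnorm_triangle[of "x \<ominus> y" "y \<ominus> z"] by (simp add: hdist_def)
qed

end

end

theory Submission
  imports Defs "HOL-Library.Function_Algebras"
begin

text \<open>For the algebra of complex numbers this is the isometric dilation of Sz.-Nagy, read for the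
  adjoint: the isometry \<open>V\<^sup>*\<close> sends \<open>h\<close> in \<open>H\<close> to
  \<open>T\<^sup>* h\<close> together with the defect vector
  \<open>(1 - T T\<^sup>*)\<^sup>1\<^sup>/\<^sup>2 h\<close> in a new summand, and it shifts
  each new summand isometrically into the next one. Then \<open>V\<^sup>*\<close> is an
  isometry, so \<open>V\<close> is a coisometry, and the part of \<open>V\<close> on
  \<open>H\<close> is \<open>T\<close>.

  For a general algebra the covariance relation reads
  \<open>V\<^sup>* \<rho>(a) = \<rho>(\<alpha>(a)) V\<^sup>*\<close>. Since
  \<open>T T\<^sup>*\<close> commutes with \<open>\<pi>\<close>, the defect space carries a
  representation \<open>\<sigma>\<close> of the algebra, and the summand that receives the
  defect space must carry a representation whose restriction to \<open>\<alpha>(A)\<close>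
  reproduces \<open>\<sigma>(a)\<close> as the action of \<open>\<alpha>(a)\<close>; the same is
  asked of each further summand. So the essential step is this: a representation of the
  subalgebra \<open>\<alpha>(A)\<close>, transported from \<open>A\<close> by the injective map
  \<open>\<alpha>\<close>, extends to a representation of \<open>A\<close> on a larger space.

  All representations are handled through their coefficients. If vectors \<open>e\<^sub>i\<close>
  span a space on which \<open>A\<close> acts, then the functions
  \<open>\<langle>\<rho>(a) e\<^sub>i, e\<^sub>j\<rangle>\<close> form a completely positive
  kernel (\<open>cp_kernel\<close>), and the space is recovered from the kernel as a reproducing
  kernel Hilbert space, whose elements are functions on the index set. In this picture
  \<open>K\<close> consists of functions of pairs
  \<open>(x, [a\<^sub>1, \<dots>, a\<^sub>n])\<close>: a summand adds one algebra element at
  the front of the list, \<open>\<rho>\<close> multiplies that element, and \<open>V f\<close>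
  is \<open>f\<close> composed with the action of \<open>V\<^sup>*\<close> on indices
  (\<open>Vstar\<close>). The defect operator enters only through the form
  \<open>\<langle>x, y\<rangle> - \<langle>T\<^sup>* x, T\<^sup>* y\<rangle>\<close>, so
  its square root never has to be formed.

  The extension step is \<open>cp_kernel_extension\<close>: every completely positive kernel
  \<open>\<phi>\<close> has the form
  \<open>\<phi> i j a = \<psi> i j (\<alpha> a)\<close> with \<open>\<psi>\<close>
  completely positive. A kernel is a linear functional on finite matrices over \<open>A\<close>,
  and \<open>\<phi>\<close> prescribes this functional on matrices over
  \<open>\<alpha>(A)\<close>. The extension theorem of M. Riesz applies once the prescribed
  functional is known to be nonnegative on those matrices over \<open>\<alpha>(A)\<close> that
  are positive over \<open>A\<close>. Domination of all matrices by matrices over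
  \<open>\<alpha>(A)\<close>, which the theorem also asks for, is elementary
  (\<open>matrix_unit_dominated\<close>). Two facts give the nonnegativity. An injective
  homomorphism reflects positivity (\<open>hom_cpos_iff\<close>), so such a matrix is the image
  of a matrix positive over \<open>A\<close>. By the Cholesky factorisation a positive matrix
  is, up to an arbitrarily small multiple of the unit, a sum of squares, on which
  \<open>\<phi>\<close> is nonnegative (\<open>cp_kernel_positive_matrix\<close>).

  The order on \<open>A\<close> that all this rests on is developed from the C*-identity without
  spectra: positive means within distance \<open>t\<close> of \<open>t\<close> for some
  \<open>t\<close>, square roots come from an iteration, and the positivity of
  \<open>c\<^sup>* c\<close> (\<open>cpos_cstar_mult_self\<close>) is obtained by an algebraic
  argument in place of the usual comparison of spectra.\<close>

section \<open>Positive elements of a unital C*-algebra\<close>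

lemma scaleC_zero_right [simp]: "scaleC c (0::'a::cstar_algebra) = 0"
  using scaleC_add_right[of c "0::'a" 0] by simp

lemma scaleC_minus_right: "scaleC c (- x) = - scaleC c (x::'a::cstar_algebra)"
  using scaleC_add_right[of c x "- x"] by (simp add: eq_neg_iff_add_eq_0 add.commute)

lemma scaleC_diff_right: "scaleC c (x - y) = scaleC c x - scaleC c (y::'a::cstar_algebra)"
  using scaleC_add_right[of c x "- y"] by (simp add: scaleC_minus_right)

lemma scaleC_zero_left [simp]: "scaleC 0 (x::'a::cstar_algebra) = 0"
  using scaleC_add_left[of 0 0 x] by simp

lemma scaleC_minus_left: "scaleC (- c) x = - scaleC c (x::'a::cstar_algebra)"
  using scaleC_add_left[of c "- c" x] by (simp add: eq_neg_iff_add_eq_0 add.commute)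

lemma scaleC_one [simp]: "scaleC 1 (x::'a::cstar_algebra) = x"
  using scaleR_scaleC[of 1 x] by simp

lemma cstar_zero [simp]: "cstar (0::'a::cstar_algebra) = 0"
  using cstar_add[of "0::'a" 0] by simp

lemma cstar_minus: "cstar (- x) = - cstar (x::'a::cstar_algebra)"
  using cstar_add[of x "- x"] by (simp add: eq_neg_iff_add_eq_0 add.commute)

lemma cstar_diff: "cstar (x - y) = cstar x - cstar (y::'a::cstar_algebra)"
  using cstar_add[of x "- y"] by (simp add: cstar_minus)

lemma cstar_scaleR: "cstar (r *\<^sub>R x) = r *\<^sub>R cstar (x::'a::cstar_algebra)"
  by (simp add: scaleR_scaleC cstar_scaleC)

lemma cstar_one [simp]: "cstar (1::'a::cstar_algebra) = 1"
  using cstar_mult[of "cstar (1::'a)" 1] by (simp add: cstar_cstar)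

lemma cstar_sum: "cstar (sum f F) = (\<Sum>i\<in>F. cstar (f i :: 'a::cstar_algebra))"
  by (induction F rule: infinite_finite_induct) (simp_all add: cstar_add)

lemmas cstar_simps =
  cstar_cstar cstar_add cstar_minus cstar_diff cstar_scaleR cstar_scaleC cstar_mult

lemma norm_le_norm_cstar: "norm x \<le> norm (cstar (x::'a::cstar_algebra))"
proof (cases "norm x = 0")
  case False
  have "norm x * norm x = norm (cstar x * x)"
    by (simp add: cstar_identity power2_eq_square)
  also have "\<dots> \<le> norm (cstar x) * norm x"
    by (rule norm_mult_ineq)
  finally show ?thesis using False by simp
qed simp

lemma norm_cstar [simp]: "norm (cstar x) = norm (x::'a::cstar_algebra)"
  using norm_le_norm_cstar[of x] norm_le_norm_cstar[of "cstar x"] by (simp add: cstar_cstar)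

text \<open>The C*-identity makes the norm of the unit idempotent; it is 0 in the zero algebra.\<close>

lemma norm_one_le: "norm (1::'a::cstar_algebra) \<le> 1"
proof -
  have "norm (1::'a) * norm (1::'a) = norm (1::'a)"
    using cstar_identity[of "1::'a"] by (simp add: power2_eq_square)
  then show ?thesis by auto
qed

lemma norm_square_sa: "cstar x = x \<Longrightarrow> norm (x * x) = (norm (x::'a::cstar_algebra))\<^sup>2"
  using cstar_identity[of x] by simp

lemma square_sa_eq_0:
  fixes x :: "'a::cstar_algebra"
  assumes "cstar x = x" "x * x = 0" shows "x = 0"
  using norm_square_sa[OF assms(1)] assms(2) by simp

text \<open>Positivity is defined through the norm, as containment of \<open>a\<close> in a ball around a
  multiple of the unit that touches 0. This makes sums of positive elements positive by the
  triangle inequality and makes square roots accessible to an iteration; that squares are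
  positive then has to be proved.\<close>

definition cpos :: "'a::cstar_algebra \<Rightarrow> bool" where
  "cpos a \<longleftrightarrow> cstar a = a \<and> (\<exists>t\<ge>0. norm (t *\<^sub>R 1 - a) \<le> t)"

lemma cpos_sa: "cpos a \<Longrightarrow> cstar a = a"
  by (simp add: cpos_def)

lemma cpos_0 [simp]: "cpos 0"
  by (auto simp: cpos_def intro!: exI[of _ 0])

lemma cpos_add:
  assumes "cpos a" "cpos b" shows "cpos (a + b)"
proof -
  obtain s t where s: "s \<ge> 0" "norm (s *\<^sub>R 1 - a) \<le> s" and t: "t \<ge> 0" "norm (t *\<^sub>R 1 - b) \<le> t"
    using assms unfolding cpos_def by blast
  have "norm ((s + t) *\<^sub>R 1 - (a + b)) = norm ((s *\<^sub>R 1 - a) + (t *\<^sub>R 1 - b))"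
    by (simp add: algebra_simps)
  also have "\<dots> \<le> s + t"
    using norm_triangle_ineq[of "s *\<^sub>R 1 - a" "t *\<^sub>R 1 - b"] s t by linarith
  finally have "norm ((s + t) *\<^sub>R 1 - (a + b)) \<le> s + t" .
  then have "\<exists>r\<ge>0. norm (r *\<^sub>R 1 - (a + b)) \<le> r"
    using s t by (intro exI[of _ "s + t"]) simp
  then show ?thesis
    using assms by (simp add: cpos_def cstar_simps)
qed

lemma cpos_scaleR:
  assumes "cpos a" "r \<ge> 0" shows "cpos (r *\<^sub>R a)"
proof -
  obtain s where s: "s \<ge> 0" "norm (s *\<^sub>R 1 - a) \<le> s"
    using assms unfolding cpos_def by blast
  have "norm ((r * s) *\<^sub>R 1 - r *\<^sub>R a) = r * norm (s *\<^sub>R 1 - a)"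
    using assms(2) by (simp flip: scaleR_scaleR scaleR_diff_right)
  also have "\<dots> \<le> r * s"
    using s assms by (intro mult_left_mono) auto
  finally have "\<exists>t\<ge>0. norm (t *\<^sub>R 1 - r *\<^sub>R a) \<le> t"
    using s assms by (intro exI[of _ "r * s"]) simp
  then show ?thesis
    using assms by (simp add: cpos_def cstar_simps)
qed

lemma cpos_scale_iff: "r > 0 \<Longrightarrow> cpos (r *\<^sub>R a) \<longleftrightarrow> cpos a"
  using cpos_scaleR[of a r] cpos_scaleR[of "r *\<^sub>R a" "inverse r"] by auto

lemma cpos_order_unit:
  fixes a :: "'a::cstar_algebra"
  assumes "cstar a = a" "norm a \<le> r" shows "cpos (r *\<^sub>R 1 - a)"
proof -
  have "r \<ge> 0" using assms norm_ge_zero[of a] by linarith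
  then have "\<exists>t\<ge>0. norm (t *\<^sub>R 1 - (r *\<^sub>R 1 - a)) \<le> t"
    using assms by (intro exI[of _ r]) simp
  then show ?thesis using assms by (simp add: cpos_def cstar_simps)
qed

lemma commute_sum_power:
  fixes x :: "'a::cstar_algebra"
  assumes "x * w = w * x" "y * w = w * y"
  shows "(x + y) * w = w * (x + y)" "(x - y) * w = w * (x - y)" "(x * y) * w = w * (x * y)"
proof -
  show "(x * y) * w = w * (x * y)"
    by (metis assms mult.assoc)
qed (simp_all add: assms algebra_simps)

text \<open>The root is written as \<open>1 - z\<close>, where \<open>z\<close> solves
  \<open>z = (y + z\<^sup>2) / 2\<close>. Iterating this equation from 0 gives polynomials
  in \<open>y\<close> whose increments are dominated by those of the scalar iteration for
  \<open>y = 1\<close>. The latter increases and is bounded by 1, hence converges, and this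
  covers the boundary case of norm exactly 1. Being a limit of polynomials in \<open>y\<close>,
  the solution is self-adjoint and commutes with all that commutes with \<open>y\<close>.\<close>

lemma exists_sqrt_one_minus:
  fixes y :: "'a::cstar_algebra"
  assumes sa: "cstar y = y" and y1: "norm y \<le> 1"
  shows "\<exists>z. cstar z = z \<and> norm z \<le> 1 \<and> (1 - z) * (1 - z) = 1 - y \<and>
    (\<forall>w. y * w = w * y \<longrightarrow> z * w = w * z)"
proof -
  \<comment> \<open>\<open>t\<close> is the same iteration for the scalar 1 in place of \<open>y\<close>; it
    majorises the increments of \<open>z\<close>.\<close>
  define z where "z = rec_nat (0::'a) (\<lambda>_ u. (1/2) *\<^sub>R (y + u * u))"
  define t where "t = rec_nat (0::real) (\<lambda>_ u. (1 + u * u) / 2)"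
  have z0: "z 0 = 0" and zS: "z (Suc n) = (1/2) *\<^sub>R (y + z n * z n)" for n
    by (simp_all add: z_def)
  have t0: "t 0 = 0" and tS: "t (Suc n) = (1 + t n * t n) / 2" for n
    by (simp_all add: t_def)
  have comm: "z n * w = w * z n" if "y * w = w * y" for n w
  proof (induction n)
    case (Suc n)
    have "(y + z n * z n) * w = w * (y + z n * z n)"
      by (intro commute_sum_power that Suc)
    then show ?case by (simp add: zS)
  qed (simp add: z0)
  have zz: "z m * z n = z n * z m" for m n
    by (intro comm comm[symmetric] refl)
  have zsa: "cstar (z n) = z n" for n
    by (induction n) (simp_all add: z0 zS cstar_simps sa)
  have t01: "0 \<le> t n \<and> t n \<le> 1" for n
  proof (induction n)
    case (Suc n)
    then show ?case using mult_le_one[of "t n" "t n"] by (simp add: tS)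
  qed (simp add: t0)
  have zt: "norm (z n) \<le> t n" for n
  proof (induction n)
    case (Suc n)
    have "norm (y + z n * z n) \<le> norm y + norm (z n) * norm (z n)"
      by (meson norm_triangle_le norm_mult_ineq add_left_mono order_trans)
    also have "\<dots> \<le> 1 + t n * t n"
      using y1 Suc t01[of n] by (intro add_mono mult_mono) auto
    finally show ?case by (simp add: zS tS)
  qed (simp add: z0 t0)
  have step: "norm (z (Suc n) - z n) \<le> t (Suc n) - t n" for n
  proof (induction n)
    case 0
    then show ?case using y1 by (simp add: z0 t0 zS tS)
  next
    case (Suc n)
    have "z (Suc (Suc n)) - z (Suc n) = (1/2) *\<^sub>R (z (Suc n) * z (Suc n) - z n * z n)"
      by (simp add: zS[of "Suc n"] zS[of n] algebra_simps)
    also have "z (Suc n) * z (Suc n) - z n * z n = (z (Suc n) - z n) * (z (Suc n) + z n)"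
      using zz[of "Suc n" n] by (simp add: algebra_simps)
    finally have "norm (z (Suc (Suc n)) - z (Suc n))
        = (1/2) * norm ((z (Suc n) - z n) * (z (Suc n) + z n))" by simp
    also have "\<dots> \<le> (1/2) * (norm (z (Suc n) - z n) * norm (z (Suc n) + z n))"
      by (intro mult_left_mono norm_mult_ineq) auto
    also have "\<dots> \<le> (1/2) * ((t (Suc n) - t n) * (t (Suc n) + t n))"
    proof (intro mult_left_mono mult_mono Suc)
      show "norm (z (Suc n) + z n) \<le> t (Suc n) + t n"
        using norm_triangle_ineq[of "z (Suc n)" "z n"] zt[of n] zt[of "Suc n"] by linarith
      show "0 \<le> t (Suc n) - t n" using Suc norm_ge_zero order_trans by blast
    qed auto
    also have "\<dots> = t (Suc (Suc n)) - t (Suc n)"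
      by (simp add: tS[of "Suc n"] tS[of n] algebra_simps)
    finally show ?case .
  qed
  have diff: "norm (z m - z n) \<le> t m - t n" if "n \<le> m" for m n
    using that
  proof (induction m rule: dec_induct)
    case (step m)
    have "norm (z (Suc m) - z n) \<le> norm (z (Suc m) - z m) + norm (z m - z n)"
      using norm_triangle_ineq[of "z (Suc m) - z m" "z m - z n"] by simp
    then show ?case using step.IH \<open>\<And>n. norm (z (Suc n) - z n) \<le> t (Suc n) - t n\<close>[of m] by linarith
  qed simp
  have "incseq t"
    using step by (intro incseq_SucI) (meson diff_ge_0_iff_ge norm_ge_zero order_trans)
  then have "convergent t"
    using t01 by (intro Bseq_monoseq_convergent incseq_imp_monoseq BseqI'[of _ 1]) auto
  then have tC: "Cauchy t" by (rule convergent_Cauchy)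
  have "Cauchy z"
  proof (rule CauchyI)
    fix e :: real assume "0 < e"
    then obtain M where M: "\<forall>m\<ge>M. \<forall>n\<ge>M. norm (t m - t n) < e"
      using CauchyD[OF tC] by blast
    have "norm (z m - z n) < e" if "m \<ge> M" "n \<ge> M" for m n
    proof (cases "n \<le> m")
      case True
      then show ?thesis using diff[OF True] M that by fastforce
    next
      case False
      then show ?thesis using diff[of m n] M that by (fastforce simp: norm_minus_commute)
    qed
    then show "\<exists>M. \<forall>m\<ge>M. \<forall>n\<ge>M. norm (z m - z n) < e" by blast
  qed
  then obtain l where l: "z \<longlonglongrightarrow> l"
    using Cauchy_convergent convergent_def by blast
  have lcomm: "l * w = w * l" if "y * w = w * y" for w
  proof (rule LIMSEQ_unique)
    show "(\<lambda>n. z n * w) \<longlonglongrightarrow> l * w" using l by (intro tendsto_intros)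
    show "(\<lambda>n. z n * w) \<longlonglongrightarrow> w * l"
      unfolding comm[OF that] using l by (intro tendsto_intros)
  qed
  have lsa: "cstar l = l"
  proof (rule LIMSEQ_unique)
    have "(\<lambda>n. norm (z n - l)) \<longlonglongrightarrow> 0" using l by (simp add: LIM_zero_iff tendsto_norm_zero_iff)
    moreover have "norm (z n - l) = norm (z n - cstar l)" for n
      using norm_cstar[of "z n - l"] by (simp add: cstar_simps zsa)
    ultimately show "z \<longlonglongrightarrow> cstar l"
      by (simp add: LIM_zero_iff tendsto_norm_zero_iff)
    show "z \<longlonglongrightarrow> l" by fact
  qed
  have l1: "norm l \<le> 1"
    by (rule Lim_norm_ubound[OF _ l]) (use zt t01 in \<open>auto intro!: always_eventually intro: order_trans\<close>)
  have "l = (1/2) *\<^sub>R (y + l * l)"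
  proof (rule LIMSEQ_unique)
    show "(\<lambda>n. z (Suc n)) \<longlonglongrightarrow> l" using l by (simp add: LIMSEQ_Suc)
    show "(\<lambda>n. z (Suc n)) \<longlonglongrightarrow> (1/2) *\<^sub>R (y + l * l)"
      unfolding zS using l by (intro tendsto_intros)
  qed
  then have "l + l = y + l * l"
    by (metis (no_types) scaleR_half_double scaleR_add_right)
  then have "(1 - l) * (1 - l) = 1 - y"
    by (simp add: algebra_simps)
  then show ?thesis using lsa l1 lcomm by blast
qed

lemma exists_sqrt:
  fixes a :: "'a::cstar_algebra"
  assumes "cpos a"
  shows "\<exists>s. cpos s \<and> s * s = a \<and> (\<forall>w. a * w = w * a \<longrightarrow> s * w = w * s)"
proof -
  obtain t0 where t0: "t0 \<ge> 0" "norm (t0 *\<^sub>R 1 - a) \<le> t0" and sa: "cstar a = a"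
    using assms unfolding cpos_def by blast
  define t where "t = t0 + 1"
  have t: "t > 0" using t0 by (simp add: t_def)
  have "norm (t *\<^sub>R 1 - a) = norm ((t0 *\<^sub>R 1 - a) + 1)" by (simp add: t_def algebra_simps)
  also have "\<dots> \<le> t" using norm_triangle_ineq[of "t0 *\<^sub>R 1 - a" 1] t0 norm_one_le[where 'a='a]
    by (simp add: t_def)
  finally have na: "norm (t *\<^sub>R 1 - a) \<le> t" .
  define y where "y = inverse t *\<^sub>R (t *\<^sub>R 1 - a)"
  have "norm y \<le> 1" using na t by (simp add: y_def divide_simps)
  moreover have "cstar y = y" by (simp add: y_def cstar_simps sa)
  ultimately obtain z where z: "cstar z = z" "norm z \<le> 1" "(1 - z) * (1 - z) = 1 - y"
    "\<forall>w. y * w = w * y \<longrightarrow> z * w = w * z"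
    using exists_sqrt_one_minus by blast
  define s where "s = sqrt t *\<^sub>R (1 - z)"
  have "cpos (1 - z)" using cpos_order_unit[of z 1] z by simp
  then have "cpos s" unfolding s_def using t by (intro cpos_scaleR) auto
  moreover have "s * s = t *\<^sub>R (1 - y)" using t z(3) by (simp add: s_def)
  then have "s * s = a" using t by (simp add: y_def algebra_simps)
  moreover have "s * w = w * s" if "a * w = w * a" for w
  proof -
    have "y * w = w * y" using that by (simp add: y_def algebra_simps)
    then have "z * w = w * z" using z(4) by blast
    then show ?thesis by (simp add: s_def algebra_simps)
  qed
  ultimately show ?thesis by blast
qed

text \<open>The element \<open>x + i w\<close> is \<open>r\<close> times a unitary, and \<open>x\<close>
  is its real part.\<close>

lemma norm_le_of_sum_squares:
  fixes x w :: "'a::cstar_algebra"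
  assumes sa: "cstar x = x" "cstar w = w" and comm: "x * w = w * x"
    and eq: "x * x + w * w = (r * r) *\<^sub>R 1" and r: "r \<ge> 0"
  shows "norm x \<le> r"
proof -
  define u where "u = x + scaleC \<i> w"
  have su: "cstar u = x - scaleC \<i> w"
    by (simp add: u_def cstar_simps sa scaleC_minus_left)
  have "cstar u * u = x * x + w * w"
    unfolding su unfolding u_def
    by (simp add: algebra_simps mult_scaleC_left mult_scaleC_right scaleC_scaleC scaleC_minus_left
        scaleC_diff_right comm)
  then have "(norm u)\<^sup>2 \<le> r\<^sup>2"
    using eq cstar_identity[of u] norm_one_le[where 'a='a] r
      mult_left_mono[of "norm (1::'a)" 1 "r * r"]
    by (simp add: power2_eq_square)
  then have "norm u \<le> r" using r by (rule power2_le_imp_le)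
  moreover have "x + x = u + cstar u" unfolding su by (simp add: u_def)
  then have "2 * norm x \<le> norm u + norm (cstar u)"
    by (metis norm_triangle_ineq norm_scaleR scaleR_2 abs_numeral)
  ultimately show ?thesis by simp
qed

text \<open>After scaling, \<open>1 - h\<^sup>2\<close> has a square root \<open>s\<close> that commutes
  with \<open>h\<close>, and \<open>s\<^sup>2 + h\<^sup>2 = 1\<close> forces
  \<open>s\<close> to have norm at most 1; so \<open>1 - h\<^sup>2 = s\<^sup>2\<close> has
  norm at most 1, which is what positivity of \<open>h\<^sup>2\<close> means.\<close>

lemma cpos_square:
  fixes h :: "'a::cstar_algebra"
  assumes sa: "cstar h = h" shows "cpos (h * h)"
proof -
  define r where "r = norm h + 1"
  have r: "r > 0" using norm_ge_zero[of h] unfolding r_def by linarith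
  \<comment> \<open>Scaling makes the norm at most 1. The summand 1 in \<open>r\<close> covers
    \<open>h = 0\<close>.\<close>
  define g where "g = inverse r *\<^sub>R h"
  have "cstar g = g" unfolding g_def by (simp only: cstar_scaleR sa)
  moreover have "norm g = inverse r * norm h" using r by (simp add: g_def)
  moreover have "inverse r * norm h \<le> inverse r * r"
    using r by (intro mult_left_mono) (auto simp: r_def)
  ultimately have g: "cstar g = g" "norm g \<le> 1" using r by simp_all
  have "norm (g * g) \<le> 1"
    using g norm_square_sa[of g] by (simp add: power_le_one)
  moreover have "cstar (g * g) = g * g" by (simp add: cstar_simps g)
  ultimately obtain z where z: "cstar z = z" "norm z \<le> 1" "(1 - z) * (1 - z) = 1 - g * g"
    "\<forall>w. (g * g) * w = w * (g * g) \<longrightarrow> z * w = w * z"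
    using exists_sqrt_one_minus by blast
  have zg: "z * g = g * z" by (rule z(4)[rule_format]) (simp add: mult.assoc)
  have "norm (1 - z) \<le> 1"
  proof (rule norm_le_of_sum_squares)
    show "cstar (1 - z) = 1 - z" "cstar g = g" by (simp_all add: cstar_diff z(1) g(1))
    show "(1 - z) * g = g * (1 - z)" by (simp add: left_diff_distrib right_diff_distrib zg)
    show "(1 - z) * (1 - z) + g * g = (1 * 1) *\<^sub>R 1" unfolding z(3) by simp
  qed simp
  then have "norm ((1 - z) * (1 - z)) \<le> 1"
    using z norm_square_sa[of "1 - z"] by (simp add: cstar_simps power_le_one)
  then have "norm (1 - g * g) \<le> 1" by (simp only: z(3))
  then have "cpos (g * g)"
    unfolding cpos_def using g by (auto simp: cstar_simps intro!: exI[of _ 1])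
  then show ?thesis
    using r by (simp add: g_def cpos_scale_iff)
qed

lemma cpos_mult_commuting:
  fixes a b :: "'a::cstar_algebra"
  assumes "cpos a" "cpos b" "a * b = b * a" shows "cpos (a * b)"
proof -
  obtain s where s: "cpos s" "s * s = a" "\<forall>w. a * w = w * a \<longrightarrow> s * w = w * s"
    using exists_sqrt[OF assms(1)] by blast
  have sb: "s * b = b * s" by (rule s(3)[rule_format]) (rule assms)
  obtain t where t: "cpos t" "t * t = b" "\<forall>w. b * w = w * b \<longrightarrow> t * w = w * t"
    using exists_sqrt[OF assms(2)] by blast
  have st: "t * s = s * t" by (rule t(3)[rule_format]) (rule sb[symmetric])
  have "cpos ((s * t) * (s * t))"
    by (rule cpos_square) (simp add: cstar_simps cpos_sa s t st)
  also have "(s * t) * (s * t) = a * b"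
    unfolding s(2)[symmetric] t(2)[symmetric] by (metis st mult.assoc)
  finally show ?thesis .
qed

text \<open>The product of \<open>r - x\<close> and \<open>r + x\<close> is positive and has a square
  root \<open>w\<close>, so that \<open>x\<^sup>2 + w\<^sup>2 = r\<^sup>2\<close>. With
  \<open>r = 0\<close> the estimate says that the cone of positive elements contains no line.\<close>

lemma norm_le_of_cpos:
  fixes x :: "'a::cstar_algebra"
  assumes "cpos (r *\<^sub>R 1 - x)" "cpos (r *\<^sub>R 1 + x)" "r \<ge> 0"
  shows "norm x \<le> r"
proof -
  have "cstar ((r *\<^sub>R 1 + x) - r *\<^sub>R 1) = (r *\<^sub>R 1 + x) - r *\<^sub>R 1"
    using cpos_sa[OF assms(2)] by (simp only: cstar_diff cstar_scaleR cstar_one)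
  then have sa: "cstar x = x" by simp
  have p: "cpos ((r *\<^sub>R 1 - x) * (r *\<^sub>R 1 + x))"
    by (rule cpos_mult_commuting[OF assms(1,2)]) (simp add: algebra_simps)
  obtain w where w: "cpos w" "w * w = (r *\<^sub>R 1 - x) * (r *\<^sub>R 1 + x)"
    "\<forall>v. ((r *\<^sub>R 1 - x) * (r *\<^sub>R 1 + x)) * v = v * ((r *\<^sub>R 1 - x) * (r *\<^sub>R 1 + x)) \<longrightarrow> w * v = v * w"
    using exists_sqrt[OF p] by blast
  have "w * x = x * w" by (rule w(3)[rule_format]) (simp add: algebra_simps)
  then show ?thesis
    using w(2) by (intro norm_le_of_sum_squares[of x w]) (simp_all add: sa cpos_sa[OF w(1)] assms algebra_simps)
qed

lemma cpos_antisym: "cpos a \<Longrightarrow> cpos (- a) \<Longrightarrow> a = 0"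
  using norm_le_of_cpos[of 0 a] by simp

text \<open>With \<open>k\<close> the square root of \<open>a\<^sup>2\<close>, the element
  \<open>m = k - a\<close> is twice the negative part of \<open>a\<close>. Compressing
  \<open>a\<close> by \<open>m\<close> cuts out the positive part and leaves a negative cube;
  this is how a failure of positivity is detected below.\<close>

lemma exists_negative_part:
  fixes a :: "'a::cstar_algebra"
  assumes sa: "cstar a = a"
  shows "\<exists>m. cstar m = m \<and> cpos (m * m * m) \<and> m * a * m = - ((1/2) *\<^sub>R (m * m * m)) \<and>
    (m = 0 \<longrightarrow> cpos a)"
proof -
  obtain k where k: "cpos k" "k * k = a * a" "\<forall>w. (a * a) * w = w * (a * a) \<longrightarrow> k * w = w * k"
    using exists_sqrt[OF cpos_square[OF sa]] by blast
  have ka: "k * a = a * k" by (rule k(3)[rule_format]) (simp add: mult.assoc)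
  define m where "m = k - a"
  have msa: "cstar m = m" by (simp add: m_def cstar_simps sa cpos_sa[OF k(1)])
  have ma: "m * a = a * m" by (simp add: m_def ka algebra_simps)
  have km: "k * m = m * k" by (simp add: m_def ka algebra_simps)
  have z: "m * (k + a) = 0" by (simp add: m_def algebra_simps ka k(2))
  have mk: "m * a = - (m * k)" using z by (simp add: distrib_left eq_neg_iff_add_eq_0 add.commute)
  have "m * m = m * k - m * a" by (simp add: m_def algebra_simps)
  then have mm: "m * m = 2 *\<^sub>R (m * k)" using mk by (simp add: scaleR_2)
  have m3: "m * m * m = 2 *\<^sub>R ((m * m) * k)"
    using mm km by (metis mult_scaleR_left mult.assoc)
  have "cpos ((m * m) * k)"
    by (rule cpos_mult_commuting[OF cpos_square[OF msa] k(1)]) (metis km mult.assoc)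
  then have p: "cpos (m * m * m)" unfolding m3 by (rule cpos_scaleR) simp
  have "m * a * m = - (m * k * m)" by (simp add: mk)
  also have "m * k * m = (1/2) *\<^sub>R (m * m * m)" by (simp add: mm)
  finally have "m * a * m = - ((1/2) *\<^sub>R (m * m * m))" .
  moreover have "cpos a" if "m = 0" using that k(1) by (simp add: m_def)
  ultimately show ?thesis using msa p by blast
qed

lemma cube_sa_eq_0:
  fixes m :: "'a::cstar_algebra"
  assumes "cstar m = m" "m * m * m = 0" shows "m = 0"
proof -
  have "(m * m) * (m * m) = 0" using assms(2) by (simp flip: mult.assoc)
  then have "m * m = 0" by (rule square_sa_eq_0[rotated]) (simp add: cstar_mult assms(1))
  then show ?thesis by (rule square_sa_eq_0[OF assms(1)])
qed

text \<open>Writing \<open>d = x + i y\<close> with self-adjoint parts,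
  \<open>d\<^sup>* d + d d\<^sup>* = 2 (x\<^sup>2 + y\<^sup>2)\<close> is positive.\<close>

lemma cpos_swap:
  fixes d :: "'a::cstar_algebra"
  assumes "cpos (- (cstar d * d))" shows "cpos (d * cstar d)"
proof -
  define p where "p = d + cstar d"
  \<comment> \<open>\<open>p\<close> and \<open>- q\<close> are twice the real and the imaginary part of
    \<open>d\<close>.\<close>
  define q where "q = scaleC \<i> (d - cstar d)"
  have sa: "cstar p = p" "cstar q = q"
    by (simp_all add: p_def q_def cstar_simps add.commute scaleC_minus_left flip: scaleC_minus_right)
  have "p * p + q * q = 2 *\<^sub>R (cstar d * d + d * cstar d)"
    by (simp add: p_def q_def mult_scaleC_left mult_scaleC_right scaleC_scaleC scaleC_minus_left
        scaleC_diff_right algebra_simps scaleR_2)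
  then have "d * cstar d = (1/2) *\<^sub>R (p * p + q * q) + - (cstar d * d)" by simp
  moreover have "cpos ((1/2) *\<^sub>R (p * p + q * q))"
    using sa by (intro cpos_scaleR cpos_add cpos_square) auto
  ultimately show ?thesis using assms by (metis cpos_add)
qed

text \<open>Apply \<open>cpos_swap\<close> not to \<open>d\<close> but to \<open>f = l d\<^sup>*\<close>,
  where \<open>l\<^sup>2 = g = - d\<^sup>* d\<close>. Then \<open>- f\<^sup>* f\<close>
  is the square of \<open>d d\<^sup>*\<close>, so \<open>f f\<^sup>*\<close> is positive; but
  \<open>f f\<^sup>* = - g\<^sup>2\<close>, and thus \<open>g = 0\<close>. The usual
  argument compares the spectra of \<open>d\<^sup>* d\<close> and \<open>d d\<^sup>*\<close>
  at this point.\<close>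

lemma cstar_mult_self_not_neg:
  fixes d :: "'a::cstar_algebra"
  assumes "cpos (- (cstar d * d))" shows "d = 0"
proof -
  define g where "g = - (cstar d * d)"
  obtain l where l: "cpos l" "l * l = g" "\<forall>w. g * w = w * g \<longrightarrow> l * w = w * l"
    using exists_sqrt[OF assms] unfolding g_def by blast
  define f where "f = l * cstar d"
  have sf: "cstar f = d * l" by (simp add: f_def cstar_simps cpos_sa[OF l(1)])
  have "- (cstar f * f) = (d * cstar d) * (d * cstar d)"
  proof -
    have "cstar f * f = d * (l * l) * cstar d" unfolding sf by (simp add: f_def mult.assoc)
    then show ?thesis unfolding l(2) by (simp add: g_def mult.assoc)
  qed
  moreover have "cpos ((d * cstar d) * (d * cstar d))"
    by (rule cpos_square) (simp add: cstar_simps)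
  ultimately have "cpos (f * cstar f)" by (intro cpos_swap) simp
  also have "f * cstar f = - (g * g)"
  proof -
    have "f * cstar f = - (l * g * l)" unfolding sf by (simp add: f_def g_def mult.assoc)
    then show ?thesis using l(2) by (metis mult.assoc)
  qed
  finally have n: "cpos (- (g * g))" .
  have gsa: "cstar g = g" by (simp add: g_def cstar_simps)
  have "g * g = 0" by (rule cpos_antisym[OF cpos_square[OF gsa] n])
  then have "g = 0" by (rule square_sa_eq_0[OF gsa])
  then show ?thesis using cstar_identity[of d] by (simp add: g_def)
qed

text \<open>Compressing \<open>c\<^sup>* c\<close> by its negative part \<open>m\<close> gives
  \<open>(c m)\<^sup>* (c m)\<close>, which is minus a positive element; hence
  \<open>c m = 0\<close> and the negative part vanishes.\<close>

theorem cpos_cstar_mult_self: "cpos (cstar c * (c::'a::cstar_algebra))"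
proof -
  have "cstar (cstar c * c) = cstar c * c" by (simp add: cstar_simps)
  then obtain m where m: "cstar m = m" "cpos (m * m * m)"
    "m * (cstar c * c) * m = - ((1/2) *\<^sub>R (m * m * m))" "m = 0 \<longrightarrow> cpos (cstar c * c)"
    using exists_negative_part[of "cstar c * c"] by blast
  have eq: "- (cstar (c * m) * (c * m)) = (1/2) *\<^sub>R (m * m * m)"
    using m(3) by (simp add: cstar_simps m(1) mult.assoc)
  then have "cpos (- (cstar (c * m) * (c * m)))"
    using m(2) by (simp add: cpos_scaleR)
  then have "c * m = 0" by (rule cstar_mult_self_not_neg)
  then have "m * m * m = 0" using eq by simp
  then show ?thesis using m cube_sa_eq_0 by blast
qed

lemma cpos_sandwich:
  fixes a :: "'a::cstar_algebra"
  assumes "cpos a" shows "cpos (cstar b * a * b)"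
proof -
  obtain s where s: "cpos s" "s * s = a" using exists_sqrt[OF assms] by blast
  have "cpos (cstar (s * b) * (s * b))" by (rule cpos_cstar_mult_self)
  also have "cstar (s * b) * (s * b) = cstar b * a * b"
    unfolding s(2)[symmetric] by (simp add: cstar_simps cpos_sa[OF s(1)] mult.assoc)
  finally show ?thesis .
qed

locale star_endomorphism =
  fixes \<alpha> :: "'a::cstar_algebra \<Rightarrow> 'a"
  assumes endo: "unital_star_endomorphism \<alpha>"
begin

lemma hom_add: "\<alpha> (a + b) = \<alpha> a + \<alpha> b"
  and hom_scaleC: "\<alpha> (scaleC c a) = scaleC c (\<alpha> a)"
  and hom_mult: "\<alpha> (a * b) = \<alpha> a * \<alpha> b"
  and hom_cstar: "\<alpha> (cstar a) = cstar (\<alpha> a)"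
  and hom_one: "\<alpha> 1 = 1"
  using endo by (auto simp: unital_star_endomorphism_def)

lemma hom_zero: "\<alpha> 0 = 0"
  using hom_add[of 0 0] by simp

lemma hom_scaleR: "\<alpha> (r *\<^sub>R a) = r *\<^sub>R \<alpha> a"
  by (simp add: scaleR_scaleC hom_scaleC)

lemma hom_minus: "\<alpha> (- a) = - \<alpha> a"
  using hom_add[of a "- a"] by (simp add: hom_zero eq_neg_iff_add_eq_0 add.commute)

lemma hom_sum: "\<alpha> (sum f F) = (\<Sum>i\<in>F. \<alpha> (f i))"
  by (induction F rule: infinite_finite_induct) (simp_all add: hom_add hom_zero)

lemma hom_cpos:
  assumes "cpos a" shows "cpos (\<alpha> a)"
proof -
  obtain s where s: "cpos s" "s * s = a" using exists_sqrt[OF assms] by blast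
  have "cpos (\<alpha> s * \<alpha> s)"
    by (rule cpos_square) (simp add: cpos_sa[OF s(1)] flip: hom_cstar)
  then show ?thesis using s(2) by (simp flip: hom_mult)
qed

end

locale injective_star_endomorphism = star_endomorphism +
  assumes inj: "inj \<alpha>"
begin

text \<open>The negative part \<open>m\<close> of \<open>a\<close> is defined by algebraic relations, which
  \<open>\<alpha>\<close> preserves. If \<open>\<alpha>(a)\<close> is positive then so is its
  compression by \<open>\<alpha>(m)\<close>, which is a negative multiple of
  \<open>\<alpha>(m\<^sup>3)\<close>; so \<open>\<alpha>(m\<^sup>3) = 0\<close>, and
  injectivity gives \<open>m = 0\<close>.\<close>

lemma hom_cpos_iff: "cpos (\<alpha> a) \<longleftrightarrow> cpos a"
proof
  assume p: "cpos (\<alpha> a)"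
  have "\<alpha> (cstar a) = \<alpha> a" by (simp add: hom_cstar cpos_sa[OF p])
  then have "cstar a = a" using inj by (simp add: inj_eq)
  then obtain m where m: "cstar m = m" "cpos (m * m * m)"
    "m * a * m = - ((1/2) *\<^sub>R (m * m * m))" "m = 0 \<longrightarrow> cpos a"
    using exists_negative_part[of a] by blast
  have "cpos (cstar (\<alpha> m) * \<alpha> a * \<alpha> m)" by (rule cpos_sandwich[OF p])
  also have "cstar (\<alpha> m) * \<alpha> a * \<alpha> m = \<alpha> (m * a * m)"
    by (simp add: hom_mult m(1) flip: hom_cstar)
  also have "\<dots> = (1/2) *\<^sub>R (- \<alpha> (m * m * m))"
    unfolding m(3) by (simp add: hom_minus hom_scaleR)
  finally have "cpos (- \<alpha> (m * m * m))" by (simp only: cpos_scale_iff)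
  with hom_cpos[OF m(2)] have "\<alpha> (m * m * m) = 0" by (rule cpos_antisym)
  then have "m * m * m = 0" using inj hom_zero by (metis injD)
  then show "cpos a" using m cube_sa_eq_0 by blast
qed (rule hom_cpos)

end

text \<open>Up to a scalar, \<open>c + e\<close> is \<open>1 - y\<close> with \<open>y\<close> of norm
  below 1. The Neumann series is replaced by Banach's fixed point theorem for
  \<open>q = 1 + y q\<close>, on the closed set of self-adjoint elements that commute with
  \<open>y\<close>.\<close>

lemma exists_inverse_shift:
  fixes c :: "'a::cstar_algebra"
  assumes "cpos c" "e > 0"
  obtains q where "cstar q = q" "q * (c + e *\<^sub>R 1) = 1" "(c + e *\<^sub>R 1) * q = 1"
proof -
  obtain t where t: "t \<ge> 0" "norm (t *\<^sub>R 1 - c) \<le> t" and sa: "cstar c = c"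
    using assms unfolding cpos_def by blast
  define s where "s = inverse (t + e)"
  have s: "s > 0" "s * t < 1" using t assms by (auto simp: s_def divide_simps)
  define y where "y = s *\<^sub>R (t *\<^sub>R 1 - c)"
  have ny: "norm y \<le> s * t" using t s by (simp add: y_def)
  have ysa: "cstar y = y" by (simp add: y_def cstar_simps sa)
  have y1: "1 - y = s *\<^sub>R (c + e *\<^sub>R 1)"
    using s(1) t assms by (simp add: y_def algebra_simps s_def flip: scaleR_add_left)
      (simp add: divide_simps flip: scaleR_add_left)
  define S where "S = {q. cstar q = q \<and> y * q = q * y}"
  have "closed S"
  proof (rule closed_sequential_limits[THEN iffD2], intro allI impI)
    fix x l assume x: "(\<forall>n. x n \<in> S) \<and> x \<longlonglongrightarrow> l"
    have "(\<lambda>n. norm (x n - l)) \<longlonglongrightarrow> 0" using x by (simp add: LIM_zero_iff tendsto_norm_zero_iff)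
    moreover have "norm (x n - l) = norm (x n - cstar l)" for n
      using norm_cstar[of "x n - l"] x by (simp add: cstar_simps S_def)
    ultimately have "x \<longlonglongrightarrow> cstar l" by (simp add: LIM_zero_iff tendsto_norm_zero_iff)
    then have "cstar l = l" using x LIMSEQ_unique by blast
    moreover have "y * l = l * y"
    proof (rule LIMSEQ_unique)
      show "(\<lambda>n. y * x n) \<longlonglongrightarrow> y * l" using x by (intro tendsto_intros) auto
      have "y * x n = x n * y" for n using x by (simp add: S_def)
      then show "(\<lambda>n. y * x n) \<longlonglongrightarrow> l * y" using x by (auto intro!: tendsto_intros)
    qed
    ultimately show "l \<in> S" by (simp add: S_def)
  qed
  then have "\<exists>!q\<in>S. 1 + y * q = q"
  proof (intro Banach_fix[where c = "s * t"])
    show "complete S" using \<open>closed S\<close> by (simp add: complete_eq_closed)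
    have "0 \<in> S" by (simp add: S_def)
    then show "S \<noteq> {}" by blast
    show "0 \<le> s * t" "s * t < 1" using s t by auto
    show "(\<lambda>q. 1 + y * q) ` S \<subseteq> S"
    proof -
      have "y * (1 + y * q) = (1 + y * q) * y" if "y * q = q * y" for q
        using that by (simp add: distrib_left distrib_right) (metis mult.assoc)
      then show ?thesis
        by (auto simp: S_def cstar_add cstar_mult ysa)
    qed
    fix q r assume "q \<in> S" "r \<in> S"
    have "dist (1 + y * q) (1 + y * r) = norm (y * (q - r))" by (simp add: dist_norm algebra_simps)
    also have "\<dots> \<le> norm y * norm (q - r)" by (rule norm_mult_ineq)
    also have "\<dots> \<le> (s * t) * dist q r" using ny by (simp add: dist_norm mult_right_mono)
    finally show "dist (1 + y * q) (1 + y * r) \<le> s * t * dist q r" .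
  qed
  then obtain q where q: "cstar q = q" "y * q = q * y" "1 + y * q = q"
    unfolding S_def by blast
  have "q - y * q = 1" using q(3) by (metis add_diff_cancel_right')
  then have "(1 - y) * q = 1" "q * (1 - y) = 1"
    using q(2) by (simp_all add: left_diff_distrib right_diff_distrib)
  then have "(c + e *\<^sub>R 1) * (s *\<^sub>R q) = 1" "(s *\<^sub>R q) * (c + e *\<^sub>R 1) = 1"
    unfolding y1 by simp_all
  moreover have "cstar (s *\<^sub>R q) = s *\<^sub>R q" by (simp add: cstar_simps q)
  ultimately show thesis using that by blast
qed

section \<open>The Riesz extension theorem and positive matrices\<close>

text \<open>Matrices over \<open>A\<close>, with an arbitrary index set, are functions on pairs of indices;
  the extension theorem is applied to the real vector space of these.\<close>

instantiation "fun" :: (type, real_vector) real_vector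
begin
definition "r *\<^sub>R f = (\<lambda>x. r *\<^sub>R f x)"
instance
  by standard (simp_all add: scaleR_fun_def fun_eq_iff algebra_simps)
end

lemma scaleR_fun_apply: "(r *\<^sub>R f) x = r *\<^sub>R f x"
  by (simp add: scaleR_fun_def)

text \<open>The extension theorem of M. Riesz, for functionals given by their graphs. A graph is a subspace
  of \<open>X \<times> \<real>\<close> on which the second coordinate is nonnegative whenever
  the first lies in the cone \<open>P\<close>; working with graphs keeps the use of Zorn's lemma
  free of partial functions. The last conclusion says that the extension is defined at each
  \<open>x\<close> that is bounded from both sides, modulo \<open>P\<close>, by elements of the
  original domain.\<close>

theorem riesz_extension:
  fixes P :: "'x::real_vector set" and G0 :: "('x \<times> real) set"
  assumes P_add: "\<And>x y. x \<in> P \<Longrightarrow> y \<in> P \<Longrightarrow> x + y \<in> P"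
    and P_scale: "\<And>r x. r > 0 \<Longrightarrow> x \<in> P \<Longrightarrow> r *\<^sub>R x \<in> P"
    and G0: "subspace G0" "\<And>x t. (x, t) \<in> G0 \<Longrightarrow> x \<in> P \<Longrightarrow> 0 \<le> t"
  obtains G where "G0 \<subseteq> G" "subspace G" "\<And>x t. (x, t) \<in> G \<Longrightarrow> x \<in> P \<Longrightarrow> 0 \<le> t"
    "\<And>x m s n t. (m, s) \<in> G0 \<Longrightarrow> m - x \<in> P \<Longrightarrow> (n, t) \<in> G0 \<Longrightarrow> x - n \<in> P
      \<Longrightarrow> \<exists>c. (x, c) \<in> G"
proof -
  define A where "A = {G. G0 \<subseteq> G \<and> subspace G \<and> (\<forall>x t. (x, t) \<in> G \<longrightarrow> x \<in> P \<longrightarrow> 0 \<le> t)}"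
  have "\<exists>G\<in>A. \<forall>G'\<in>A. G \<subseteq> G' \<longrightarrow> G' = G"
  proof (rule subset_Zorn_nonempty)
    show "A \<noteq> {}" using G0 by (auto simp: A_def)
    fix C assume "C \<noteq> {}" and C: "subset.chain A C"
    have CA: "C \<subseteq> A" using C by (simp add: subset_chain_def)
    have tot: "X \<subseteq> Y \<or> Y \<subseteq> X" if "X \<in> C" "Y \<in> C" for X Y
      using C that by (auto simp: subset_chain_def)
    have "subspace (\<Union>C)"
    proof (rule subspaceI)
      show "0 \<in> \<Union>C" using \<open>C \<noteq> {}\<close> CA by (auto simp: A_def dest: subspace_0)
      fix u v assume "u \<in> \<Union>C" "v \<in> \<Union>C"
      then obtain X Y where "X \<in> C" "u \<in> X" "Y \<in> C" "v \<in> Y" by blast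
      then obtain Z where "Z \<in> C" "u \<in> Z" "v \<in> Z" using tot by blast
      then show "u + v \<in> \<Union>C" using CA by (auto simp: A_def intro: subspace_add)
    next
      fix r :: real and u assume "u \<in> \<Union>C"
      then show "r *\<^sub>R u \<in> \<Union>C" using CA by (auto simp: A_def intro: subspace_scale)
    qed
    then show "\<Union>C \<in> A" using \<open>C \<noteq> {}\<close> CA by (fastforce simp: A_def)
  qed
  then obtain G where GA: "G \<in> A" and max: "\<And>G'. G' \<in> A \<Longrightarrow> G \<subseteq> G' \<Longrightarrow> G' = G"
    by blast
  have sub: "G0 \<subseteq> G" "subspace G" and pos: "\<And>x t. (x, t) \<in> G \<Longrightarrow> x \<in> P \<Longrightarrow> 0 \<le> t"
    using GA by (auto simp: A_def)
  have dom: "\<exists>c. (x, c) \<in> G"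
    if m: "(m, s) \<in> G0" "m - x \<in> P" and n: "(n, t) \<in> G0" "x - n \<in> P" for x m s n t
  proof -
    define L where "L = {t. \<exists>n. (n, t) \<in> G \<and> x - n \<in> P}"
    \<comment> \<open>Any value between the lower bounds \<open>L\<close> and the upper bounds for
      \<open>x\<close> can serve; the supremum of the former is one.\<close>
    define c where "c = Sup L"
    have le: "t' \<le> s'" if "(n', t') \<in> G" "x - n' \<in> P" "(m', s') \<in> G" "m' - x \<in> P" for m' s' n' t'
    proof -
      have "(m', s') - (n', t') \<in> G" using that sub by (intro subspace_diff)
      moreover have "(m' - x) + (x - n') \<in> P" using that by (intro P_add)
      ultimately show ?thesis using pos[of "m' - n'" "s' - t'"] by simp
    qed
    have "L \<noteq> {}" using n sub by (auto simp: L_def)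
    moreover have "bdd_above L"
      using m sub le by (intro bdd_aboveI[of _ s]) (auto simp: L_def)
    ultimately have lower: "t' \<le> c" if "(n', t') \<in> G" "x - n' \<in> P" for n' t'
      using that unfolding c_def by (intro cSup_upper) (auto simp: L_def)
    have upper: "c \<le> s'" if "(m', s') \<in> G" "m' - x \<in> P" for m' s'
      unfolding c_def using \<open>L \<noteq> {}\<close> that le by (intro cSup_least) (auto simp: L_def)
    define G' where "G' = {g + r *\<^sub>R (x, c) | g r. g \<in> G}"
    have GG': "G \<subseteq> G'"
    proof
      fix g assume "g \<in> G"
      then have "g + 0 *\<^sub>R (x, c) \<in> G'" unfolding G'_def by blast
      then show "g \<in> G'" by (simp del: scaleR_Pair)
    qed
    have "subspace G'"
    proof (rule subspaceI)
      show "0 \<in> G'" using GG' sub subspace_0 by blast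
      fix u v assume "u \<in> G'" "v \<in> G'"
      then obtain g r h q where uv: "u = g + r *\<^sub>R (x, c)" "v = h + q *\<^sub>R (x, c)" "g \<in> G" "h \<in> G"
        unfolding G'_def by blast
      have "u + v = (g + h) + (r + q) *\<^sub>R (x, c)" unfolding uv by (simp add: algebra_simps)
      moreover have "g + h \<in> G" using uv sub by (intro subspace_add)
      ultimately show "u + v \<in> G'" unfolding G'_def by blast
    next
      fix a :: real and u assume "u \<in> G'"
      then obtain g r where u: "u = g + r *\<^sub>R (x, c)" "g \<in> G" unfolding G'_def by blast
      have "a *\<^sub>R u = a *\<^sub>R g + (a * r) *\<^sub>R (x, c)" unfolding u by (simp add: algebra_simps)
      moreover have "a *\<^sub>R g \<in> G" using u sub by (intro subspace_scale)
      ultimately show "a *\<^sub>R u \<in> G'" unfolding G'_def by blast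
    qed
    moreover have "0 \<le> u" if yu: "(y, u) \<in> G'" "y \<in> P" for y u
    proof -
      obtain n' t' r where g: "(n', t') \<in> G" "y = n' + r *\<^sub>R x" "u = t' + r * c"
      proof -
        obtain g r where "g \<in> G" "(y, u) = g + r *\<^sub>R (x, c)"
          using yu(1) unfolding G'_def by blast
        then show thesis by (intro that[of "fst g" "snd g" r]) (auto simp: prod_eq_iff)
      qed
      have scale: "(q *\<^sub>R n', q * t') \<in> G" for q
        using subspace_scale[OF sub(2) g(1), of q] by simp
      consider "r = 0" | "r > 0" | "r < 0" by linarith
      then show ?thesis
      proof cases
        case 1 then show ?thesis using g that pos by simp
      next
        case 2
        have "x - (- inverse r) *\<^sub>R n' = inverse r *\<^sub>R y"
          using 2 by (simp add: g algebra_simps)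
        also have "\<dots> \<in> P" using 2 that by (intro P_scale) auto
        finally have "- inverse r * t' \<le> c" by (intro lower[OF scale])
        then show ?thesis using 2 by (simp add: g field_simps)
      next
        case 3
        have "(- inverse r) *\<^sub>R n' - x = (- inverse r) *\<^sub>R y"
          using 3 by (simp add: g algebra_simps)
        also have "\<dots> \<in> P" using 3 that by (intro P_scale) auto
        finally have "c \<le> - inverse r * t'" by (intro upper[OF scale])
        then show ?thesis using 3 by (simp add: g field_simps)
      qed
    qed
    ultimately have "G' \<in> A" using sub GG' unfolding A_def by blast
    then have "G' = G" using GG' by (rule max)
    moreover have "0 + 1 *\<^sub>R (x, c) \<in> G'"
      unfolding G'_def using subspace_0[OF sub(2)] by blast
    ultimately show ?thesis by auto
  qed
  show thesis by (rule that[OF sub pos dom])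
qed

text \<open>The coefficients
  \<open>\<phi> i j a = \<langle>\<rho>(a) e\<^sub>i, e\<^sub>j\<rangle>\<close> of a
  *-representation \<open>\<rho>\<close> have these properties: the double sum in the positivity
  condition is the squared norm of \<open>\<Sum> \<rho>(a) e\<^sub>i\<close>. It ranges over
  lists, in which an index may be repeated, so that substituting indices preserves it trivially.\<close>

definition cp_kernel :: "('i \<Rightarrow> 'i \<Rightarrow> 'a::cstar_algebra \<Rightarrow> complex) \<Rightarrow> bool" where
  "cp_kernel \<phi> \<longleftrightarrow>
     (\<forall>i j a b. \<phi> i j (a + b) = \<phi> i j a + \<phi> i j b) \<and>
     (\<forall>i j c a. \<phi> i j (scaleC c a) = c * \<phi> i j a) \<and>
     (\<forall>i j a. \<phi> j i (cstar a) = cnj (\<phi> i j a)) \<and>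
     (\<forall>xs. 0 \<le> Re (\<Sum>(i, a)\<leftarrow>xs. \<Sum>(j, b)\<leftarrow>xs. \<phi> i j (cstar b * a)))"

context
  fixes \<phi> :: "'i \<Rightarrow> 'i \<Rightarrow> 'a::cstar_algebra \<Rightarrow> complex"
  assumes cp: "cp_kernel \<phi>"
begin

lemma cp_add: "\<phi> i j (a + b) = \<phi> i j a + \<phi> i j b"
  and cp_scaleC: "\<phi> i j (scaleC c a) = c * \<phi> i j a"
  and cp_cstar: "\<phi> j i (cstar a) = cnj (\<phi> i j a)"
  and cp_pos: "0 \<le> Re (\<Sum>(i, a)\<leftarrow>xs. \<Sum>(j, b)\<leftarrow>xs. \<phi> i j (cstar b * a))"
  using cp unfolding cp_kernel_def by blast+

lemma cp_zero: "\<phi> i j 0 = 0"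
  using cp_scaleC[of i j 0 0] by simp

lemma cp_scaleR: "\<phi> i j (r *\<^sub>R a) = r * \<phi> i j a"
  by (simp add: scaleR_scaleC cp_scaleC)

lemma cp_minus: "\<phi> i j (- a) = - \<phi> i j a"
  using cp_scaleR[of i j "-1" a] by simp

lemma cp_diff: "\<phi> i j (a - b) = \<phi> i j a - \<phi> i j b"
  using cp_add[of i j a "- b"] by (simp add: cp_minus)

lemma cp_pos_set:
  assumes "finite F"
  shows "0 \<le> Re (\<Sum>i\<in>F. \<Sum>j\<in>F. \<phi> i j (cstar (b j) * b i))"
proof -
  obtain l where l: "distinct l" "set l = F" using finite_distinct_list[OF assms] by blast
  show ?thesis
    using cp_pos[of "map (\<lambda>i. (i, b i)) l"] l
    by (simp add: o_def split_def sum_list_distinct_conv_sum_set)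
qed

end

text \<open>The value at the column \<open>d\<close> of the \<open>A\<close>-valued quadratic form of the
  matrix \<open>C\<close>. The entry at \<open>i, j\<close> stands to the right of
  \<open>d\<^sub>j\<^sup>*\<close> and to the left of \<open>d\<^sub>i\<close>, which matches
  \<open>\<phi> i j (b\<^sub>j\<^sup>* b\<^sub>i)\<close>.\<close>

definition mat_form :: "'i set \<Rightarrow> ('i \<Rightarrow> 'i \<Rightarrow> 'a::cstar_algebra) \<Rightarrow> ('i \<Rightarrow> 'a) \<Rightarrow> 'a" where
  "mat_form F C d = (\<Sum>i\<in>F. \<Sum>j\<in>F. cstar (d j) * C i j * d i)"

text \<open>Cholesky factorisation, by induction on the index set. The diagonal entry at the new index
  \<open>k\<close> is made invertible by adding \<open>e\<close>. The matrix then splits into a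
  square \<open>B\<^sub>j\<^sup>* B\<^sub>i\<close> that accounts for the whole row and column
  of \<open>k\<close>, and the Schur complement \<open>C'\<close>, which lives on the remaining
  indices. The kernel is nonnegative on the square by complete positivity and on the Schur
  complement by induction; finally \<open>e\<close> tends to 0.\<close>

lemma cp_kernel_positive_matrix:
  fixes \<phi> :: "'i \<Rightarrow> 'i \<Rightarrow> 'a::cstar_algebra \<Rightarrow> complex"
  assumes cp: "cp_kernel \<phi>" and fin: "finite F"
    and herm: "\<And>i j. cstar (C i j) = C j i"
    and pos: "\<And>d. cpos (mat_form F C d)"
  shows "0 \<le> Re (\<Sum>i\<in>F. \<Sum>j\<in>F. \<phi> i j (C i j))"
  using fin herm pos
proof (induction F arbitrary: C)
  case empty
  then show ?case by simp
next
  case (insert k F C)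
  note herm = insert.prems(1) and pos = insert.prems(2)
  have ins: "(\<Sum>i\<in>insert k F. \<Sum>j\<in>insert k F. g i j)
      = g k k + (\<Sum>j\<in>F. g k j) + ((\<Sum>i\<in>F. g i k) + (\<Sum>i\<in>F. \<Sum>j\<in>F. g i j))"
    for g :: "'i \<Rightarrow> 'i \<Rightarrow> 'b::ab_group_add"
    using insert.hyps by (simp add: sum.distrib)
  have ne: "i \<noteq> k" if "i \<in> F" for i using that insert.hyps by auto
  have "cpos (mat_form (insert k F) C (\<lambda>i. if i = k then 1 else 0))" by (rule pos)
  also have "mat_form (insert k F) C (\<lambda>i. if i = k then 1 else 0) = C k k"
    unfolding mat_form_def ins by (simp add: ne cong: sum.cong)
  finally have coo: "cpos (C k k)" .
  have main: "0 \<le> Re (\<Sum>i\<in>insert k F. \<Sum>j\<in>insert k F. \<phi> i j (C i j)) + e * Re (\<phi> k k 1)"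
    if e: "e > 0" for e
  proof -
    define p where "p = C k k + e *\<^sub>R 1"
    obtain q where q: "cstar q = q" "q * p = 1" "p * q = 1"
      using exists_inverse_shift[OF coo e] unfolding p_def by blast
    have "cpos (e *\<^sub>R 1)" using cpos_scaleR[OF cpos_square[of 1], of e] e by simp
    then have "cpos p" unfolding p_def by (intro cpos_add coo)
    then obtain u where u: "cpos u" "u * u = p" "\<forall>w. p * w = w * p \<longrightarrow> u * w = w * u"
      using exists_sqrt by blast
    have usa: "cstar u = u" by (rule cpos_sa[OF u(1)])
    have uq: "u * q = q * u" using u(3) q by auto
    have uuq: "u * (u * q) = 1" "q * u * u = 1" using q u(2) by (simp_all add: mult.assoc) (simp flip: mult.assoc)
    \<comment> \<open>The Schur complement of the pivot \<open>p\<close>, and the row of the square. Off the pivot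
      the row is \<open>p\<^sup>-\<^sup>1\<^sup>/\<^sup>2 C\<^sub>i\<^sub>k\<close>, with
      \<open>p\<^sup>-\<^sup>1\<^sup>/\<^sup>2 = u q\<close>.\<close>
    define C' where "C' i j = C i j - C k j * q * C i k" for i j
    define B where "B i = (if i = k then u else u * q * C i k)" for i
    have B1: "cstar (B k) * B k = p" by (simp add: B_def usa u(2))
    have B2: "cstar (B j) * B k = C k j" if "j \<noteq> k" for j
      using that by (simp add: B_def cstar_simps usa q herm) (metis uuq(2) mult.assoc mult_1_right uq)
    have B3: "cstar (B k) * B i = C i k" if "i \<noteq> k" for i
      using that by (simp add: B_def usa) (metis uuq(1) mult.assoc mult_1_left)
    have B4: "cstar (B j) * B i = C i j - C' i j" if "i \<noteq> k" "j \<noteq> k" for i j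
    proof -
      have "cstar (B j) * B i = C k j * q * (u * (u * q)) * C i k"
        using that by (simp add: B_def cstar_simps usa q herm mult.assoc)
      then show ?thesis by (simp add: uuq C'_def)
    qed
    have "0 \<le> Re (\<Sum>i\<in>F. \<Sum>j\<in>F. \<phi> i j (C' i j))"
    proof (rule insert.IH)
      show "cstar (C' i j) = C' j i" for i j
        by (simp add: C'_def cstar_simps herm q mult.assoc)
      show "cpos (mat_form F C' d)" for d
      proof -
        define h where "h = (\<Sum>i\<in>F. C i k * d i)"
        \<comment> \<open>This value at \<open>k\<close> minimises the form of \<open>C\<close>, with
          \<open>p\<close> as pivot, over all columns extending \<open>d\<close>; the
          minimum is the form of the Schur complement.\<close>
        define d' where "d' = d(k := - (q * h))"
        have d'k: "d' k = - (q * h)" and d'F: "i \<in> F \<Longrightarrow> d' i = d i" for i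
          using insert.hyps by (auto simp: d'_def)
        have ch: "(\<Sum>j\<in>F. cstar (d j) * C k j) = cstar h"
          by (simp add: h_def cstar_sum cstar_simps herm)
        have "mat_form (insert k F) C d' = cstar (d' k) * C k k * d' k
            + (\<Sum>j\<in>F. cstar (d j) * C k j) * d' k
            + (cstar (d' k) * h + (\<Sum>i\<in>F. \<Sum>j\<in>F. cstar (d j) * C i j * d i))"
          unfolding mat_form_def ins h_def
          by (simp add: d'F sum_distrib_left sum_distrib_right mult.assoc)
        also have "\<dots> = cstar h * q * C k k * q * h - cstar h * q * h - cstar h * q * h
            + mat_form F C d"
          unfolding ch d'k mat_form_def by (simp add: cstar_simps q mult.assoc)
        also have "C k k = p - e *\<^sub>R 1" by (simp add: p_def)
        also have "cstar h * q * (p - e *\<^sub>R 1) * q * h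
            = cstar h * (q * p) * q * h - e *\<^sub>R (cstar (q * h) * (q * h))"
          by (simp add: cstar_simps q algebra_simps)
        also have "cstar h * (q * p) * q * h = cstar h * q * h" by (simp add: q)
        finally have A: "mat_form (insert k F) C d' + e *\<^sub>R (cstar (q * h) * (q * h))
            = mat_form F C d - cstar h * q * h" by simp
        have "cstar h * q * h = (\<Sum>i\<in>F. \<Sum>j\<in>F. cstar (d j) * (C k j * q * C i k) * d i)"
          unfolding ch[symmetric] unfolding h_def
          by (simp add: sum_distrib_left sum_distrib_right mult.assoc)
        then have "mat_form F C' d = mat_form F C d - cstar h * q * h"
          by (simp add: mat_form_def C'_def algebra_simps sum_subtractf)
        then show ?thesis
          unfolding A[symmetric]
          using e by (auto intro!: cpos_add pos cpos_scaleR cpos_cstar_mult_self)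
      qed
    qed
    moreover have "0 \<le> Re (\<Sum>i\<in>insert k F. \<Sum>j\<in>insert k F. \<phi> i j (cstar (B j) * B i))"
      using insert.hyps by (intro cp_pos_set[OF cp]) auto
    moreover have "(\<Sum>i\<in>insert k F. \<Sum>j\<in>insert k F. \<phi> i j (cstar (B j) * B i))
        = \<phi> k k p + (\<Sum>j\<in>F. \<phi> k j (C k j)) + ((\<Sum>i\<in>F. \<phi> i k (C i k))
          + (\<Sum>i\<in>F. \<Sum>j\<in>F. \<phi> i j (C i j - C' i j)))"
    proof -
      show ?thesis unfolding ins by (simp add: ne B1 B2 B3 B4 cong: sum.cong)
    qed
    moreover have "\<phi> k k p = \<phi> k k (C k k) + e * \<phi> k k 1"
      by (simp add: p_def cp_add[OF cp] cp_scaleR[OF cp])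
    ultimately show ?thesis
      unfolding ins by (simp add: cp_diff[OF cp] sum_subtractf)
  qed
  show ?case
  proof (rule ccontr)
    let ?S = "Re (\<Sum>i\<in>insert k F. \<Sum>j\<in>insert k F. \<phi> i j (C i j))" and ?m = "Re (\<phi> k k 1)"
    assume "\<not> 0 \<le> ?S"
    then have neg: "?S < 0" by simp
    \<comment> \<open>Small enough for the perturbation to be at most half of the assumed negative value.\<close>
    define e where "e = - ?S / (2 * (\<bar>?m\<bar> + 1))"
    have e: "e > 0" unfolding e_def using neg by (intro divide_pos_pos) (linarith, simp add: add_nonneg_pos)
    have "e * ?m \<le> e * (\<bar>?m\<bar> + 1)" using e by (intro mult_left_mono) auto
    also have "\<dots> = - ?S / 2" by (simp add: e_def field_simps)
    finally show False using main[OF e] neg by simp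
  qed
qed

section \<open>Extension of completely positive kernels along an injective endomorphism\<close>

lemma subspace_sum_list_Pair:
  assumes "subspace G" "\<And>x. x \<in> set xs \<Longrightarrow> (f x, g x) \<in> G"
  shows "(\<Sum>x\<leftarrow>xs. f x, \<Sum>x\<leftarrow>xs. g x) \<in> G"
  using assms(2)
proof (induction xs)
  case Nil
  then show ?case using subspace_0[OF assms(1)] by (simp flip: zero_prod_def)
next
  case (Cons x xs)
  then have "(f x, g x) + (\<Sum>x\<leftarrow>xs. f x, \<Sum>x\<leftarrow>xs. g x) \<in> G"
    by (intro subspace_add[OF assms(1)]) auto
  then show ?case by simp
qed

definition matrix_unit :: "'i \<Rightarrow> 'i \<Rightarrow> 'a \<Rightarrow> 'i \<times> 'i \<Rightarrow> 'a::cstar_algebra" where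
  "matrix_unit i j a = (\<lambda>p. if p = (i, j) then a else 0)"

lemma matrix_unit_add: "matrix_unit i j (a + b) = matrix_unit i j a + matrix_unit i j b"
  and matrix_unit_scaleR: "matrix_unit i j (r *\<^sub>R a) = r *\<^sub>R matrix_unit i j a"
  by (auto simp: matrix_unit_def fun_eq_iff scaleR_fun_apply)

definition pform :: "'i set \<Rightarrow> ('i \<Rightarrow> 'a) \<Rightarrow> ('i \<times> 'i \<Rightarrow> 'a) \<Rightarrow> 'a::cstar_algebra" where
  "pform F d M = mat_form F (\<lambda>i j. M (i, j)) d"

lemma pform_add: "pform F d (M + N) = pform F d M + pform F d N"
  by (simp add: pform_def mat_form_def algebra_simps sum.distrib)

lemma pform_zero: "pform F d 0 = 0"
  by (simp add: pform_def mat_form_def)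

lemma pform_diff: "pform F d (M - N) = pform F d M - pform F d N"
  by (simp add: pform_def mat_form_def algebra_simps sum_subtractf)

lemma pform_scaleR: "pform F d (r *\<^sub>R M) = r *\<^sub>R pform F d M"
  by (simp add: pform_def mat_form_def scaleR_fun_apply scaleR_sum_right)

lemma pform_sum_list: "pform F d (\<Sum>x\<leftarrow>xs. M x) = (\<Sum>x\<leftarrow>xs. pform F d (M x))"
proof (induction xs)
  case Nil
  show ?case by (simp only: list.map sum_list.Nil pform_zero)
next
  case (Cons x xs)
  then show ?case by (simp only: list.map sum_list.Cons pform_add)
qed

lemma pform_matrix_unit:
  assumes "finite F"
  shows "pform F d (matrix_unit i j a) = (if i \<in> F \<and> j \<in> F then cstar (d j) * a * d i else 0)"
proof -
  have "pform F d (matrix_unit i j a) = (\<Sum>k\<in>F. \<Sum>l\<in>F. if k = i then if l = j then cstar (d j) * a * d i else 0 else 0)"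
    unfolding pform_def mat_form_def matrix_unit_def by (intro sum.cong) auto
  also have "\<dots> = (\<Sum>k\<in>F. if k = i then \<Sum>l\<in>F. if l = j then cstar (d j) * a * d i else 0 else 0)"
    by (intro sum.cong) auto
  finally show ?thesis using assms by (simp add: sum.delta)
qed

lemma cstar_mat_form: "cstar (mat_form F C d) = mat_form F (\<lambda>i j. cstar (C j i)) d"
  unfolding mat_form_def by (subst sum.swap) (simp add: cstar_sum cstar_simps mult.assoc)

text \<open>The matrices whose hermitian part is positive. Not insisting on hermitian matrices lets a real
  functional be extended to all matrices at once; skew-hermitian matrices lie in this cone
  together with their negatives, so the extended functional vanishes on them.\<close>

definition accretive :: "('i \<times> 'i \<Rightarrow> 'a::cstar_algebra) set" where
  "accretive = {M. \<forall>F d. finite F \<longrightarrow> cpos (pform F d M + cstar (pform F d M))}"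

lemma accretive_add: "M \<in> accretive \<Longrightarrow> N \<in> accretive \<Longrightarrow> M + N \<in> accretive"
proof -
  assume *: "M \<in> accretive" "N \<in> accretive"
  have "cpos ((pform F d M + cstar (pform F d M)) + (pform F d N + cstar (pform F d N)))"
    if "finite F" for F d
    using * that by (intro cpos_add[of "pform F d M + _"]) (auto simp: accretive_def)
  then show ?thesis by (simp add: accretive_def pform_add cstar_add ac_simps)
qed

lemma accretive_scaleR: "r > 0 \<Longrightarrow> M \<in> accretive \<Longrightarrow> r *\<^sub>R M \<in> accretive"
  by (simp add: accretive_def pform_scaleR cstar_scaleR cpos_scaleR flip: scaleR_add_right)

text \<open>Expanding
  \<open>(d\<^sub>j - a d\<^sub>i)\<^sup>* (d\<^sub>j - a d\<^sub>i) \<ge> 0\<close>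
  bounds the real part of the off-diagonal entry by the diagonal ones. The bounding matrix has
  scalar entries, so it is a matrix over \<open>\<alpha>(A)\<close>; this is the domination that
  the extension theorem asks for.\<close>

lemma matrix_unit_dominated:
  fixes i j :: 'i and a :: "'a::cstar_algebra"
  shows
  "(matrix_unit i i (((norm a)\<^sup>2/2) *\<^sub>R 1) + matrix_unit j j ((1/2) *\<^sub>R 1)) - matrix_unit i j a \<in> accretive"
  (is "?M \<in> _")
  unfolding accretive_def
proof (intro CollectI allI impI)
  fix F :: "'i set" and d :: "'i \<Rightarrow> 'a" assume F: "finite F"
  have half: "((r/2) *\<^sub>R x) + ((r/2) *\<^sub>R x) = r *\<^sub>R x" for r and x :: 'a
    by (simp flip: scaleR_add_left)
  have di: "((norm a)\<^sup>2/2) *\<^sub>R (cstar (d i) * d i) + cstar (((norm a)\<^sup>2/2) *\<^sub>R (cstar (d i) * d i))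
      = (norm a)\<^sup>2 *\<^sub>R (cstar (d i) * d i)"
    by (simp add: cstar_simps half)
  have dj: "(1/2) *\<^sub>R (cstar (d j) * d j) + cstar ((1/2) *\<^sub>R (cstar (d j) * d j))
      = cstar (d j) * d j"
    using half[of 1] by (simp add: cstar_simps)
  show "cpos (pform F d ?M + cstar (pform F d ?M))"
  proof (cases "i \<in> F \<and> j \<in> F")
    case True
    let ?x = "d j - a * d i" and ?y = "(norm a)\<^sup>2 *\<^sub>R 1 - cstar a * a"
    have "pform F d ?M + cstar (pform F d ?M)
        = (norm a)\<^sup>2 *\<^sub>R (cstar (d i) * d i) + cstar (d j) * d j
          - cstar (d j) * a * d i - cstar (d i) * cstar a * d j"
      using True di dj by (simp add: pform_diff pform_add pform_matrix_unit F cstar_simps mult.assoc algebra_simps)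
    also have "\<dots> = cstar ?x * ?x + cstar (d i) * ?y * d i"
      by (simp add: cstar_simps algebra_simps)
    finally have "pform F d ?M + cstar (pform F d ?M) = cstar ?x * ?x + cstar (d i) * ?y * d i" .
    moreover have "cpos ?y"
      by (rule cpos_order_unit) (simp_all add: cstar_simps cstar_identity)
    ultimately show ?thesis
      by (simp only: cpos_add cpos_cstar_mult_self cpos_sandwich)
  next
    case False
    have 1: "cpos ((norm a)\<^sup>2 *\<^sub>R (cstar (d i) * d i))" "cpos (cstar (d j) * d j)"
      by (auto intro!: cpos_scaleR cpos_cstar_mult_self)
    show ?thesis
      using False di dj 1
      by (cases "i \<in> F"; cases "j \<in> F") (simp_all add: pform_diff pform_add pform_matrix_unit F)
  qed
qed

context injective_star_endomorphism
begin

text \<open>The kernel \<open>\<phi>\<close> prescribes the real functional that sends the matrix with the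
  single entry \<open>\<alpha>(a)\<close> at \<open>i, j\<close> to
  \<open>Re (\<phi> i j a)\<close>. It is nonnegative on accretive matrices over
  \<open>\<alpha>(A)\<close> because \<open>\<alpha>\<close> reflects positivity and
  \<open>\<phi>\<close> is nonnegative on positive matrices. An extension that is nonnegative on
  all accretive matrices is nonnegative on squares, and its complexification is the kernel
  \<open>\<psi>\<close>.\<close>

theorem cp_kernel_extension:
  assumes cp: "cp_kernel (\<phi> :: 'i \<Rightarrow> 'i \<Rightarrow> 'a \<Rightarrow> complex)"
  obtains \<psi> where "cp_kernel \<psi>" "\<And>i j a. \<psi> i j (\<alpha> a) = \<phi> i j a"
proof -
  define mat where "mat = (\<lambda>xs. \<Sum>(i, j, a)\<leftarrow>xs. matrix_unit i j (a::'a) :: 'i \<times> 'i \<Rightarrow> 'a)"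
  define val where "val = (\<lambda>xs. \<Sum>(i, j, a)\<leftarrow>xs. Re (\<phi> i j a))"
  define G0 where "G0 = {(\<alpha> \<circ> mat xs, val xs) | xs. True}"
  have mat_Nil: "mat [] = 0" and mat_Cons: "mat ((i, j, a) # xs) = matrix_unit i j a + mat xs" for i j a xs
    by (simp_all add: mat_def)
  have val_Nil: "val [] = 0" and val_Cons: "val ((i, j, a) # xs) = Re (\<phi> i j a) + val xs" for i j a xs
    by (simp_all add: val_def)
  have G0: "subspace G0"
  proof (rule subspaceI)
    have "(\<alpha> \<circ> mat [], val []) \<in> G0" unfolding G0_def by blast
    then show "0 \<in> G0" by (simp add: mat_Nil val_Nil o_def hom_zero zero_prod_def zero_fun_def)
    fix u v assume "u \<in> G0" "v \<in> G0"
    then obtain xs ys where "u = (\<alpha> \<circ> mat xs, val xs)" "v = (\<alpha> \<circ> mat ys, val ys)"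
      unfolding G0_def by blast
    then have "u + v = (\<alpha> \<circ> mat (xs @ ys), val (xs @ ys))"
      by (auto simp: mat_def val_def hom_add)
    then show "u + v \<in> G0" unfolding G0_def by blast
  next
    fix r :: real and u assume "u \<in> G0"
    then obtain xs where u: "u = (\<alpha> \<circ> mat xs, val xs)" unfolding G0_def by blast
    let ?ys = "map (\<lambda>(i, j, a). (i, j, r *\<^sub>R a)) xs"
    have "mat ?ys = r *\<^sub>R mat xs"
    proof (induction xs)
      case Nil
      show ?case by (simp only: list.map mat_Nil scaleR_zero_right)
    next
      case (Cons x xs)
      then show ?case
        by (cases x) (simp only: list.map mat_Cons matrix_unit_scaleR scaleR_add_right prod.case)
    qed
    moreover have "val ?ys = r * val xs"
      by (induction xs) (auto simp: val_Nil val_Cons cp_scaleR[OF cp] algebra_simps)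
    ultimately have "r *\<^sub>R u = (\<alpha> \<circ> mat ?ys, val ?ys)"
      by (auto simp: u hom_scaleR scaleR_fun_apply)
    then show "r *\<^sub>R u \<in> G0" unfolding G0_def by blast
  qed
  have G0_pos: "0 \<le> t" if Mt: "(M, t) \<in> G0" "M \<in> accretive" for M t
  proof -
    obtain xs where M: "M = \<alpha> \<circ> mat xs" and t: "t = val xs" using Mt(1) unfolding G0_def by blast
    define F where "F = (\<lambda>(i, j, a). i) ` set xs \<union> (\<lambda>(i, j, a). j) ` set xs"
    have F: "finite F" by (simp add: F_def)
    \<comment> \<open>The hermitian part, up to a factor 2; its image under \<open>\<alpha>\<close> is positive.\<close>
    define C where "C i j = mat xs (i, j) + cstar (mat xs (j, i))" for i j
    have "cpos (mat_form F C d)" for d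
    proof -
      have "\<alpha> (mat_form F C d) = mat_form F (\<lambda>i j. \<alpha> (C i j)) (\<lambda>i. \<alpha> (d i))"
        by (simp add: mat_form_def hom_sum hom_mult hom_cstar)
      also have "\<dots> = pform F (\<lambda>i. \<alpha> (d i)) M + cstar (pform F (\<lambda>i. \<alpha> (d i)) M)"
        unfolding pform_def cstar_mat_form
        by (simp add: mat_form_def C_def M hom_add hom_cstar algebra_simps sum.distrib)
      finally have "cpos (\<alpha> (mat_form F C d))" using Mt(2) F by (simp add: accretive_def)
      then show ?thesis by (simp only: hom_cpos_iff)
    qed
    moreover have "cstar (C i j) = C j i" for i j by (simp add: C_def cstar_simps add.commute)
    ultimately have "0 \<le> Re (\<Sum>i\<in>F. \<Sum>j\<in>F. \<phi> i j (C i j))"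
      by (intro cp_kernel_positive_matrix[OF cp F]) auto
    moreover have "Re (\<Sum>i\<in>F. \<Sum>j\<in>F. \<phi> i j (mat ys (i, j))) = val ys"
      if "set ys \<subseteq> set xs" for ys
      using that
    proof (induction ys)
      case Nil
      then show ?case by (simp add: mat_Nil val_Nil cp_zero[OF cp])
    next
      case (Cons y ys)
      obtain i j a where y: "y = (i, j, a)" by (cases y)
      have ij: "i \<in> F" "j \<in> F" using Cons.prems unfolding y F_def by force+
      have "(\<Sum>k\<in>F. \<Sum>l\<in>F. \<phi> k l (matrix_unit i j a (k, l)))
          = (\<Sum>k\<in>F. if k = i then \<Sum>l\<in>F. if l = j then \<phi> i j a else 0 else 0)"
        unfolding matrix_unit_def by (intro sum.cong) (auto simp: cp_zero[OF cp] intro!: sum.cong)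
      also have "\<dots> = \<phi> i j a" using ij F by (simp add: sum.delta)
      finally show ?case
        using Cons unfolding y by (simp add: mat_Cons val_Cons cp_add[OF cp] sum.distrib)
    qed
    moreover have "Re (\<Sum>i\<in>F. \<Sum>j\<in>F. \<phi> i j (cstar (mat xs (j, i))))
        = Re (\<Sum>i\<in>F. \<Sum>j\<in>F. \<phi> i j (mat xs (i, j)))"
      by (subst sum.swap) (simp add: cp_cstar[OF cp])
    ultimately show ?thesis
      by (simp add: t C_def cp_add[OF cp] sum.distrib)
  qed
  obtain G where G: "G0 \<subseteq> G" "subspace G" "\<And>x t. (x, t) \<in> G \<Longrightarrow> x \<in> accretive \<Longrightarrow> 0 \<le> t"
    and dom: "\<And>x m s n t. (m, s) \<in> G0 \<Longrightarrow> m - x \<in> accretive \<Longrightarrow> (n, t) \<in> G0 \<Longrightarrow>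
      x - n \<in> accretive \<Longrightarrow> \<exists>c. (x, c) \<in> G"
    by (rule riesz_extension[OF accretive_add accretive_scaleR G0 G0_pos]) auto
  have ex: "\<exists>c. (matrix_unit i j a, c) \<in> G" for i j a
  proof -
    have upper: "\<exists>m s. (m, s) \<in> G0 \<and> m - matrix_unit i j a \<in> accretive" for a
    proof -
      let ?xs = "[(i, i, ((norm a)\<^sup>2/2) *\<^sub>R 1), (j, j, (1/2) *\<^sub>R 1)]"
      have "\<alpha> \<circ> mat ?xs = matrix_unit i i (((norm a)\<^sup>2/2) *\<^sub>R 1) + matrix_unit j j ((1/2) *\<^sub>R 1)"
        by (auto simp: mat_Cons mat_Nil matrix_unit_def fun_eq_iff hom_add hom_scaleR hom_one hom_zero)
      then have "(\<alpha> \<circ> mat ?xs) - matrix_unit i j a \<in> accretive" using matrix_unit_dominated by metis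
      then show ?thesis unfolding G0_def by blast
    qed
    obtain m s where m: "(m, s) \<in> G0" "m - matrix_unit i j a \<in> accretive" using upper by blast
    obtain n t where n: "(n, t) \<in> G0" "n - matrix_unit i j (- a) \<in> accretive" using upper by blast
    have "(- n, - t) \<in> G0" using subspace_neg[OF G0 n(1)] by simp
    moreover have "matrix_unit i j a - - n \<in> accretive"
    proof -
      have "matrix_unit i j (- a) = - matrix_unit i j a" by (auto simp: matrix_unit_def)
      then show ?thesis using n(2) by (simp add: add.commute)
    qed
    ultimately show ?thesis using dom m by blast
  qed
  have unique: "c = c'" if "(x, c) \<in> G" "(x, c') \<in> G" for x c c'
  proof -
    have "(x - x, c - c') \<in> G" "(x - x, c' - c) \<in> G"
      using subspace_diff[OF G(2) that] subspace_diff[OF G(2) that(2,1)] by simp_all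
    moreover have "x - x \<in> accretive"
      unfolding accretive_def by (simp add: pform_zero)
    ultimately have "0 \<le> c - c'" "0 \<le> c' - c" using G(3) by blast+
    then show ?thesis by simp
  qed
  define h where "h i j a = (SOME c. (matrix_unit i j a, c) \<in> G)" for i j a
  have h: "(matrix_unit i j a, h i j a) \<in> G" for i j a
    unfolding h_def by (rule someI_ex) (rule ex)
  have h_eq: "h i j a = c" if "(matrix_unit i j a, c) \<in> G" for i j a c
    using h that by (rule unique)
  have h_add: "h i j (a + b) = h i j a + h i j b" for i j a b
    using subspace_add[OF G(2) h[of i j a] h[of i j b]] by (intro h_eq) (simp add: matrix_unit_add)
  have h_scaleR: "h i j (r *\<^sub>R a) = r * h i j a" for i j r a
    using subspace_scale[OF G(2) h[of i j a], of r] by (intro h_eq) (simp add: matrix_unit_scaleR)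
  have h_minus: "h i j (- a) = - h i j a" for i j a
    using h_scaleR[of i j "-1" a] by simp
  have h_cstar: "h j i (cstar a) = h i j a" for i j a
  proof -
    have skew: "matrix_unit i j a - matrix_unit j i (cstar a) \<in> accretive" for i j and a :: 'a
      unfolding accretive_def by (auto simp: pform_diff pform_matrix_unit cstar_simps mult.assoc)
    have "(matrix_unit i j a - matrix_unit j i (cstar a), h i j a - h j i (cstar a)) \<in> G"
      "(matrix_unit j i (cstar a) - matrix_unit i j a, h j i (cstar a) - h i j a) \<in> G"
      using subspace_diff[OF G(2) h[of i j a] h[of j i "cstar a"]]
        subspace_diff[OF G(2) h[of j i "cstar a"] h[of i j a]] by simp_all
    moreover have "matrix_unit j i (cstar a) - matrix_unit i j a \<in> accretive"
      using skew[of j i "cstar a"] by (simp only: cstar_cstar)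
    ultimately have "0 \<le> h i j a - h j i (cstar a)" "0 \<le> h j i (cstar a) - h i j a"
      using skew[of i j a] by (blast intro: G(3))+
    then show ?thesis by simp
  qed
  have h_pos: "0 \<le> (\<Sum>(i, a)\<leftarrow>xs. \<Sum>(j, b)\<leftarrow>xs. h i j (cstar b * a))" for xs
  proof -
    let ?M = "\<Sum>(i, a)\<leftarrow>xs. \<Sum>(j, b)\<leftarrow>xs. matrix_unit i j (cstar b * a)"
    have "(?M, \<Sum>(i, a)\<leftarrow>xs. \<Sum>(j, b)\<leftarrow>xs. h i j (cstar b * a)) \<in> G"
      unfolding split_def by (intro subspace_sum_list_Pair G(2) h)
    moreover have "?M \<in> accretive"
      unfolding accretive_def
    proof (intro CollectI allI impI)
      fix F :: "'i set" and d :: "'i \<Rightarrow> 'a" assume F: "finite F"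
      define w where "w = (\<Sum>(i, a)\<leftarrow>xs. if i \<in> F then a * d i else 0)"
      have star: "cstar (\<Sum>(i, a)\<leftarrow>ys. if i \<in> F then a * d i else 0)
          = (\<Sum>(i, a)\<leftarrow>ys. if i \<in> F then cstar (a * d i) else 0)" for ys
        by (induction ys) (auto simp: cstar_add)
      have "pform F d ?M = (\<Sum>(i, a)\<leftarrow>xs. \<Sum>(j, b)\<leftarrow>xs.
          (if j \<in> F then cstar (b * d j) else 0) * (if i \<in> F then a * d i else 0))"
        unfolding split_def pform_sum_list
        by (intro arg_cong[of _ _ sum_list] map_cong refl) (auto simp: pform_matrix_unit F cstar_simps mult.assoc)
      also have "\<dots> = cstar w * w"
        unfolding w_def star by (simp add: split_def sum_list_mult_const sum_list_const_mult)
      finally have "pform F d ?M + cstar (pform F d ?M) = cstar w * w + cstar w * w"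
        by (simp add: cstar_simps)
      then show "cpos (pform F d ?M + cstar (pform F d ?M))"
        by (simp add: cpos_add cpos_cstar_mult_self)
    qed
    ultimately show ?thesis by (rule G(3))
  qed
  have h_ext: "h i j (\<alpha> a) = Re (\<phi> i j a)" for i j a
  proof (rule h_eq)
    have "\<alpha> \<circ> mat [(i, j, a)] = matrix_unit i j (\<alpha> a)"
      by (auto simp: mat_Cons mat_Nil matrix_unit_def hom_zero)
    moreover have "(\<alpha> \<circ> mat [(i, j, a)], val [(i, j, a)]) \<in> G0" unfolding G0_def by blast
    ultimately have "(matrix_unit i j (\<alpha> a), val [(i, j, a)]) \<in> G0" by simp
    then show "(matrix_unit i j (\<alpha> a), Re (\<phi> i j a)) \<in> G" using G(1) by (auto simp: val_Cons val_Nil)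
  qed
  \<comment> \<open>The complex-linear functional with real part \<open>h\<close>.\<close>
  define \<psi> where "\<psi> i j a = Complex (h i j a) (- h i j (scaleC \<i> a))" for i j a
  have "cp_kernel \<psi>"
    unfolding cp_kernel_def
  proof (intro conjI allI)
    show add: "\<psi> i j (a + b) = \<psi> i j a + \<psi> i j b" for i j a b
      by (simp add: \<psi>_def h_add scaleC_add_right complex_eq_iff)
    show "\<psi> i j (scaleC c a) = c * \<psi> i j a" for i j c a
    proof -
      have c: "c = complex_of_real (Re c) + complex_of_real (Im c) * \<i>"
        by (simp add: complex_eq_iff)
      have ca: "scaleC c a = Re c *\<^sub>R a + Im c *\<^sub>R scaleC \<i> a"
        by (subst c) (simp only: scaleC_add_left scaleR_scaleC scaleC_scaleC)
      have ica: "scaleC \<i> (scaleC c a) = Re c *\<^sub>R scaleC \<i> a - Im c *\<^sub>R a"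
        unfolding ca by (simp add: scaleR_scaleC scaleC_add_right scaleC_scaleC mult.commute)
          (simp add: scaleC_minus_left flip: mult.assoc)
      show ?thesis
        unfolding \<psi>_def ica unfolding ca
        using h_add[of i j "Re c *\<^sub>R scaleC \<i> a" "- (Im c *\<^sub>R a)"]
        by (simp add: h_add h_scaleR h_minus complex_eq_iff)
    qed
    show "\<psi> j i (cstar a) = cnj (\<psi> i j a)" for i j a
    proof -
      have "h j i (scaleC \<i> (cstar a)) = h j i (cstar (- scaleC \<i> a))"
        by (simp add: cstar_simps scaleC_minus_left)
      also have "\<dots> = - h i j (scaleC \<i> a)" by (simp only: h_cstar h_minus)
      finally show ?thesis by (simp add: \<psi>_def h_cstar complex_eq_iff)
    qed
    show "0 \<le> Re (\<Sum>(i, a)\<leftarrow>xs. \<Sum>(j, b)\<leftarrow>xs. \<psi> i j (cstar b * a))" for xs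
    proof -
      have Re_sum: "Re (\<Sum>x\<leftarrow>ys. f x) = (\<Sum>x\<leftarrow>ys. Re (f x))" for f and ys :: "('i \<times> 'a) list"
        by (induction ys) auto
      show ?thesis using h_pos[of xs] by (simp add: Re_sum split_def \<psi>_def)
    qed
  qed
  moreover have "\<psi> i j (\<alpha> a) = \<phi> i j a" for i j a
    by (simp add: \<psi>_def h_ext cp_scaleC[OF cp] complex_eq_iff flip: hom_scaleC)
  ultimately show thesis by (rule that)
qed

end

section \<open>Reproducing kernel Hilbert spaces\<close>

text \<open>Lists of pairs stand for formal linear combinations \<open>\<Sum> c e\<^sub>i\<close>, with
  concatenation as addition. A function \<open>f\<close> acts on them as the vector with
  coordinates \<open>f i = \<langle>f, e\<^sub>i\<rangle>\<close> does, hence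
  conjugate-linearly.\<close>

definition ev :: "('i \<Rightarrow> complex) \<Rightarrow> ('i \<times> complex) list \<Rightarrow> complex" where
  "ev f v = (\<Sum>(i, c)\<leftarrow>v. cnj c * f i)"

definition lscale :: "complex \<Rightarrow> ('i \<times> complex) list \<Rightarrow> ('i \<times> complex) list" where
  "lscale c v = map (\<lambda>(i, d). (i, c * d)) v"

lemma ev_Nil [simp]: "ev f [] = 0"
  and ev_Cons [simp]: "ev f ((i, c) # v) = cnj c * f i + ev f v"
  and ev_append [simp]: "ev f (v @ w) = ev f v + ev f w"
  by (simp_all add: ev_def)

lemma ev_lscale [simp]: "ev f (lscale c v) = cnj c * ev f v"
  by (induction v) (auto simp: lscale_def algebra_simps)

lemma ev_add: "ev (\<lambda>i. f i + g i) v = ev f v + ev g v"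
  by (induction v) (auto simp: algebra_simps)

lemma ev_diff: "ev (\<lambda>i. f i - g i) v = ev f v - ev g v"
  by (induction v) (auto simp: algebra_simps)

lemma ev_mult: "ev (\<lambda>i. c * f i) v = c * ev f v"
  by (induction v) (auto simp: algebra_simps)

lemma ev_zero [simp]: "ev (\<lambda>_. 0) v = 0"
  by (induction v) auto

lemma ev_tendsto: "(\<And>i. (\<lambda>n. f n i) \<longlonglongrightarrow> g i) \<Longrightarrow> (\<lambda>n. ev (f n) v) \<longlonglongrightarrow> ev g v"
  by (induction v) (auto intro!: tendsto_intros)

locale pos_kernel =
  fixes k :: "'i \<Rightarrow> 'i \<Rightarrow> complex"
  assumes k_herm: "k j i = cnj (k i j)"
    and k_pos: "0 \<le> Re (\<Sum>(i, c)\<leftarrow>v. \<Sum>(j, d)\<leftarrow>v. c * cnj d * k i j)"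
begin

text \<open>The coordinates \<open>\<langle>v, e\<^sub>i\<rangle>\<close> of the formal combination
  \<open>v\<close>.\<close>

definition emb :: "('i \<times> complex) list \<Rightarrow> 'i \<Rightarrow> complex" where
  "emb v i = (\<Sum>(j, c)\<leftarrow>v. c * k j i)"

lemma emb_Nil [simp]: "emb [] i = 0"
  and emb_Cons [simp]: "emb ((j, c) # v) i = c * k j i + emb v i"
  and emb_append [simp]: "emb (v @ w) i = emb v i + emb w i"
  by (simp_all add: emb_def)

lemma emb_lscale [simp]: "emb (lscale c v) i = c * emb v i"
  by (induction v) (auto simp: lscale_def algebra_simps)

abbreviation "gram v w \<equiv> ev (emb v) w"

lemma cnj_emb: "cnj (emb w j) = ev (k j) w"
  by (induction w) (auto simp: k_herm[of _ j])

lemma emb_append_fun: "emb (v @ w) = (\<lambda>i. emb v i + emb w i)"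
  and emb_Cons_fun: "emb ((j, c) # v) = (\<lambda>i. c * k j i + emb v i)"
  and emb_lscale_fun: "emb (lscale c v) = (\<lambda>i. c * emb v i)"
  and emb_Nil_fun: "emb [] = (\<lambda>_. 0)"
  by auto

lemma gram_herm: "gram w v = cnj (gram v w)"
  by (induction v) (auto simp: emb_Cons_fun emb_Nil_fun ev_add ev_mult simp flip: cnj_emb)

definition sqnorm :: "('i \<times> complex) list \<Rightarrow> real" where
  "sqnorm v = Re (gram v v)"

lemma gram_eq_sum: "gram v w = (\<Sum>(i, c)\<leftarrow>v. \<Sum>(j, d)\<leftarrow>w. c * cnj d * k i j)"
proof (induction v)
  case (Cons x v)
  obtain i c where x: "x = (i, c)" by (cases x)
  have "c * ev (k i) w = (\<Sum>(j, d)\<leftarrow>w. c * cnj d * k i j)"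
    by (induction w) (auto simp: algebra_simps)
  then show ?case using Cons by (simp add: x emb_Cons_fun ev_add ev_mult)
qed (simp add: emb_Nil_fun)

lemma sqnorm_nonneg: "0 \<le> sqnorm v"
  using k_pos[of v] by (simp add: sqnorm_def gram_eq_sum)

lemma gram_self: "gram v v = complex_of_real (sqnorm v)"
  using gram_herm[of v v] by (simp add: sqnorm_def complex_eq_iff)

lemma sqnorm_append: "sqnorm (v @ w) = sqnorm v + 2 * Re (gram v w) + sqnorm w"
  using gram_herm[of w v] by (simp add: sqnorm_def emb_append_fun ev_add)

lemma sqnorm_lscale: "sqnorm (lscale c v) = (cmod c)\<^sup>2 * sqnorm v"
proof -
  have "gram (lscale c v) (lscale c v) = (c * cnj c) * gram v v"
    by (simp add: emb_lscale_fun ev_mult)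
  also have "c * cnj c = complex_of_real ((cmod c)\<^sup>2)" by (rule complex_norm_square[symmetric])
  finally have "complex_of_real (sqnorm (lscale c v)) = complex_of_real ((cmod c)\<^sup>2 * sqnorm v)"
    unfolding gram_self by simp
  then show ?thesis by (simp only: of_real_eq_iff)
qed

definition bound :: "('i \<Rightarrow> complex) \<Rightarrow> real \<Rightarrow> bool" where
  "bound f C \<longleftrightarrow> 0 \<le> C \<and> (\<forall>v. cmod (ev f v) \<le> C * sqrt (sqnorm v))"

text \<open>A function belongs to the space if it is bounded as a functional on formal combinations, with
  \<open>nrm\<close> the functional norm. The space is thus the dual of the pre-Hilbert space of
  formal combinations, which makes it complete at once; the inner product is what needs work.\<close>

definition rkhs :: "('i \<Rightarrow> complex) set" where
  "rkhs = {f. \<exists>C. bound f C}"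

definition nrm :: "('i \<Rightarrow> complex) \<Rightarrow> real" where
  "nrm f = Inf {C. bound f C}"

lemma nrm_le: "bound f C \<Longrightarrow> nrm f \<le> C"
  unfolding nrm_def by (rule cInf_lower) (auto simp: bound_def intro!: bdd_belowI[of _ 0])

lemma rkhsI: "bound f C \<Longrightarrow> f \<in> rkhs"
  by (auto simp: rkhs_def)

lemma bound_nrm: assumes "f \<in> rkhs" shows "bound f (nrm f)"
proof -
  have ne: "{C. bound f C} \<noteq> {}" using assms by (simp add: rkhs_def)
  have "cmod (ev f v) \<le> nrm f * sqrt (sqnorm v)" for v
  proof (cases "sqrt (sqnorm v) = 0")
    case True
    obtain C where "bound f C" using ne by blast
    then have "cmod (ev f v) \<le> C * sqrt (sqnorm v)" by (simp add: bound_def)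
    then show ?thesis using True by simp
  next
    case False
    then have p: "sqrt (sqnorm v) > 0" using sqnorm_nonneg[of v] by simp
    have "cmod (ev f v) / sqrt (sqnorm v) \<le> nrm f"
      unfolding nrm_def using ne p by (intro cInf_greatest) (auto simp: bound_def divide_le_eq)
    then show ?thesis using p by (simp add: divide_le_eq)
  qed
  moreover have "0 \<le> nrm f"
    unfolding nrm_def using ne by (intro cInf_greatest) (auto simp: bound_def)
  ultimately show ?thesis by (simp add: bound_def)
qed

lemma nrm_nonneg: "f \<in> rkhs \<Longrightarrow> 0 \<le> nrm f"
  and ev_le: "f \<in> rkhs \<Longrightarrow> cmod (ev f v) \<le> nrm f * sqrt (sqnorm v)"
  using bound_nrm by (auto simp: bound_def)

lemma bound_add:
  assumes "bound f C" "bound g D" shows "bound (\<lambda>i. f i + g i) (C + D)"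
proof -
  have "cmod (ev f v + ev g v) \<le> (C + D) * sqrt (sqnorm v)" for v
  proof -
    have "cmod (ev f v) \<le> C * sqrt (sqnorm v)" "cmod (ev g v) \<le> D * sqrt (sqnorm v)"
      using assms by (auto simp: bound_def)
    then show ?thesis using norm_triangle_ineq[of "ev f v" "ev g v"] by (simp add: algebra_simps)
  qed
  then show ?thesis using assms by (simp add: bound_def ev_add)
qed

lemma bound_mult:
  assumes "bound f C" shows "bound (\<lambda>i. c * f i) (cmod c * C)"
proof -
  have "cmod c * cmod (ev f v) \<le> cmod c * (C * sqrt (sqnorm v))" for v
    using assms by (intro mult_left_mono) (auto simp: bound_def)
  then show ?thesis using assms by (simp add: bound_def ev_mult norm_mult mult.assoc)
qed

lemma rkhs_add: "f \<in> rkhs \<Longrightarrow> g \<in> rkhs \<Longrightarrow> (\<lambda>i. f i + g i) \<in> rkhs"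
  by (blast intro: rkhsI bound_add bound_nrm)

lemma rkhs_mult: "f \<in> rkhs \<Longrightarrow> (\<lambda>i. c * f i) \<in> rkhs"
  by (blast intro: rkhsI bound_mult bound_nrm)

lemma rkhs_uminus: "f \<in> rkhs \<Longrightarrow> (\<lambda>i. - f i) \<in> rkhs"
  using rkhs_mult[of f "-1"] by simp

lemma rkhs_diff: "f \<in> rkhs \<Longrightarrow> g \<in> rkhs \<Longrightarrow> (\<lambda>i. f i - g i) \<in> rkhs"
  using rkhs_add[OF _ rkhs_uminus, of f g] by simp

lemma rkhs_zero: "(\<lambda>_. 0) \<in> rkhs"
  by (rule rkhsI[of _ 0]) (simp add: bound_def)

lemma nrm_add: "f \<in> rkhs \<Longrightarrow> g \<in> rkhs \<Longrightarrow> nrm (\<lambda>i. f i + g i) \<le> nrm f + nrm g"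
  by (intro nrm_le bound_add bound_nrm)

lemma nrm_zero: "nrm (\<lambda>_. 0) = 0"
  using nrm_le[of "\<lambda>_. 0" 0] nrm_nonneg[OF rkhs_zero] by (simp add: bound_def)

lemma nrm_mult: assumes f: "f \<in> rkhs" shows "nrm (\<lambda>i. c * f i) = cmod c * nrm f"
proof (cases "c = 0")
  case False
  have "nrm (\<lambda>i. inverse c * (c * f i)) \<le> cmod (inverse c) * nrm (\<lambda>i. c * f i)"
    by (intro nrm_le bound_mult bound_nrm rkhs_mult f)
  also have "(\<lambda>i. inverse c * (c * f i)) = f" using False by (simp add: fun_eq_iff)
  finally have "cmod c * nrm f \<le> cmod c * (inverse (cmod c) * nrm (\<lambda>i. c * f i))"
    by (intro mult_left_mono) (auto simp: norm_inverse)
  then have "cmod c * nrm f \<le> nrm (\<lambda>i. c * f i)"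
    using False by (simp add: field_simps)
  moreover have "nrm (\<lambda>i. c * f i) \<le> cmod c * nrm f"
    by (intro nrm_le bound_mult bound_nrm f)
  ultimately show ?thesis by simp
qed (simp add: nrm_zero)

lemma nrm_minus: "f \<in> rkhs \<Longrightarrow> nrm (\<lambda>i. - f i) = nrm f"
  using nrm_mult[of f "-1"] by simp

lemma nrm_diff_commute: "f \<in> rkhs \<Longrightarrow> g \<in> rkhs \<Longrightarrow> nrm (\<lambda>i. f i - g i) = nrm (\<lambda>i. g i - f i)"
  using nrm_minus[OF rkhs_diff, of f g] by simp

lemma nrm_eq_0D: assumes "f \<in> rkhs" "nrm f = 0" shows "f = (\<lambda>_. 0)"
proof
  fix i show "f i = 0" using ev_le[OF assms(1), of "[(i, 1)]"] assms(2) by simp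
qed

text \<open>Formal combinations of length 0 are invisible to the space. All linear relations between the
  vectors \<open>e\<^sub>i\<close> are used in this form.\<close>

lemma ev_null: "f \<in> rkhs \<Longrightarrow> sqnorm v = 0 \<Longrightarrow> ev f v = 0"
  using ev_le[of f v] by simp

text \<open>If \<open>f\<close> is represented by a vector, this is
  \<open>\<parallel>f\<parallel>\<^sup>2 - \<parallel>f - v\<parallel>\<^sup>2\<close>. So
  its supremum over \<open>v\<close> is the squared norm, and a nearly maximal \<open>v\<close>
  is a good approximation to \<open>f\<close>.\<close>

definition gain :: "('i \<Rightarrow> complex) \<Rightarrow> ('i \<times> complex) list \<Rightarrow> real" where
  "gain f v = 2 * Re (ev f v) - sqnorm v"

lemma gain_le: assumes f: "f \<in> rkhs" shows "gain f v \<le> (nrm f)\<^sup>2"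
proof -
  have "Re (ev f v) \<le> nrm f * sqrt (sqnorm v)"
    using ev_le[OF f, of v] complex_Re_le_cmod[of "ev f v"] by linarith
  moreover have "0 \<le> (nrm f - sqrt (sqnorm v))\<^sup>2" by simp
  ultimately show ?thesis using sqnorm_nonneg[of v] by (simp add: gain_def power2_diff)
qed

text \<open>Replacing \<open>v\<close> by its multiple by \<open>t u\<close>, with \<open>u\<close> a unit
  scalar that makes the value at \<open>v\<close> real, turns the hypothesis into a quadratic
  inequality in \<open>t\<close>, which is used at its extremal \<open>t\<close>.\<close>

lemma bound_of_gain:
  assumes "\<And>v. gain f v \<le> B\<^sup>2" "0 \<le> B" shows "bound f B"
proof -
  have "cmod (ev f v) \<le> B * sqrt (sqnorm v)" for v
  proof -
    let ?a = "cmod (ev f v)" and ?s = "sqnorm v"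
    \<comment> \<open>A phase that makes the value real and nonnegative.\<close>
    obtain u where u: "cmod u = 1" "cnj u * ev f v = complex_of_real ?a"
    proof (cases "ev f v = 0")
      case True then show thesis using that[of 1] by simp
    next
      case False
      have "cnj (sgn (ev f v)) * ev f v = (ev f v * cnj (ev f v)) / complex_of_real ?a"
        by (simp add: sgn_eq)
      also have "\<dots> = complex_of_real ?a"
        unfolding complex_norm_square[symmetric] using False by (simp add: power2_eq_square)
      finally have "cnj (sgn (ev f v)) * ev f v = complex_of_real ?a" .
      then show thesis using that[of "sgn (ev f v)"] False by (simp add: norm_sgn)
    qed
    have quad: "2 * t * ?a \<le> B\<^sup>2 + t\<^sup>2 * ?s" for t :: real
    proof -
      have e: "ev f (lscale (of_real t * u) v) = of_real (t * ?a)"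
        by (simp only: ev_lscale complex_cnj_mult complex_cnj_complex_of_real mult.assoc u(2)
            of_real_mult)
      have "gain f (lscale (of_real t * u) v) = 2 * t * ?a - t\<^sup>2 * ?s"
        unfolding gain_def sqnorm_lscale e by (simp add: norm_mult u(1))
      then show ?thesis using assms(1)[of "lscale (of_real t * u) v"] by simp
    qed
    show ?thesis
    proof (cases "?s = 0")
      case True
      have "?a = 0"
      proof (rule ccontr)
        assume "?a \<noteq> 0"
        then have "2 * ((B\<^sup>2 + 1) / (2 * ?a)) * ?a = B\<^sup>2 + 1" by simp
        then show False using quad[of "(B\<^sup>2 + 1) / (2 * ?a)"] True by simp
      qed
      then show ?thesis using True by simp
    next
      case False
      then have s: "?s > 0" using sqnorm_nonneg[of v] by simp
      have "2 * (?a / ?s) * ?a \<le> B\<^sup>2 + (?a / ?s)\<^sup>2 * ?s" by (rule quad)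
      moreover have "(?a / ?s)\<^sup>2 * ?s = ?a\<^sup>2 / ?s" "2 * (?a / ?s) * ?a = 2 * (?a\<^sup>2 / ?s)"
        using s by (simp_all add: power2_eq_square)
      ultimately have "?a\<^sup>2 / ?s \<le> B\<^sup>2" by linarith
      then have "?a\<^sup>2 \<le> B\<^sup>2 * ?s" using s by (simp add: pos_divide_le_eq)
      then have "?a \<le> sqrt (B\<^sup>2 * ?s)" by (rule real_le_rsqrt)
      then show ?thesis using assms(2) by (simp add: real_sqrt_mult)
    qed
  qed
  then show ?thesis using assms(2) by (simp add: bound_def)
qed

lemma gain_diff_emb: "gain (\<lambda>i. f i - emb v i) w = gain f (w @ v) - gain f v"
proof -
  have "Re (gram v w) = Re (gram w v)" using gram_herm[of v w] by simp
  then show ?thesis by (simp add: gain_def ev_diff sqnorm_append)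
qed

lemma gain_emb: "gain (emb v) w \<le> sqnorm v"
proof -
  have "gram v w = cnj (gram w v)" by (rule gram_herm)
  then have "sqnorm (v @ lscale (- 1) w) = sqnorm v - 2 * Re (gram v w) + sqnorm w"
    by (simp add: sqnorm_append sqnorm_lscale)
  then show ?thesis using sqnorm_nonneg[of "v @ lscale (-1) w"] by (simp add: gain_def)
qed

lemma emb_rkhs: "emb v \<in> rkhs"
  by (rule rkhsI[of _ "sqrt (sqnorm v)"], rule bound_of_gain) (auto simp: gain_emb sqnorm_nonneg)

text \<open>Translating \<open>v\<close> into the argument turns the gain of \<open>f - v\<close> into
  that of \<open>f\<close> minus a constant, so the suprema differ by this constant. The
  identity makes the norm Hilbertian: it gives density of the formal combinations and determines
  the inner product with them.\<close>

lemma nrm_diff_emb: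
  assumes f: "f \<in> rkhs" shows "(nrm (\<lambda>i. f i - emb v i))\<^sup>2 = (nrm f)\<^sup>2 - gain f v"
proof (rule antisym)
  let ?g = "\<lambda>i. f i - emb v i"
  have g: "?g \<in> rkhs" by (intro rkhs_diff f emb_rkhs)
  have nn: "0 \<le> (nrm f)\<^sup>2 - gain f v" using gain_le[OF f] by simp
  have "bound ?g (sqrt ((nrm f)\<^sup>2 - gain f v))"
    using nn gain_le[OF f] by (intro bound_of_gain) (auto simp: gain_diff_emb)
  then have "nrm ?g \<le> sqrt ((nrm f)\<^sup>2 - gain f v)" by (rule nrm_le)
  then show "(nrm ?g)\<^sup>2 \<le> (nrm f)\<^sup>2 - gain f v"
    using nn power_mono[OF _ nrm_nonneg[OF g], of _ 2] by fastforce
  have *: "gain f w \<le> (nrm ?g)\<^sup>2 + gain f v" for w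
  proof -
    have "gain ?g (w @ lscale (- 1) v) \<le> (nrm ?g)\<^sup>2" by (rule gain_le[OF g])
    moreover have "gain f ((w @ lscale (- 1) v) @ v) = gain f w"
    proof -
      have "gram w (lscale (-1) v @ v) = 0" "sqnorm (lscale (-1) v @ v) = 0"
        by (simp_all add: sqnorm_def emb_append_fun emb_lscale_fun ev_add ev_mult)
      then show ?thesis by (simp add: gain_def sqnorm_append[of w] del: ev_append) simp
    qed
    ultimately show ?thesis by (simp add: gain_diff_emb)
  qed
  have nn': "0 \<le> (nrm ?g)\<^sup>2 + gain f v" using *[of "[]"] by (simp add: gain_def sqnorm_def)
  then have "bound f (sqrt ((nrm ?g)\<^sup>2 + gain f v))"
    using * by (intro bound_of_gain) auto
  then have "nrm f \<le> sqrt ((nrm ?g)\<^sup>2 + gain f v)" by (rule nrm_le)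
  then have "(nrm f)\<^sup>2 \<le> (nrm ?g)\<^sup>2 + gain f v"
    using nn' power_mono[OF _ nrm_nonneg[OF f], of _ 2] by fastforce
  then show "(nrm f)\<^sup>2 - gain f v \<le> (nrm ?g)\<^sup>2" by simp
qed

lemma emb_dense:
  assumes f: "f \<in> rkhs" obtains v where "(\<lambda>n. nrm (\<lambda>i. f i - emb (v n) i)) \<longlonglongrightarrow> 0"
proof -
  have ex: "\<exists>v. (nrm (\<lambda>i. f i - emb v i))\<^sup>2 < e" if e: "e > 0" for e
  proof (rule ccontr)
    assume "\<not> ?thesis"
    then have far: "e \<le> (nrm (\<lambda>i. f i - emb v i))\<^sup>2" for v by (simp add: not_less)
    have "gain f v \<le> (nrm f)\<^sup>2 - e" for v
      using nrm_diff_emb[OF f, of v] far[of v] by linarith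
    moreover from this[of "[]"] have nn: "0 \<le> (nrm f)\<^sup>2 - e" by (simp add: gain_def sqnorm_def)
    ultimately have "bound f (sqrt ((nrm f)\<^sup>2 - e))" by (intro bound_of_gain) auto
    then have "nrm f \<le> sqrt ((nrm f)\<^sup>2 - e)" by (rule nrm_le)
    then have "(nrm f)\<^sup>2 \<le> (sqrt ((nrm f)\<^sup>2 - e))\<^sup>2"
      by (intro power_mono nrm_nonneg f)
    then have "(nrm f)\<^sup>2 \<le> (nrm f)\<^sup>2 - e" using nn by simp
    then show False using e by simp
  qed
  have "\<exists>v. nrm (\<lambda>i. f i - emb v i) < inverse (real (Suc n))" for n
  proof -
    obtain v where "(nrm (\<lambda>i. f i - emb v i))\<^sup>2 < (inverse (real (Suc n)))\<^sup>2"
      using ex[of "(inverse (real (Suc n)))\<^sup>2"] by auto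
    then show ?thesis by (intro exI[of _ v]) (rule power2_less_imp_less, auto)
  qed
  then obtain v where v: "\<And>n. nrm (\<lambda>i. f i - emb (v n) i) < inverse (real (Suc n))" by metis
  have "(\<lambda>n. nrm (\<lambda>i. f i - emb (v n) i)) \<longlonglongrightarrow> 0"
  proof (rule tendsto_sandwich[OF _ _ tendsto_const LIMSEQ_inverse_real_of_nat])
    show "\<forall>\<^sub>F n in sequentially. 0 \<le> nrm (\<lambda>i. f i - emb (v n) i)"
      by (intro always_eventually allI nrm_nonneg rkhs_diff f emb_rkhs)
    show "\<forall>\<^sub>F n in sequentially. nrm (\<lambda>i. f i - emb (v n) i) \<le> inverse (real (Suc n))"
      using v by (intro always_eventually allI less_imp_le)
  qed
  then show thesis by (rule that)
qed

text \<open>The real part of the inner product, by polarisation.\<close>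

definition re_ip :: "('i \<Rightarrow> complex) \<Rightarrow> ('i \<Rightarrow> complex) \<Rightarrow> real" where
  "re_ip f g = ((nrm (\<lambda>i. f i + g i))\<^sup>2 - (nrm (\<lambda>i. f i - g i))\<^sup>2) / 4"

definition ip :: "('i \<Rightarrow> complex) \<Rightarrow> ('i \<Rightarrow> complex) \<Rightarrow> complex" where
  "ip f g = Complex (re_ip f g) (re_ip f (\<lambda>i. \<i> * g i))"

lemma re_ip_emb: assumes f: "f \<in> rkhs" shows "re_ip f (emb v) = Re (ev f v)"
proof -
  have "(\<lambda>i. f i + emb v i) = (\<lambda>i. f i - emb (lscale (-1) v) i)" by simp
  then show ?thesis
    unfolding re_ip_def using nrm_diff_emb[OF f, of v] nrm_diff_emb[OF f, of "lscale (-1) v"]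
    by (simp add: gain_def sqnorm_lscale)
qed

lemma ip_emb: assumes f: "f \<in> rkhs" shows "ip f (emb v) = ev f v"
  using re_ip_emb[OF f, of v] re_ip_emb[OF f, of "lscale \<i> v"]
  by (simp add: ip_def emb_lscale_fun complex_eq_iff)

lemma nrm_lipschitz:
  assumes f: "f \<in> rkhs" and g: "g \<in> rkhs"
  shows "\<bar>nrm f - nrm g\<bar> \<le> nrm (\<lambda>i. f i - g i)"
proof -
  have "nrm f \<le> nrm g + nrm (\<lambda>i. f i - g i)"
    using nrm_add[OF g rkhs_diff[OF f g]] by simp
  moreover have "nrm g \<le> nrm f + nrm (\<lambda>i. f i - g i)"
    using nrm_add[OF f rkhs_diff[OF g f]] nrm_diff_commute[OF f g] by simp
  ultimately show ?thesis by simp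
qed

lemma nrm_tendsto:
  assumes "f \<in> rkhs" "\<And>n. F n \<in> rkhs" "(\<lambda>n. nrm (\<lambda>i. F n i - f i)) \<longlonglongrightarrow> 0"
  shows "(\<lambda>n. nrm (F n)) \<longlonglongrightarrow> nrm f"
proof (rule LIM_zero_cancel, rule Lim_null_comparison[OF _ assms(3)])
  show "\<forall>\<^sub>F n in sequentially. norm (nrm (F n) - nrm f) \<le> nrm (\<lambda>i. F n i - f i)"
    using nrm_lipschitz[OF assms(2) assms(1)] by (intro always_eventually) simp
qed

lemma re_ip_tendsto:
  assumes f: "f \<in> rkhs" and g: "g \<in> rkhs" and G: "\<And>n. G n \<in> rkhs"
    and lim: "(\<lambda>n. nrm (\<lambda>i. G n i - g i)) \<longlonglongrightarrow> 0"
  shows "(\<lambda>n. re_ip f (G n)) \<longlonglongrightarrow> re_ip f g"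
proof -
  have "(\<lambda>n. nrm (\<lambda>i. f i + G n i)) \<longlonglongrightarrow> nrm (\<lambda>i. f i + g i)"
    by (rule nrm_tendsto) (use lim in \<open>auto intro: rkhs_add f g G\<close>)
  moreover have "(\<lambda>n. nrm (\<lambda>i. f i - G n i)) \<longlonglongrightarrow> nrm (\<lambda>i. f i - g i)"
  proof (rule nrm_tendsto)
    have "nrm (\<lambda>i. f i - G n i - (f i - g i)) = nrm (\<lambda>i. G n i - g i)" for n
      using nrm_diff_commute[OF G g] by simp
    then show "(\<lambda>n. nrm (\<lambda>i. f i - G n i - (f i - g i))) \<longlonglongrightarrow> 0" using lim by simp
  qed (intro rkhs_diff f g G)+
  ultimately show ?thesis unfolding re_ip_def by (intro tendsto_intros) auto
qed

lemma ip_tendsto: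
  assumes f: "f \<in> rkhs" and g: "g \<in> rkhs" and G: "\<And>n. G n \<in> rkhs"
    and lim: "(\<lambda>n. nrm (\<lambda>i. G n i - g i)) \<longlonglongrightarrow> 0"
  shows "(\<lambda>n. ip f (G n)) \<longlonglongrightarrow> ip f g"
proof -
  have "nrm (\<lambda>i. \<i> * G n i - \<i> * g i) = nrm (\<lambda>i. G n i - g i)" for n
    using nrm_mult[OF rkhs_diff[OF G g], of \<i>] by (simp add: algebra_simps)
  then have "(\<lambda>n. re_ip f (\<lambda>i. \<i> * G n i)) \<longlonglongrightarrow> re_ip f (\<lambda>i. \<i> * g i)"
    using lim by (intro re_ip_tendsto f rkhs_mult g G) simp
  then show ?thesis
    unfolding ip_def using re_ip_tendsto[OF assms] by (intro tendsto_Complex)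
qed

text \<open>The inner product with \<open>g\<close> is a limit of evaluations, which are visibly linear;
  this gives linearity in the first argument without the parallelogram law.\<close>

lemma ip_approx:
  assumes g: "g \<in> rkhs"
  shows "\<exists>v. \<forall>f\<in>rkhs. (\<lambda>n. ev f (v n)) \<longlonglongrightarrow> ip f g"
proof -
  obtain v where v: "(\<lambda>n. nrm (\<lambda>i. g i - emb (v n) i)) \<longlonglongrightarrow> 0" by (rule emb_dense[OF g])
  have "nrm (\<lambda>i. g i - emb (v n) i) = nrm (\<lambda>i. emb (v n) i - g i)" for n
    by (intro nrm_diff_commute g emb_rkhs)
  then have "(\<lambda>n. ip f (emb (v n))) \<longlonglongrightarrow> ip f g" if "f \<in> rkhs" for f
    using v by (intro ip_tendsto that g emb_rkhs) simp
  then show ?thesis by (intro exI[of _ v]) (simp add: ip_emb)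
qed

lemma ip_add_left:
  assumes "f \<in> rkhs" "f' \<in> rkhs" "g \<in> rkhs"
  shows "ip (\<lambda>i. f i + f' i) g = ip f g + ip f' g"
proof -
  obtain v where v: "\<And>f. f \<in> rkhs \<Longrightarrow> (\<lambda>n. ev f (v n)) \<longlonglongrightarrow> ip f g"
    using ip_approx[OF assms(3)] by blast
  have "(\<lambda>n. ev f (v n) + ev f' (v n)) \<longlonglongrightarrow> ip f g + ip f' g"
    by (intro tendsto_add v assms)
  then show ?thesis
    using LIMSEQ_unique[OF v[OF rkhs_add[OF assms(1,2)]]] by (simp add: ev_add)
qed

lemma ip_mult_left:
  assumes "f \<in> rkhs" "g \<in> rkhs" shows "ip (\<lambda>i. c * f i) g = c * ip f g"
proof -
  obtain v where v: "\<And>f. f \<in> rkhs \<Longrightarrow> (\<lambda>n. ev f (v n)) \<longlonglongrightarrow> ip f g"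
    using ip_approx[OF assms(2)] by blast
  have "(\<lambda>n. c * ev f (v n)) \<longlonglongrightarrow> c * ip f g"
    by (intro tendsto_mult tendsto_const v assms)
  then show ?thesis
    using LIMSEQ_unique[OF v[OF rkhs_mult[OF assms(1)]]] by (simp add: ev_mult)
qed

lemma re_ip_commute: "f \<in> rkhs \<Longrightarrow> g \<in> rkhs \<Longrightarrow> re_ip f g = re_ip g f"
  using nrm_diff_commute[of f g] by (simp add: re_ip_def add.commute)

lemma ip_commute:
  assumes f: "f \<in> rkhs" and g: "g \<in> rkhs" shows "ip f g = cnj (ip g f)"
proof -
  have "nrm (\<lambda>i. \<i> * (g i - \<i> * f i)) = nrm (\<lambda>i. g i - \<i> * f i)"
    "nrm (\<lambda>i. - \<i> * (g i + \<i> * f i)) = nrm (\<lambda>i. g i + \<i> * f i)"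
    using nrm_mult[OF rkhs_diff[OF g rkhs_mult[OF f]], of \<i> \<i>]
      nrm_mult[OF rkhs_add[OF g rkhs_mult[OF f]], of "- \<i>" \<i>] by simp_all
  moreover have "(\<lambda>i. \<i> * (g i - \<i> * f i)) = (\<lambda>i. f i + \<i> * g i)"
    "(\<lambda>i. - \<i> * (g i + \<i> * f i)) = (\<lambda>i. f i - \<i> * g i)"
    by (simp_all add: fun_eq_iff algebra_simps flip: mult.assoc)
  ultimately have "re_ip f (\<lambda>i. \<i> * g i) = - re_ip g (\<lambda>i. \<i> * f i)"
    unfolding re_ip_def by (simp add: field_simps)
  then show ?thesis using re_ip_commute[OF f g] by (simp add: ip_def complex_eq_iff)
qed

lemma Re_ip_self: assumes f: "f \<in> rkhs" shows "Re (ip f f) = (nrm f)\<^sup>2"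
proof -
  have "nrm (\<lambda>i. f i + f i) = 2 * nrm f" using nrm_mult[OF f, of 2] by simp
  then show ?thesis by (simp add: ip_def re_ip_def nrm_zero power_mult_distrib)
qed

definition RK :: "('i \<Rightarrow> complex) hilbert" where
  "RK = \<lparr>carrier = rkhs, mult = undefined, one = undefined, zero = (\<lambda>_. 0),
     add = (\<lambda>f g i. f i + g i), smult = (\<lambda>c f i. c * f i), hinner = ip\<rparr>"

lemma RK_simps [simp]: "carrier RK = rkhs" "\<zero>\<^bsub>RK\<^esub> = (\<lambda>_. 0)"
  "f \<oplus>\<^bsub>RK\<^esub> g = (\<lambda>i. f i + g i)" "c \<odot>\<^bsub>RK\<^esub> f = (\<lambda>i. c * f i)" "hinner RK = ip"
  by (simp_all add: RK_def)

lemma RK_abelian: "abelian_group RK"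
proof (rule abelian_groupI)
  fix f assume "f \<in> carrier RK"
  then show "\<exists>g\<in>carrier RK. g \<oplus>\<^bsub>RK\<^esub> f = \<zero>\<^bsub>RK\<^esub>"
    by (intro bexI[of _ "\<lambda>i. - f i"]) (auto intro: rkhs_uminus)
qed (auto simp: rkhs_add rkhs_zero add.assoc add.commute)

lemma RK_inner: "complex_inner_space RK"
proof (intro complex_inner_space.intro complex_inner_space_axioms.intro)
  show "module (cring_class_ops :: complex ring) RK"
    by (intro moduleI RK_abelian cring_class)
      (auto simp: rkhs_mult cring_class_ops_def algebra_simps)
  fix f assume f: "f \<in> carrier RK"
  then show "0 \<le> Re (hinner RK f f)" by (simp add: Re_ip_self)
  assume "hinner RK f f = 0"
  then have "nrm f = 0" using f Re_ip_self[of f] by simp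
  then show "f = \<zero>\<^bsub>RK\<^esub>" using f nrm_eq_0D by simp
next
  show "hinner RK f g = cnj (hinner RK g f)" if "f \<in> carrier RK" "g \<in> carrier RK" for f g
    using that unfolding RK_simps by (rule ip_commute)
qed (simp_all add: ip_add_left ip_mult_left)

lemma hnorm_RK: "f \<in> rkhs \<Longrightarrow> hnorm RK f = nrm f"
  by (simp add: hnorm_def Re_ip_self nrm_nonneg)

sublocale RK: complex_inner_space RK by (rule RK_inner)

lemma RK_minus: assumes "f \<in> rkhs" "g \<in> rkhs" shows "f \<ominus>\<^bsub>RK\<^esub> g = (\<lambda>i. f i - g i)"
proof -
  have "\<ominus>\<^bsub>RK\<^esub> g = (\<lambda>i. - g i)"
    using assms by (intro RK.M.minus_equality) (auto intro: rkhs_uminus)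
  then show ?thesis by (simp add: a_minus_def)
qed

lemma hdist_RK: "f \<in> rkhs \<Longrightarrow> g \<in> rkhs \<Longrightarrow> hdist RK f g = nrm (\<lambda>i. f i - g i)"
  by (simp add: hdist_def RK_minus hnorm_RK rkhs_diff)

text \<open>A Cauchy sequence converges pointwise, and the norm estimates pass to the pointwise limit.\<close>

lemma RK_hilbert: "hilbert_space RK"
proof (intro hilbert_space.intro hilbert_space_axioms.intro RK_inner)
  interpret M: Metric_space "carrier RK" "hdist RK" by (rule RK.Metric_space_hdist)
  show "M.mcomplete"
    unfolding M.mcomplete_def
  proof (intro allI impI)
    fix F assume F: "M.MCauchy F"
    have "range F \<subseteq> rkhs"
      using F unfolding M.MCauchy_def by simp
    then have Fr: "F n \<in> rkhs" for n by blast
    have close: "\<exists>N. \<forall>m\<ge>N. \<forall>n\<ge>N. nrm (\<lambda>i. F m i - F n i) < e" if "e > 0" for e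
    proof -
      obtain N where N: "\<forall>m n. N \<le> m \<longrightarrow> N \<le> n \<longrightarrow> hdist RK (F m) (F n) < e"
        using F \<open>e > 0\<close> unfolding M.MCauchy_def by blast
      have "nrm (\<lambda>i. F m i - F n i) < e" if "m \<ge> N" "n \<ge> N" for m n
        using N that unfolding hdist_RK[OF Fr[of m] Fr[of n], symmetric] by blast
      then show ?thesis by blast
    qed
    have "Cauchy (\<lambda>n. F n i)" for i
    proof (rule CauchyI)
      fix e :: real assume "e > 0"
      define s where "s = sqrt (sqnorm [(i, 1)]) + 1"
      have s: "s > 0" using sqnorm_nonneg[of "[(i, 1)]"] by (simp add: s_def add_nonneg_pos)
      obtain N where N: "\<forall>m\<ge>N. \<forall>n\<ge>N. nrm (\<lambda>i. F m i - F n i) < e / s"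
        using close[of "e / s"] \<open>e > 0\<close> s by auto
      have "norm (F m i - F n i) < e" if "m \<ge> N" "n \<ge> N" for m n
      proof -
        have r: "(\<lambda>i. F m i - F n i) \<in> rkhs" by (intro rkhs_diff Fr)
        have "norm (F m i - F n i) \<le> nrm (\<lambda>i. F m i - F n i) * sqrt (sqnorm [(i, 1)])"
          using ev_le[OF r, of "[(i, 1)]"] by simp
        also have "\<dots> \<le> nrm (\<lambda>i. F m i - F n i) * s"
          using nrm_nonneg[OF r] by (intro mult_left_mono) (auto simp: s_def)
        also have "\<dots> < e / s * s" using N that s by (intro mult_strict_right_mono) auto
        finally show ?thesis using s by simp
      qed
      then show "\<exists>M. \<forall>m\<ge>M. \<forall>n\<ge>M. norm (F m i - F n i) < e" by blast
    qed
    then have f: "(\<lambda>n. F n i) \<longlonglongrightarrow> lim (\<lambda>n. F n i)" for i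
      using Cauchy_convergent convergent_LIMSEQ_iff by blast
    define f where "f i = lim (\<lambda>n. F n i)" for i
    note f = f[folded f_def]
    have tail: "bound (\<lambda>i. F m i - f i) e"
      if N: "\<forall>m\<ge>N. \<forall>n\<ge>N. nrm (\<lambda>i. F m i - F n i) < e" and m: "m \<ge> N" and e: "e > 0" for N m e
    proof -
      have "cmod (ev (\<lambda>i. F m i - f i) v) \<le> e * sqrt (sqnorm v)" for v
      proof (rule tendsto_upperbound)
        show "(\<lambda>n. cmod (ev (\<lambda>i. F m i - F n i) v)) \<longlonglongrightarrow> cmod (ev (\<lambda>i. F m i - f i) v)"
          by (rule tendsto_norm, rule ev_tendsto, rule tendsto_diff[OF tendsto_const f])
        have "cmod (ev (\<lambda>i. F m i - F n i) v) \<le> e * sqrt (sqnorm v)" if "n \<ge> N" for n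
        proof -
          have r: "(\<lambda>i. F m i - F n i) \<in> rkhs" by (intro rkhs_diff Fr)
          have "nrm (\<lambda>i. F m i - F n i) * sqrt (sqnorm v) \<le> e * sqrt (sqnorm v)"
            using N m that sqnorm_nonneg[of v] by (intro mult_right_mono) (auto simp: less_imp_le)
          then show ?thesis using ev_le[OF r, of v] by linarith
        qed
        then show "\<forall>\<^sub>F n in sequentially. cmod (ev (\<lambda>i. F m i - F n i) v) \<le> e * sqrt (sqnorm v)"
          using eventually_sequentially by blast
      qed simp
      then show ?thesis using e by (simp add: bound_def)
    qed
    obtain N where N: "\<forall>m\<ge>N. \<forall>n\<ge>N. nrm (\<lambda>i. F m i - F n i) < 1" using close[of 1] by auto
    have "(\<lambda>i. F N i - f i) \<in> rkhs" using tail[OF N] by (intro rkhsI) auto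
    then have fr: "f \<in> rkhs" using rkhs_diff[OF Fr[of N]] by fastforce
    have "limitin M.mtopology F f sequentially"
      unfolding M.limit_metric_sequentially
    proof (intro conjI allI impI)
      show "f \<in> carrier RK" using fr by simp
      fix e :: real assume "e > 0"
      then obtain N where N: "\<forall>m\<ge>N. \<forall>n\<ge>N. nrm (\<lambda>i. F m i - F n i) < e / 2"
        using close[of "e / 2"] by auto
      have "hdist RK (F n) f < e" if "n \<ge> N" for n
        unfolding hdist_RK[OF Fr[of n] fr] using nrm_le[OF tail[OF N that]] \<open>e > 0\<close> by simp
      then show "\<exists>N. \<forall>n\<ge>N. F n \<in> carrier RK \<and> hdist RK (F n) f < e" using Fr by auto
    qed
    then show "\<exists>x. limitin M.mtopology F x sequentially" by blast
  qed
qed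

end

section \<open>Riesz representation and adjoints\<close>

lemma linear_coeff_eq_0:
  fixes d s :: real
  assumes quad: "\<And>t. 0 \<le> 2 * t * d + t\<^sup>2 * s" and s: "0 \<le> s"
  shows "d = 0"
proof -
  define u where "u = d / (s + 1)"
  have d: "d = u * (s + 1)" using s by (simp add: u_def)
  have "2 * (- u) * d + (- u)\<^sup>2 * s = - (u\<^sup>2 * (s + 2))"
    unfolding d by (simp add: monoid_mult_class.power2_eq_square algebra_simps)
  then have "u\<^sup>2 * (s + 2) \<le> 0" using quad[of "- u"] by simp
  then have "u = 0" using s by (simp add: mult_le_0_iff)
  then show ?thesis using d by simp
qed

context complex_inner_space
begin

lemma hnorm_smult: "x \<in> carrier H \<Longrightarrow> hnorm H (c \<odot> x) = cmod c * hnorm H x"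
proof -
  assume x: "x \<in> carrier H"
  have "hinner H (c \<odot> x) (c \<odot> x) = (c * cnj c) * hinner H x x"
    using x by (simp add: hinner_smult_left hinner_smult_right smult_closed_complex)
  also have "c * cnj c = complex_of_real ((cmod c)\<^sup>2)"
    by (rule complex_norm_square[symmetric])
  finally show ?thesis by (simp add: hnorm_def real_sqrt_mult)
qed

lemma cmod_hinner_le:
  assumes x: "x \<in> carrier H" and y: "y \<in> carrier H"
  shows "cmod (hinner H x y) \<le> hnorm H x * hnorm H y"
proof (cases "hinner H x y = 0")
  case True
  then show ?thesis using x y by (simp add: hnorm_ge_zero)
next
  case False
  let ?z = "hinner H x y"
  let ?u = "cnj (sgn ?z)"
  have "?u * ?z = (?z * cnj ?z) / complex_of_real (cmod ?z)" by (simp add: sgn_eq)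
  also have "\<dots> = complex_of_real (cmod ?z)"
    unfolding complex_norm_square[symmetric] using False
    by (simp add: monoid_mult_class.power2_eq_square)
  finally have "Re (hinner H (?u \<odot> x) y) = cmod ?z"
    using x y by (simp add: hinner_smult_left)
  moreover have "hnorm H (?u \<odot> x) = hnorm H x"
    using x False by (simp add: hnorm_smult norm_sgn)
  ultimately show ?thesis
    using Re_hinner_le[OF smult_closed_complex[OF x, of ?u] y] by simp
qed

lemma hinner_minus_right:
  assumes "x \<in> carrier H" "y \<in> carrier H"
  shows "hinner H x (\<ominus> y) = - hinner H x y"
  using hinner_commute[of x "\<ominus> y"] hinner_commute[of x y] assms by (simp add: hinner_minus_left)

lemma hinner_eqI:
  assumes "x \<in> carrier H" "y \<in> carrier H" "\<And>z. z \<in> carrier H \<Longrightarrow> hinner H z x = hinner H z y"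
  shows "x = y"
proof -
  have "hinner H (x \<ominus> y) (x \<ominus> y) = 0"
    using assms by (simp add: a_minus_def hinner_add_right hinner_minus_right)
  then have "x \<ominus> y = \<zero>" using assms by (intro hinner_eq_zero) auto
  moreover have "x = (x \<ominus> y) \<oplus> y" using assms by (simp add: a_minus_def M.a_assoc M.l_neg)
  ultimately show ?thesis using assms by simp
qed

lemma hnorm_square_minus:
  assumes "x \<in> carrier H" "y \<in> carrier H"
  shows "(hnorm H (x \<ominus> y))\<^sup>2 = (hnorm H x)\<^sup>2 - 2 * Re (hinner H x y) + (hnorm H y)\<^sup>2"
  using assms by (simp add: a_minus_def hnorm_square_add hinner_minus_right hnorm_minus)

lemma hnorm_le_add_dist:
  assumes "x \<in> carrier H" "y \<in> carrier H" shows "hnorm H x \<le> hnorm H y + hdist H x y"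
proof -
  have "x = (x \<ominus> y) \<oplus> y" using assms by (simp add: a_minus_def M.a_assoc M.l_neg)
  then have "hnorm H x \<le> hnorm H (x \<ominus> y) + hnorm H y"
    using hnorm_triangle[of "x \<ominus> y" y] assms by simp
  then show ?thesis using assms by (simp add: hdist_def)
qed

end

context hilbert_space
begin

text \<open>The representing vector minimises
  \<open>\<parallel>y\<parallel>\<^sup>2 - 2 Re (g y)\<close>. The parallelogram identity
  makes a minimising sequence Cauchy, and the first variation at the minimum gives the
  representation.\<close>

theorem riesz_representation:
  assumes g_add: "\<And>x y. x \<in> carrier H \<Longrightarrow> y \<in> carrier H \<Longrightarrow> g (x \<oplus> y) = g x + g y"
    and g_smult: "\<And>c x. x \<in> carrier H \<Longrightarrow> g (c \<odot> x) = c * g x"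
    and g_bound: "\<And>x. x \<in> carrier H \<Longrightarrow> cmod (g x) \<le> C * hnorm H x"
  shows "\<exists>x\<in>carrier H. \<forall>y\<in>carrier H. g y = hinner H y x"
proof -
  interpret D: Metric_space "carrier H" "hdist H" by (rule Metric_space_hdist)
  define Q where "Q y = (hnorm H y)\<^sup>2 - 2 * Re (g y)" for y
  define m where "m = Inf (Q ` carrier H)"
  have "- C\<^sup>2 \<le> Q y" if "y \<in> carrier H" for y
  proof -
    have "Re (g y) \<le> C * hnorm H y"
      using g_bound[OF that] complex_Re_le_cmod[of "g y"] by linarith
    moreover have "0 \<le> (hnorm H y - C)\<^sup>2" by simp
    ultimately show ?thesis by (simp add: Q_def power2_diff mult.commute)
  qed
  then have bdd: "bdd_below (Q ` carrier H)" by (intro bdd_belowI[of _ "- C\<^sup>2"]) auto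
  have m_le: "m \<le> Q y" if "y \<in> carrier H" for y
    unfolding m_def using that bdd by (intro cInf_lower) auto
  \<comment> \<open>A minimising sequence.\<close>
  have "\<exists>y\<in>carrier H. Q y < m + inverse (real (Suc n))" for n
  proof -
    have "Inf (Q ` carrier H) < m + inverse (real (Suc n))" by (simp add: m_def)
    then show ?thesis
      using cInf_lessD[of "Q ` carrier H"] M.zero_closed by blast
  qed
  then obtain y where y: "y n \<in> carrier H" "Q (y n) < m + inverse (real (Suc n))" for n
    by metis
  \<comment> \<open>Parallelogram identity: \<open>Q\<close> at the midpoint is at least \<open>m\<close>.\<close>
  have close: "(hdist H (y n) (y p))\<^sup>2 \<le> 2 * inverse (real (Suc n)) + 2 * inverse (real (Suc p))"
    for n p
  proof -
    let ?s = "y n \<oplus> y p"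
    let ?z = "(1/2 :: complex) \<odot> ?s"
    have z: "?z \<in> carrier H" using y by (simp add: smult_closed_complex)
    have "hnorm H ?z = hnorm H ?s / 2" using y by (simp add: hnorm_smult)
    then have "(hnorm H ?z)\<^sup>2 = (hnorm H ?s)\<^sup>2 / 4" by (simp only: power_divide) simp
    moreover have "g ?z = (g (y n) + g (y p)) / 2" using y by (simp add: g_smult g_add)
    then have "Re (g ?z) = (Re (g (y n)) + Re (g (y p))) / 2"
      by (simp only: Re_divide_numeral plus_complex.sel)
    ultimately have "4 * Q ?z = (hnorm H ?s)\<^sup>2 - 4 * Re (g (y n)) - 4 * Re (g (y p))"
      unfolding Q_def by simp
    then have "(hdist H (y n) (y p))\<^sup>2 = 2 * Q (y n) + 2 * Q (y p) - 4 * Q ?z"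
      using y by (simp add: hdist_def hnorm_square_add hnorm_square_minus Q_def)
    then show ?thesis using m_le[OF z] y(2)[of n] y(2)[of p] by linarith
  qed
  have "D.MCauchy y"
    unfolding D.MCauchy_def
  proof (intro conjI allI impI)
    show "range y \<subseteq> carrier H" using y by blast
    fix e :: real assume e: "e > 0"
    then obtain N where N: "inverse (real (Suc N)) < e\<^sup>2 / 4"
      using reals_Archimedean[of "e\<^sup>2/4"] by auto
    have "hdist H (y n) (y p) < e" if "N \<le> n" "N \<le> p" for n p
    proof -
      have "inverse (real (Suc n)) \<le> inverse (real (Suc N))" "inverse (real (Suc p)) \<le> inverse (real (Suc N))"
        using that by (auto intro!: le_imp_inverse_le)
      then have "(hdist H (y n) (y p))\<^sup>2 < e\<^sup>2" using close[of n p] N by linarith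
      then show ?thesis using e by (rule power2_less_imp_less[OF _ less_imp_le])
    qed
    then show "\<exists>N. \<forall>n n'. N \<le> n \<longrightarrow> N \<le> n' \<longrightarrow> hdist H (y n) (y n') < e" by blast
  qed
  then obtain x where "limitin D.mtopology y x sequentially"
    using complete unfolding D.mcomplete_def by blast
  then have x: "x \<in> carrier H" and lim: "(\<lambda>n. hdist H (y n) x) \<longlonglongrightarrow> 0"
    unfolding D.limitin_metric_dist_null by blast+
  have "(\<lambda>n. hnorm H (y n) - hnorm H x) \<longlonglongrightarrow> 0"
  proof (rule Lim_null_comparison[OF _ lim], intro always_eventually allI)
    show "norm (hnorm H (y n) - hnorm H x) \<le> hdist H (y n) x" for n
      using hnorm_le_add_dist[OF y(1) x, of n] hnorm_le_add_dist[OF x y(1), of n]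
        D.commute[of x "y n"] by simp
  qed
  then have "(\<lambda>n. hnorm H (y n)) \<longlonglongrightarrow> hnorm H x" by (simp add: LIM_zero_iff)
  moreover have "(\<lambda>n. g (y n) - g x) \<longlonglongrightarrow> 0"
  proof (rule Lim_null_comparison[of _ "\<lambda>n. C * hdist H (y n) x"], intro always_eventually allI)
    fix n
    have "g (y n) = g (y n \<ominus> x) + g x"
      using g_add[of "y n \<ominus> x" x] y x by (simp add: a_minus_def M.a_assoc M.l_neg)
    then show "norm (g (y n) - g x) \<le> C * hdist H (y n) x"
      using g_bound[of "y n \<ominus> x"] y x by (simp add: hdist_def)
    show "(\<lambda>n. C * hdist H (y n) x) \<longlonglongrightarrow> 0"
      using tendsto_mult_left[OF lim, of C] by simp
  qed
  then have "(\<lambda>n. g (y n)) \<longlonglongrightarrow> g x" by (simp add: LIM_zero_iff)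
  ultimately have "(\<lambda>n. Q (y n)) \<longlonglongrightarrow> Q x"
    unfolding Q_def by (intro tendsto_intros)
  moreover have "(\<lambda>n. m + inverse (real (Suc n))) \<longlonglongrightarrow> m + 0"
    by (intro tendsto_add tendsto_const LIMSEQ_inverse_real_of_nat)
  ultimately have Qx: "Q x \<le> m"
    using y(2) by (intro tendsto_le[OF sequentially_bot, of _ "m"]) (auto intro!: always_eventually less_imp_le)
  have re: "Re (hinner H x z) = Re (g z)" if z: "z \<in> carrier H" for z
  proof -
    let ?d = "Re (hinner H x z) - Re (g z)" and ?s = "(hnorm H z)\<^sup>2"
    have quad: "0 \<le> 2 * t * ?d + t\<^sup>2 * ?s" for t :: real
    proof -
      have tz: "complex_of_real t \<odot> z \<in> carrier H" using z by (rule smult_closed_complex)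
      have "Q x \<le> Q (x \<oplus> complex_of_real t \<odot> z)"
        using Qx m_le[of "x \<oplus> complex_of_real t \<odot> z"] x tz by simp
      then show ?thesis
        using x z tz
        by (simp add: Q_def hnorm_square_add g_add g_smult hnorm_smult hinner_smult_right
            power_mult_distrib algebra_simps)
    qed
    have "?d = 0" by (rule linear_coeff_eq_0[OF quad]) simp
    then show ?thesis by simp
  qed
  have "g z = hinner H z x" if z: "z \<in> carrier H" for z
  proof -
    have iz: "\<i> \<odot> z \<in> carrier H" using z by (rule smult_closed_complex)
    have "Im (hinner H x z) = - Im (g z)"
      using re[OF iz] x z by (simp add: hinner_smult_right g_smult)
    then show ?thesis using re[OF z] hinner_commute[OF z x] by (simp add: complex_eq_iff)
  qed
  then show ?thesis using x by blast
qed

theorem adjoint_exists: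
  assumes T: "T \<in> bounded_ops H"
  obtains S where "is_adjoint H T S"
proof -
  obtain C where C: "\<And>x. x \<in> carrier H \<Longrightarrow> hnorm H (T x) \<le> C * hnorm H x"
    and lin: "hlinear H H T"
    using T by (auto simp: bounded_ops_def)
  have Tc: "x \<in> carrier H \<Longrightarrow> T x \<in> carrier H" for x using lin by (auto simp: hlinear_def)
  have "\<exists>s\<in>carrier H. \<forall>y\<in>carrier H. hinner H (T y) x = hinner H y s" if x: "x \<in> carrier H" for x
  proof (rule riesz_representation)
    show "cmod (hinner H (T y) x) \<le> (C * hnorm H x) * hnorm H y" if y: "y \<in> carrier H" for y
    proof -
      have "cmod (hinner H (T y) x) \<le> hnorm H (T y) * hnorm H x"
        using x y Tc by (intro cmod_hinner_le) auto
      also have "\<dots> \<le> (C * hnorm H y) * hnorm H x"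
        using C[OF y] x by (intro mult_right_mono hnorm_ge_zero) auto
      finally show ?thesis by (simp add: mult_ac)
    qed
  qed (use lin x Tc in \<open>simp_all add: hlinear_def hinner_add_left hinner_smult_left\<close>)
  then obtain S where S: "\<And>x. x \<in> carrier H \<Longrightarrow> S x \<in> carrier H"
    "\<And>x y. x \<in> carrier H \<Longrightarrow> y \<in> carrier H \<Longrightarrow> hinner H (T y) x = hinner H y (S x)"
    by metis
  have "hlinear H H S"
    unfolding hlinear_def
  proof (intro conjI ballI allI)
    show "S \<in> carrier H \<rightarrow> carrier H" using S by blast
    fix x assume x: "x \<in> carrier H"
    show "S (x \<oplus> y) = S x \<oplus> S y" if y: "y \<in> carrier H" for y
      using x y S Tc by (intro hinner_eqI) (auto simp: hinner_add_right simp flip: S(2))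
    show "S (c \<odot> x) = c \<odot> S x" for c
      using x S Tc by (intro hinner_eqI)
        (auto simp: hinner_smult_right smult_closed_complex simp flip: S(2))
  qed
  moreover have "hnorm H (S x) \<le> C * hnorm H x" if x: "x \<in> carrier H" for x
  proof (cases "hnorm H (S x) = 0")
    case True
    have "0 \<le> C * hnorm H x" using C[OF x] hnorm_ge_zero[OF Tc[OF x]] by linarith
    then show ?thesis using True by simp
  next
    case False
    have "(hnorm H (S x))\<^sup>2 = Re (hinner H (T (S x)) x)"
      using x S by (simp add: hnorm_square)
    also have "\<dots> \<le> hnorm H (T (S x)) * hnorm H x" using x S Tc by (intro Re_hinner_le) auto
    also have "\<dots> \<le> (C * hnorm H (S x)) * hnorm H x"
      using C[OF S(1)[OF x]] x by (intro mult_right_mono hnorm_ge_zero) auto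
    finally have "hnorm H (S x) * hnorm H (S x) \<le> hnorm H (S x) * (C * hnorm H x)"
      by (simp add: monoid_mult_class.power2_eq_square mult_ac)
    moreover have "0 < hnorm H (S x)" using False hnorm_ge_zero[OF S(1)[OF x]] by simp
    ultimately show ?thesis by simp
  qed
  ultimately have "S \<in> bounded_ops H" by (auto simp: bounded_ops_def)
  then show thesis using S T by (intro that[of S]) (simp add: is_adjoint_def)
qed

end

context complex_inner_space
begin

lemma contraction_norm_le:
  assumes "contraction H T" "x \<in> carrier H"
  shows "hnorm H (T x) \<le> hnorm H x"
proof -
  have lin: "hlinear H H T" and n: "op_norm H T \<le> 1" and "\<exists>C. \<forall>x\<in>carrier H. hnorm H (T x) \<le> C * hnorm H x"
    using assms by (auto simp: contraction_def bounded_ops_def)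
  then obtain C where C: "\<And>x. x \<in> carrier H \<Longrightarrow> hnorm H (T x) \<le> C * hnorm H x" by blast
  have Tc: "x \<in> carrier H \<Longrightarrow> T x \<in> carrier H" for x using lin by (auto simp: hlinear_def)
  show ?thesis
  proof (cases "hnorm H x = 0")
    case True
    then show ?thesis using C[OF assms(2)] by simp
  next
    case False
    then have p: "0 < hnorm H x" using hnorm_ge_zero[OF assms(2)] by simp
    let ?c = "complex_of_real (inverse (hnorm H x))"
    let ?u = "?c \<odot> x"
    have u: "?u \<in> carrier H" "hnorm H ?u \<le> 1"
      using assms p by (simp_all add: smult_closed_complex hnorm_smult norm_inverse)
    have "hnorm H (T y) \<le> \<bar>C\<bar>" if "y \<in> carrier H" "hnorm H y \<le> 1" for y
    proof -
      have "C * hnorm H y \<le> \<bar>C\<bar> * hnorm H y"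
        using hnorm_ge_zero[OF that(1)] by (intro mult_right_mono) auto
      also have "\<dots> \<le> \<bar>C\<bar>" using that by (simp add: mult_left_le)
      finally show ?thesis using C[OF that(1)] by linarith
    qed
    then have "bdd_above ((\<lambda>x. hnorm H (T x)) ` {x \<in> carrier H. hnorm H x \<le> 1})"
      by (intro bdd_aboveI[of _ "\<bar>C\<bar>"]) auto
    then have "hnorm H (T ?u) \<le> op_norm H T"
      unfolding op_norm_def using u by (intro cSUP_upper) auto
    moreover have "T ?u = ?c \<odot> T x" using lin assms by (simp add: hlinear_def)
    then have "hnorm H (T ?u) = inverse (hnorm H x) * hnorm H (T x)"
      using assms p Tc by (simp add: hnorm_smult norm_inverse)
    ultimately have "inverse (hnorm H x) * hnorm H (T x) \<le> 1" using n by linarith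
    then show ?thesis using p by (simp add: field_simps)
  qed
qed

lemma contractionI:
  assumes lin: "hlinear H H T" and le: "\<And>x. x \<in> carrier H \<Longrightarrow> hnorm H (T x) \<le> hnorm H x"
  shows "contraction H T"
proof -
  have "\<exists>C. \<forall>x\<in>carrier H. hnorm H (T x) \<le> C * hnorm H x"
    using le by (intro exI[of _ 1]) simp
  moreover have "op_norm H T \<le> 1"
    unfolding op_norm_def
  proof (rule cSUP_least)
    have "\<zero> \<in> {x \<in> carrier H. hnorm H x \<le> 1}" by (simp add: hnorm_def hinner_zero_left)
    then show "{x \<in> carrier H. hnorm H x \<le> 1} \<noteq> {}" by blast
  qed (use le in force)
  ultimately show ?thesis using lin by (simp add: contraction_def bounded_ops_def)
qed

end

section \<open>Operators on a reproducing kernel Hilbert space\<close>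

text \<open>\<open>L\<close> assigns to each basis vector a formal combination; \<open>lift\<close> is the
  linear extension of this map, and \<open>pull\<close> is the adjoint operator, written in
  coordinates.\<close>

definition lift :: "('i \<Rightarrow> ('j \<times> complex) list) \<Rightarrow> ('i \<times> complex) list \<Rightarrow> ('j \<times> complex) list" where
  "lift L v = concat (map (\<lambda>(i, c). lscale c (L i)) v)"

definition pull :: "('i \<Rightarrow> ('j \<times> complex) list) \<Rightarrow> ('j \<Rightarrow> complex) \<Rightarrow> 'i \<Rightarrow> complex" where
  "pull L f i = ev f (L i)"

lemma ev_pull: "ev (pull L f) v = ev f (lift L v)"
  by (induction v) (auto simp: pull_def lift_def)

context pos_kernel
begin

lemma bound_pull:
  assumes f: "f \<in> rkhs" and B: "0 \<le> B" "\<And>v. sqnorm (lift L v) \<le> B\<^sup>2 * sqnorm v"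
  shows "bound (pull L f) (B * nrm f)"
proof -
  have "cmod (ev f (lift L v)) \<le> (B * nrm f) * sqrt (sqnorm v)" for v
  proof -
    have "sqrt (sqnorm (lift L v)) \<le> sqrt (B\<^sup>2 * sqnorm v)" using B(2)[of v] by simp
    also have "\<dots> = B * sqrt (sqnorm v)" using B(1) by (simp add: real_sqrt_mult)
    finally have "nrm f * sqrt (sqnorm (lift L v)) \<le> nrm f * (B * sqrt (sqnorm v))"
      using nrm_nonneg[OF f] by (rule mult_left_mono)
    then show ?thesis using ev_le[OF f, of "lift L v"] by (simp add: mult_ac)
  qed
  then show ?thesis using B nrm_nonneg[OF f] by (simp add: bound_def ev_pull)
qed

lemma hlinear_pull:
  assumes "\<And>f. f \<in> rkhs \<Longrightarrow> pull L f \<in> rkhs" shows "hlinear RK RK (pull L)"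
  using assms by (auto simp: hlinear_def pull_def ev_add ev_mult)

lemma ev_cong_emb:
  assumes f: "f \<in> rkhs" and eq: "emb v = emb w" shows "ev f v = ev f w"
proof -
  have "emb (v @ lscale (- 1) w) = (\<lambda>_. 0)" by (simp add: fun_eq_iff eq)
  then have "sqnorm (v @ lscale (- 1) w) = 0" unfolding sqnorm_def by (simp only: ev_zero zero_complex.sel)
  then have "ev f (v @ lscale (- 1) w) = 0" by (rule ev_null[OF f])
  then show ?thesis by simp
qed

lemma pull_emb_isometric:
  assumes "\<And>i j. gram (L i) (L j) = k i j"
  shows "pull L (emb (lift L v)) = emb v"
proof
  fix j
  show "pull L (emb (lift L v)) j = emb v j"
    unfolding pull_def
    by (induction v)
      (auto simp: lift_def assms emb_Nil_fun emb_append_fun emb_lscale_fun ev_add ev_mult)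
qed

lemma sqnorm_lift_isometric:
  assumes "\<And>i j. gram (L i) (L j) = k i j" shows "sqnorm (lift L v) = sqnorm v"
  unfolding sqnorm_def ev_pull[symmetric] pull_emb_isometric[OF assms] ..

text \<open>If the map on basis vectors preserves the kernel, then its linear extension is isometric and
  \<open>pull L\<close> is the adjoint of an isometry.\<close>

theorem pull_coisometry:
  assumes iso: "\<And>i j. gram (L i) (L j) = k i j"
  shows "contraction RK (pull L)" "coisometry RK (pull L)"
proof -
  have le: "sqnorm (lift L v) \<le> 1\<^sup>2 * sqnorm v" for v by (simp add: sqnorm_lift_isometric[OF iso])
  have b: "bound (pull L f) (1 * nrm f)" if "f \<in> rkhs" for f
    using that by (rule bound_pull[OF _ _ le]) simp
  have r: "pull L f \<in> rkhs" if "f \<in> rkhs" for f using b[OF that] by (rule rkhsI)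
  show con: "contraction RK (pull L)"
  proof (rule RK.contractionI)
    show "hlinear RK RK (pull L)" by (intro hlinear_pull r)
    show "hnorm RK (pull L f) \<le> hnorm RK f" if "f \<in> carrier RK" for f
      using that b r nrm_le by (fastforce simp: hnorm_RK)
  qed
  interpret hilbert_space RK by (rule RK_hilbert)
  obtain S where S: "is_adjoint RK (pull L) S"
    using con adjoint_exists unfolding contraction_def by blast
  have "pull L (S f) = f" if f: "f \<in> rkhs" for f
  proof
    fix i
    have Sf: "S f \<in> rkhs" using S f by (auto simp: is_adjoint_def bounded_ops_def hlinear_def)
    have "L i = lift L [(i, 1)]" by (simp add: lift_def lscale_def)
    then have e: "pull L (emb (L i)) = emb [(i, 1)]" using pull_emb_isometric[OF iso] by metis
    have "pull L (S f) i = ip (S f) (emb (L i))" by (simp add: pull_def ip_emb[OF Sf])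
    also have "\<dots> = cnj (ip (emb (L i)) (S f))" by (rule ip_commute[OF Sf emb_rkhs])
    also have "ip (emb (L i)) (S f) = ip (pull L (emb (L i))) f"
      using S f emb_rkhs[of "L i"] by (simp add: is_adjoint_def)
    also have "cnj (ip (pull L (emb (L i))) f) = ip f (emb [(i, 1)])"
      unfolding e by (rule ip_commute[OF f emb_rkhs, symmetric])
    also have "\<dots> = f i" by (simp add: ip_emb[OF f])
    finally show "pull L (S f) i = f i" .
  qed
  then show "coisometry RK (pull L)" using S by (auto simp: coisometry_def)
qed

end

text \<open>The range of an isometry defined on a complete space is complete, hence closed.\<close>

lemma hilbert_embeddingI:
  assumes "hilbert_space H" "complex_inner_space K"
    and lin: "hlinear H K J"
    and ip: "\<And>x y. x \<in> carrier H \<Longrightarrow> y \<in> carrier H \<Longrightarrow> hinner K (J x) (J y) = hinner H x y"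
  shows "hilbert_embedding H K J"
proof -
  interpret H: hilbert_space H by fact
  interpret K: complex_inner_space K by fact
  interpret DH: Metric_space "carrier H" "hdist H" by (rule H.Metric_space_hdist)
  interpret DK: Metric_space "carrier K" "hdist K" by (rule K.Metric_space_hdist)
  have Jc: "J x \<in> carrier K" if "x \<in> carrier H" for x using lin that by (auto simp: hlinear_def)
  have norm: "hnorm K (J x) = hnorm H x" if "x \<in> carrier H" for x
    using that by (simp add: hnorm_def ip)
  have dist: "hdist K (J x) (J y) = hdist H x y" if "x \<in> carrier H" "y \<in> carrier H" for x y
  proof -
    have "(hnorm K (J x \<ominus>\<^bsub>K\<^esub> J y))\<^sup>2 = (hnorm H (x \<ominus>\<^bsub>H\<^esub> y))\<^sup>2"
      using that by (simp only: K.hnorm_square_minus H.hnorm_square_minus Jc ip norm)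
    then have "hnorm K (J x \<ominus>\<^bsub>K\<^esub> J y) = hnorm H (x \<ominus>\<^bsub>H\<^esub> y)"
      by (rule power2_eq_imp_eq) (use that Jc in \<open>auto intro!: K.hnorm_ge_zero H.hnorm_ge_zero\<close>)
    then show ?thesis using that Jc by (simp add: hdist_def)
  qed
  have "closedin DK.mtopology (J ` carrier H)"
    unfolding DK.metric_closedin_iff_sequentially_closed
  proof (intro conjI allI impI)
    show "J ` carrier H \<subseteq> carrier K" using Jc by blast
    fix \<sigma> l assume \<sigma>: "range \<sigma> \<subseteq> J ` carrier H \<and> limitin DK.mtopology \<sigma> l sequentially"
    then have "\<forall>n. \<exists>x. x \<in> carrier H \<and> \<sigma> n = J x" by blast
    then obtain x where x: "\<And>n. x n \<in> carrier H" "\<And>n. \<sigma> n = J (x n)" by metis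
    have "DK.MCauchy \<sigma>"
      using \<sigma> x Jc by (intro DK.convergent_imp_MCauchy[of \<sigma> l]) auto
    then have "DH.MCauchy x"
      using x by (auto simp: DH.MCauchy_def DK.MCauchy_def dist)
    then obtain y where y: "limitin DH.mtopology x y sequentially"
      using H.complete unfolding DH.mcomplete_def by blast
    then have yc: "y \<in> carrier H" by (simp add: DH.limit_metric_sequentially)
    have "limitin DK.mtopology \<sigma> (J y) sequentially"
      using y yc x Jc by (simp add: DH.limit_metric_sequentially DK.limit_metric_sequentially dist)
    then have "l = J y" using \<sigma> DK.limitin_metric_unique by (metis trivial_limit_sequentially)
    then show "l \<in> J ` carrier H" using yc by blast
  qed
  then show ?thesis using lin ip by (simp add: hilbert_embedding_def)
qed

text \<open>The algebra acts on the indices in such a way that the vector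
  \<open>e\<^bsub>act c i\<^esub>\<close> behaves like \<open>\<rho>(c) e\<^sub>i\<close>.
  Additivity and multiplicativity of the action hold through the kernel, not for the indices
  themselves.\<close>

locale cp_action =
  fixes \<Theta> :: "'i \<Rightarrow> 'i \<Rightarrow> 'a::cstar_algebra \<Rightarrow> complex" and act :: "'a \<Rightarrow> 'i \<Rightarrow> 'i"
  assumes cp: "cp_kernel \<Theta>" and act_left: "\<Theta> (act c i) j d = \<Theta> i j (d * c)"
begin

lemma act_right: "\<Theta> i (act c j) d = \<Theta> i j (cstar c * d)"
proof -
  have "\<Theta> i (act c j) d = cnj (\<Theta> (act c j) i (cstar d))"
    using cp_cstar[OF cp, of i "act c j" "cstar d"] by (simp add: cstar_cstar)
  also have "\<dots> = \<Theta> i j (cstar c * d)"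
    unfolding act_left by (simp add: cstar_simps flip: cp_cstar[OF cp])
  finally show ?thesis .
qed

sublocale pos_kernel "\<lambda>i j. \<Theta> i j 1"
proof
  show "\<Theta> j i 1 = cnj (\<Theta> i j 1)" for i j
    using cp_cstar[OF cp, of j i 1] by simp
  show "0 \<le> Re (\<Sum>(i, c)\<leftarrow>v. \<Sum>(j, d)\<leftarrow>v. c * cnj d * \<Theta> i j 1)" for v
    using cp_pos[OF cp, of "map (\<lambda>(i, c). (i, scaleC c 1)) v"]
    by (simp add: o_def split_def cstar_simps mult_scaleC_left mult_scaleC_right scaleC_scaleC
        cp_scaleC[OF cp] mult_ac)
qed

definition rep :: "'a \<Rightarrow> ('i \<Rightarrow> complex) \<Rightarrow> 'i \<Rightarrow> complex" where
  "rep a f = (\<lambda>i. f (act (cstar a) i))"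

abbreviation "actl a \<equiv> (\<lambda>i. [(act a i, 1 :: complex)])"

lemma rep_eq_pull: "rep a = pull (actl (cstar a))"
  by (simp add: rep_def pull_def fun_eq_iff)

text \<open>The difference of the two sides is the kernel applied to
  \<open>\<parallel>a\<parallel>\<^sup>2 - a\<^sup>* a\<close>, which has a square root.\<close>

lemma sqnorm_actl: "sqnorm (lift (actl a) v) \<le> (norm a)\<^sup>2 * sqnorm v"
proof -
  have "cpos ((norm a)\<^sup>2 *\<^sub>R 1 - cstar a * a)"
    by (rule cpos_order_unit) (simp_all add: cstar_simps cstar_identity)
  then obtain s where s: "cpos s" "s * s = (norm a)\<^sup>2 *\<^sub>R 1 - cstar a * a" using exists_sqrt by blast
  have l: "lift (actl a) v = map (\<lambda>(i, c). (act a i, c)) v"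
    by (induction v) (auto simp: lift_def lscale_def)
  have "sqnorm (lift (actl a) v) = Re (\<Sum>(i, c)\<leftarrow>v. \<Sum>(j, d)\<leftarrow>v. c * cnj d * \<Theta> i j (cstar a * a))"
    unfolding l sqnorm_def gram_eq_sum by (simp add: o_def split_def act_left act_right)
  moreover have "0 \<le> Re (\<Sum>(i, c)\<leftarrow>v. \<Sum>(j, d)\<leftarrow>v. c * cnj d * \<Theta> i j (s * s))"
    using cp_pos[OF cp, of "map (\<lambda>(i, c). (i, scaleC c s)) v"]
    by (simp add: o_def split_def cstar_simps mult_scaleC_left mult_scaleC_right scaleC_scaleC
        cp_scaleC[OF cp] cpos_sa[OF s(1)] mult_ac)
  moreover have "(\<Sum>(i, c)\<leftarrow>v. \<Sum>(j, d)\<leftarrow>v. c * cnj d * \<Theta> i j (s * s))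
      = (norm a)\<^sup>2 * (\<Sum>(i, c)\<leftarrow>v. \<Sum>(j, d)\<leftarrow>v. c * cnj d * \<Theta> i j 1)
        - (\<Sum>(i, c)\<leftarrow>v. \<Sum>(j, d)\<leftarrow>v. c * cnj d * \<Theta> i j (cstar a * a))"
    unfolding s(2)
    by (simp add: split_def cp_diff[OF cp] cp_scaleR[OF cp] sum_list_subtractf sum_list_const_mult[symmetric]
        algebra_simps)
  ultimately show ?thesis by (simp add: sqnorm_def gram_eq_sum)
qed

lemma bound_rep: "f \<in> rkhs \<Longrightarrow> bound (rep a f) (norm a * nrm f)"
  unfolding rep_eq_pull using sqnorm_actl[of "cstar a"] by (intro bound_pull) auto

lemma rep_rkhs: "f \<in> rkhs \<Longrightarrow> rep a f \<in> rkhs"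
  using bound_rep by (rule rkhsI)

lemma rep_emb: "rep (cstar a) (emb v) = emb (lift (actl (cstar a)) v)"
proof
  show "rep (cstar a) (emb v) i = emb (lift (actl (cstar a)) v) i" for i
    by (induction v) (auto simp: rep_def lift_def lscale_def cstar_cstar act_left act_right)
qed

text \<open>Both sides agree when \<open>g\<close> is a formal combination, since
  \<open>rep (cstar a)\<close> acts on these through the indices; the general case follows by
  density.\<close>

lemma rep_adjoint:
  assumes f: "f \<in> rkhs" and g: "g \<in> rkhs"
  shows "ip (rep a f) g = ip f (rep (cstar a) g)"
proof -
  obtain v where v: "(\<lambda>n. nrm (\<lambda>i. g i - emb (v n) i)) \<longlonglongrightarrow> 0" by (rule emb_dense[OF g])
  have v': "(\<lambda>n. nrm (\<lambda>i. emb (v n) i - g i)) \<longlonglongrightarrow> 0"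
    using v unfolding nrm_diff_commute[OF g emb_rkhs] .
  have eq: "ip (rep a f) (emb (v n)) = ip f (rep (cstar a) (emb (v n)))" for n
  proof -
    have "ip (rep a f) (emb (v n)) = ev (rep a f) (v n)" by (rule ip_emb[OF rep_rkhs[OF f]])
    also have "\<dots> = ev f (lift (actl (cstar a)) (v n))" by (simp only: rep_eq_pull ev_pull)
    finally show ?thesis unfolding rep_emb ip_emb[OF f] .
  qed
  have "(\<lambda>n. ip (rep a f) (emb (v n))) \<longlonglongrightarrow> ip (rep a f) g"
    by (rule ip_tendsto[OF rep_rkhs[OF f] g emb_rkhs v'])
  moreover have "(\<lambda>n. ip f (rep (cstar a) (emb (v n)))) \<longlonglongrightarrow> ip f (rep (cstar a) g)"
  proof (rule ip_tendsto[OF f rep_rkhs[OF g] rep_rkhs[OF emb_rkhs]])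
    show "(\<lambda>n. nrm (\<lambda>i. rep (cstar a) (emb (v n)) i - rep (cstar a) g i)) \<longlonglongrightarrow> 0"
    proof (rule tendsto_sandwich[of "\<lambda>_. 0" _ _ "\<lambda>n. norm (cstar a) * nrm (\<lambda>i. emb (v n) i - g i)"])
      show "\<forall>\<^sub>F n in sequentially. 0 \<le> nrm (\<lambda>i. rep (cstar a) (emb (v n)) i - rep (cstar a) g i)"
        by (intro always_eventually allI nrm_nonneg rkhs_diff rep_rkhs emb_rkhs g)
      have "nrm (\<lambda>i. rep (cstar a) (emb (v n)) i - rep (cstar a) g i)
          \<le> norm (cstar a) * nrm (\<lambda>i. emb (v n) i - g i)" for n
        using nrm_le[OF bound_rep[OF rkhs_diff[OF emb_rkhs g], of "cstar a" "v n"]]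
        by (simp only: rep_def)
      then show "\<forall>\<^sub>F n in sequentially. nrm (\<lambda>i. rep (cstar a) (emb (v n)) i - rep (cstar a) g i)
          \<le> norm (cstar a) * nrm (\<lambda>i. emb (v n) i - g i)"
        by (intro always_eventually allI)
      show "(\<lambda>n. norm (cstar a) * nrm (\<lambda>i. emb (v n) i - g i)) \<longlonglongrightarrow> 0"
        using tendsto_mult_left[OF v', of "norm (cstar a)"] by simp
    qed simp
  qed
  ultimately show ?thesis unfolding eq by (rule LIMSEQ_unique)
qed

theorem representation_rep: "representation RK rep"
proof -
  have bdd: "rep a \<in> bounded_ops RK" for a
  proof -
    have "hlinear RK RK (rep a)"
      unfolding rep_eq_pull by (intro hlinear_pull) (simp add: rep_rkhs flip: rep_eq_pull)
    moreover have "hnorm RK (rep a f) \<le> norm a * hnorm RK f" if "f \<in> carrier RK" for f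
      using that nrm_le[OF bound_rep[of f a]] by (simp add: hnorm_RK rep_rkhs)
    ultimately show ?thesis by (auto simp: bounded_ops_def)
  qed
  have add: "rep (a + b) f = (\<lambda>i. rep a f i + rep b f i)" if f: "f \<in> rkhs" for a b f
  proof
    fix i
    have "emb [(act (cstar a + cstar b) i, 1)] = emb [(act (cstar a) i, 1), (act (cstar b) i, 1)]"
      by (auto simp: act_left distrib_left cp_add[OF cp])
    from ev_cong_emb[OF f this] show "rep (a + b) f i = rep a f i + rep b f i"
      by (simp add: rep_def cstar_add)
  qed
  have scale: "rep (scaleC c a) f = (\<lambda>i. c * rep a f i)" if f: "f \<in> rkhs" for c a f
  proof
    fix i
    have "emb [(act (scaleC (cnj c) (cstar a)) i, 1)] = emb [(act (cstar a) i, cnj c)]"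
      by (auto simp: act_left mult_scaleC_right cp_scaleC[OF cp])
    from ev_cong_emb[OF f this] show "rep (scaleC c a) f i = c * rep a f i"
      by (simp add: rep_def cstar_scaleC)
  qed
  have mult: "rep (a * b) f = rep a (rep b f)" if f: "f \<in> rkhs" for a b f
  proof
    fix i
    have "emb [(act (cstar b * cstar a) i, 1)] = emb [(act (cstar b) (act (cstar a) i), 1)]"
      by (auto simp: act_left mult.assoc)
    from ev_cong_emb[OF f this] show "rep (a * b) f i = rep a (rep b f) i"
      by (simp add: rep_def cstar_mult)
  qed
  have one: "rep 1 f = f" if f: "f \<in> rkhs" for f
  proof
    fix i
    have "emb [(act 1 i, 1)] = emb [(i, 1)]" by (auto simp: act_left)
    from ev_cong_emb[OF f this] show "rep 1 f i = f i" by (simp add: rep_def)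
  qed
  show ?thesis
    unfolding representation_def is_adjoint_def
    using bdd add scale mult one rep_adjoint by simp
qed

end

section \<open>The coisometric extension\<close>

text \<open>Coefficients with respect to the vectors
  \<open>\<rho>(w\<^sub>p) e\<^bsub>g p\<^esub>\<close>.\<close>

lemma cp_kernel_pullback:
  assumes cp: "cp_kernel \<psi>"
  shows "cp_kernel (\<lambda>p q c. \<psi> (g p) (g q) (cstar (w q) * c * w p))"
  unfolding cp_kernel_def
proof (intro conjI allI)
  show "0 \<le> Re (\<Sum>(p, a)\<leftarrow>xs. \<Sum>(q, b)\<leftarrow>xs. \<psi> (g p) (g q) (cstar (w q) * (cstar b * a) * w p))" for xs
    using cp_pos[OF cp, of "map (\<lambda>(p, a). (g p, a * w p)) xs"]
    by (simp add: o_def split_def cstar_simps mult.assoc)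
  show "\<psi> (g q) (g p) (cstar (w p) * cstar c * w q) = cnj (\<psi> (g p) (g q) (cstar (w q) * c * w p))" for p q c
    by (simp add: cstar_simps mult.assoc flip: cp_cstar[OF cp])
qed (simp_all add: cp_add[OF cp] cp_scaleC[OF cp] distrib_left distrib_right
    mult_scaleC_left mult_scaleC_right)

lemma sum_list_filter_if:
  "(\<Sum>x\<leftarrow>xs. if P x then f x else 0) = (\<Sum>x\<leftarrow>filter P xs. f x :: 'b::comm_monoid_add)"
  by (induction xs) auto

lemma sum_list_fibres:
  assumes "finite N" "\<And>x. x \<in> set xs \<Longrightarrow> l x \<in> N"
  shows "(\<Sum>x\<leftarrow>xs. f x) = (\<Sum>n\<in>N. \<Sum>x\<leftarrow>filter (\<lambda>x. l x = n) xs. f x :: 'b::comm_monoid_add)"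
  using assms(2)
proof (induction xs)
  case (Cons x xs)
  have "(\<Sum>n\<in>N. \<Sum>y\<leftarrow>filter (\<lambda>x. l x = n) (x # xs). f y)
      = (\<Sum>n\<in>N. (if l x = n then f x else 0) + (\<Sum>y\<leftarrow>filter (\<lambda>x. l x = n) xs. f y))"
    by (intro sum.cong) auto
  also have "\<dots> = f x + (\<Sum>n\<in>N. \<Sum>y\<leftarrow>filter (\<lambda>x. l x = n) xs. f y)"
    using Cons.prems assms(1) by (simp add: sum.distrib sum.delta)
  finally show ?case using Cons by simp
qed simp

text \<open>Coefficients of a direct sum; the component of an index \<open>p\<close> is \<open>l p\<close>.\<close>

lemma cp_kernel_block_diagonal:
  assumes cp: "\<And>n. cp_kernel (\<Xi> n)"
  shows "cp_kernel (\<lambda>p q c. if l p = l q then \<Xi> (l p) p q c else 0)"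
  unfolding cp_kernel_def
proof (intro conjI allI)
  fix xs :: "('b \<times> 'c) list"
  let ?N = "(\<lambda>(p, a). l p) ` set xs"
  have "(\<Sum>(p, a)\<leftarrow>xs. \<Sum>(q, b)\<leftarrow>xs. if l p = l q then \<Xi> (l p) p q (cstar b * a) else 0)
      = (\<Sum>n\<in>?N. \<Sum>(p, a)\<leftarrow>filter (\<lambda>(p, a). l p = n) xs. \<Sum>(q, b)\<leftarrow>xs.
          if l p = l q then \<Xi> (l p) p q (cstar b * a) else 0)"
    unfolding split_def by (intro sum_list_fibres) auto
  also have "\<dots> = (\<Sum>n\<in>?N. \<Sum>(p, a)\<leftarrow>filter (\<lambda>(p, a). l p = n) xs.
      \<Sum>(q, b)\<leftarrow>filter (\<lambda>(p, a). l p = n) xs. \<Xi> n p q (cstar b * a))"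
  proof (intro sum.cong refl arg_cong[of _ _ sum_list] map_cong)
    fix n x assume "x \<in> set (filter (\<lambda>(p, a). l p = n) xs)"
    then have x: "l (fst x) = n" by auto
    show "(case x of (p, a) \<Rightarrow> \<Sum>(q, b)\<leftarrow>xs. if l p = l q then \<Xi> (l p) p q (cstar b * a) else 0)
      = (case x of (p, a) \<Rightarrow> \<Sum>(q, b)\<leftarrow>filter (\<lambda>(p, a). l p = n) xs. \<Xi> n p q (cstar b * a))"
      unfolding split_def x sum_list_filter_if[symmetric] by (simp add: eq_commute)
  qed
  finally show "0 \<le> Re (\<Sum>(p, a)\<leftarrow>xs. \<Sum>(q, b)\<leftarrow>xs.
      if l p = l q then \<Xi> (l p) p q (cstar b * a) else 0)"
    using cp_pos[OF cp] by (simp add: sum_nonneg)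
qed (auto simp: cp_add[OF cp] cp_scaleC[OF cp] cp_cstar[OF cp])

context complex_inner_space
begin

definition vsum :: "'v list \<Rightarrow> 'v" where
  "vsum xs = foldr (\<oplus>) xs \<zero>"

lemma vsum_closed: "set xs \<subseteq> carrier H \<Longrightarrow> vsum xs \<in> carrier H"
  by (induction xs) (auto simp: vsum_def)

text \<open>The double sum is the value of the form at the sum of the vectors.\<close>

lemma form_sum_nonneg:
  fixes B :: "'v \<Rightarrow> 'v \<Rightarrow> complex"
  assumes add: "\<And>x y z. x \<in> carrier H \<Longrightarrow> y \<in> carrier H \<Longrightarrow> z \<in> carrier H
      \<Longrightarrow> B (x \<oplus> y) z = B x z + B y z"
    and zero: "\<And>z. z \<in> carrier H \<Longrightarrow> B \<zero> z = 0"
    and herm: "\<And>x y. x \<in> carrier H \<Longrightarrow> y \<in> carrier H \<Longrightarrow> B y x = cnj (B x y)"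
    and pos: "\<And>x. x \<in> carrier H \<Longrightarrow> 0 \<le> Re (B x x)"
    and xs: "set xs \<subseteq> carrier H"
  shows "0 \<le> Re (\<Sum>x\<leftarrow>xs. \<Sum>y\<leftarrow>xs. B x y)"
proof -
  have l: "B (vsum ys) z = (\<Sum>x\<leftarrow>ys. B x z)" if "set ys \<subseteq> carrier H" "z \<in> carrier H" for ys z
    using that
  proof (induction ys)
    case (Cons y ys)
    then have "B (vsum (y # ys)) z = B y z + B (vsum ys) z"
      using add[of y "vsum ys" z] vsum_closed[of ys] by (simp add: vsum_def)
    then show ?case using Cons by simp
  qed (simp add: vsum_def zero)
  have cnj_sum: "cnj (\<Sum>y\<leftarrow>ys. g y) = (\<Sum>y\<leftarrow>ys. cnj (g y))" for g :: "'v \<Rightarrow> complex" and ys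
    by (induction ys) auto
  have r: "B z (vsum ys) = (\<Sum>y\<leftarrow>ys. B z y)" if "set ys \<subseteq> carrier H" "z \<in> carrier H" for ys z
  proof -
    have "B z (vsum ys) = cnj (\<Sum>y\<leftarrow>ys. B y z)"
      using herm[OF vsum_closed[OF that(1)] that(2)] l[OF that] by simp
    also have "\<dots> = (\<Sum>y\<leftarrow>ys. B z y)"
      unfolding cnj_sum using that herm[OF _ that(2)]
      by (intro arg_cong[of _ _ sum_list] map_cong refl) (metis complex_cnj_cnj subsetD)
    finally show ?thesis .
  qed
  have "B (vsum xs) (vsum xs) = (\<Sum>x\<leftarrow>xs. B x (vsum xs))"
    by (rule l[OF xs vsum_closed[OF xs]])
  also have "\<dots> = (\<Sum>x\<leftarrow>xs. \<Sum>y\<leftarrow>xs. B x y)"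
    using r[OF xs] xs by (intro arg_cong[of _ _ sum_list] map_cong refl) blast
  finally show ?thesis using pos[OF vsum_closed[OF xs]] by simp
qed

end

locale contractive_covariant = injective_star_endomorphism \<alpha> + hilbert_space H
  for \<alpha> :: "'a::cstar_algebra \<Rightarrow> 'a" and H :: "'v hilbert" (structure) +
  fixes \<pi> :: "'a \<Rightarrow> 'v \<Rightarrow> 'v" and T S :: "'v \<Rightarrow> 'v"
  assumes cov: "covariant_representation \<alpha> H \<pi> T" and adj: "is_adjoint H T S"
begin

lemma pi_closed: "x \<in> carrier H \<Longrightarrow> \<pi> a x \<in> carrier H"
  using cov by (auto simp: covariant_representation_def representation_def bounded_ops_def hlinear_def)

lemma pi_add: "x \<in> carrier H \<Longrightarrow> \<pi> (a + b) x = \<pi> a x \<oplus> \<pi> b x"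
  and pi_scaleC: "x \<in> carrier H \<Longrightarrow> \<pi> (scaleC c a) x = c \<odot> \<pi> a x"
  and pi_mult: "x \<in> carrier H \<Longrightarrow> \<pi> (a * b) x = \<pi> a (\<pi> b x)"
  and pi_one: "x \<in> carrier H \<Longrightarrow> \<pi> 1 x = x"
  using cov by (auto simp: covariant_representation_def representation_def)

lemma pi_adjoint: "x \<in> carrier H \<Longrightarrow> y \<in> carrier H \<Longrightarrow> hinner H (\<pi> a x) y = hinner H x (\<pi> (cstar a) y)"
  using cov by (auto simp: covariant_representation_def representation_def is_adjoint_def)

lemma covariance: "x \<in> carrier H \<Longrightarrow> T (\<pi> (\<alpha> a) x) = \<pi> a (T x)"
  using cov by (auto simp: covariant_representation_def)

lemma T_closed: "x \<in> carrier H \<Longrightarrow> T x \<in> carrier H"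
  and S_closed: "x \<in> carrier H \<Longrightarrow> S x \<in> carrier H"
  and S_add: "x \<in> carrier H \<Longrightarrow> y \<in> carrier H \<Longrightarrow> S (x \<oplus> y) = S x \<oplus> S y"
  and S_smult: "x \<in> carrier H \<Longrightarrow> S (c \<odot> x) = c \<odot> S x"
  and T_adjoint: "x \<in> carrier H \<Longrightarrow> y \<in> carrier H \<Longrightarrow> hinner H (T x) y = hinner H x (S y)"
  using adj by (auto simp: is_adjoint_def bounded_ops_def hlinear_def)

text \<open>The adjoint of the covariance relation.\<close>

lemma S_pi: assumes x: "x \<in> carrier H" shows "S (\<pi> a x) = \<pi> (\<alpha> a) (S x)"
proof (rule hinner_eqI)
  fix z assume z: "z \<in> carrier H"
  have "hinner H z (S (\<pi> a x)) = hinner H (T z) (\<pi> (cstar (cstar a)) x)"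
    using x z by (simp add: T_adjoint pi_closed cstar_cstar)
  also have "\<dots> = hinner H (\<pi> (cstar a) (T z)) x"
    using x z by (simp only: pi_adjoint T_closed)
  also have "\<dots> = hinner H (T (\<pi> (\<alpha> (cstar a)) z)) x"
    using z by (simp only: covariance)
  also have "\<dots> = hinner H (\<pi> (\<alpha> (cstar a)) z) (S x)"
    using x z by (simp only: T_adjoint pi_closed)
  also have "\<dots> = hinner H z (\<pi> (\<alpha> a) (S x))"
    using x z by (simp add: pi_adjoint S_closed hom_cstar cstar_cstar)
  finally show "hinner H z (S (\<pi> a x)) = hinner H z (\<pi> (\<alpha> a) (S x))" .
qed (use x in \<open>simp_all add: pi_closed S_closed\<close>)

lemma S_norm: assumes x: "x \<in> carrier H" shows "hnorm H (S x) \<le> hnorm H x"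
proof (cases "hnorm H (S x) = 0")
  case True
  then show ?thesis using hnorm_ge_zero[OF x] by simp
next
  case False
  have "(hnorm H (S x))\<^sup>2 = Re (hinner H (T (S x)) x)"
    using x by (simp add: hnorm_square S_closed T_adjoint)
  also have "\<dots> \<le> hnorm H (T (S x)) * hnorm H x"
    using x by (intro Re_hinner_le T_closed S_closed)
  also have "\<dots> \<le> hnorm H (S x) * hnorm H x"
    using x cov contraction_norm_le[OF _ S_closed[OF x], of T]
    by (intro mult_right_mono hnorm_ge_zero) (auto simp: covariant_representation_def)
  finally have "hnorm H (S x) * hnorm H (S x) \<le> hnorm H (S x) * hnorm H x"
    by (simp add: monoid_mult_class.power2_eq_square)
  moreover have "0 < hnorm H (S x)" using False hnorm_ge_zero[OF S_closed[OF x]] by simp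
  ultimately show ?thesis by simp
qed

text \<open>For \<open>t = 0\<close> this is the inner product of \<open>H\<close>, for
  \<open>t = 1\<close> the inner product
  \<open>\<langle>(1 - T T\<^sup>*) x, y\<rangle>\<close> of the defect space.\<close>

definition form :: "real \<Rightarrow> 'v \<Rightarrow> 'v \<Rightarrow> complex" where
  "form t x y = hinner H x y - of_real t * hinner H (S x) (S y)"

lemma form_add: "x \<in> carrier H \<Longrightarrow> y \<in> carrier H \<Longrightarrow> z \<in> carrier H \<Longrightarrow>
    form t (x \<oplus> y) z = form t x z + form t y z"
  by (simp add: form_def hinner_add_left S_add S_closed algebra_simps)

lemma form_smult: "x \<in> carrier H \<Longrightarrow> z \<in> carrier H \<Longrightarrow> form t (c \<odot> x) z = c * form t x z"
  by (simp add: form_def hinner_smult_left S_smult S_closed algebra_simps)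

lemma form_herm: assumes "x \<in> carrier H" "y \<in> carrier H" shows "form t y x = cnj (form t x y)"
  using hinner_commute[of y x] hinner_commute[of "S y" "S x"] assms by (simp add: form_def S_closed)

lemma form_zero: assumes "z \<in> carrier H" shows "form t \<zero> z = 0" "form t z \<zero> = 0"
proof -
  show 1: "form t \<zero> z = 0" using form_add[of \<zero> \<zero> z t] assms by simp
  show "form t z \<zero> = 0" using form_herm[of \<zero> z t] assms 1 by simp
qed

lemma form_pos:
  assumes x: "x \<in> carrier H" and t: "0 \<le> t" "t \<le> 1" shows "0 \<le> Re (form t x x)"
proof -
  have "(hnorm H (S x))\<^sup>2 \<le> (hnorm H x)\<^sup>2"
    using x by (intro power_mono S_norm hnorm_ge_zero S_closed)
  moreover have "t * (hnorm H (S x))\<^sup>2 \<le> 1 * (hnorm H (S x))\<^sup>2"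
    using t by (intro mult_right_mono) auto
  ultimately show ?thesis using x by (simp add: form_def hnorm_square S_closed)
qed

lemma form_pi:
  assumes "x \<in> carrier H" "y \<in> carrier H"
  shows "form t (\<pi> a x) y = form t x (\<pi> (cstar a) y)"
  using assms by (simp add: form_def pi_adjoint S_pi S_closed pi_closed hom_cstar)

text \<open>The coefficients of \<open>\<pi>\<close> with respect to \<open>form t\<close>. Vectors outside
  the carrier are sent to 0.\<close>

definition base_kernel :: "real \<Rightarrow> 'v \<times> 'a list \<Rightarrow> 'v \<times> 'a list \<Rightarrow> 'a \<Rightarrow> complex" where
  "base_kernel t p q c = (if fst p \<in> carrier H \<and> fst q \<in> carrier H then form t (\<pi> c (fst p)) (fst q) else 0)"

lemma cp_base_kernel:
  assumes t: "0 \<le> t" "t \<le> 1" shows "cp_kernel (base_kernel t)"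
  unfolding cp_kernel_def
proof (intro conjI allI)
  show "base_kernel t q p (cstar c) = cnj (base_kernel t p q c)" for p q c
    using form_pi[of "fst q" "fst p" t "cstar c"] form_herm[of "\<pi> c (fst p)" "fst q" t]
    by (auto simp: base_kernel_def pi_closed cstar_cstar)
  show "0 \<le> Re (\<Sum>(p, a)\<leftarrow>xs. \<Sum>(q, b)\<leftarrow>xs. base_kernel t p q (cstar b * a))" for xs
  proof -
    define u where "u = (\<lambda>(p :: 'v \<times> 'a list, a). if fst p \<in> carrier H then \<pi> a (fst p) else \<zero>)"
    have "set (map u xs) \<subseteq> carrier H" by (auto simp: u_def pi_closed)
    then have "0 \<le> Re (\<Sum>x\<leftarrow>map u xs. \<Sum>y\<leftarrow>map u xs. form t x y)"
      by (intro form_sum_nonneg[of "form t"] form_add form_zero form_herm form_pos t) auto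
    moreover have "base_kernel t p q (cstar b * a) = form t (u (p, a)) (u (q, b))" for p q a b
      using form_pi[of "\<pi> a (fst p)" "fst q" t "cstar b"]
      by (auto simp: base_kernel_def u_def pi_mult pi_closed form_zero cstar_cstar)
    ultimately show ?thesis by (simp add: o_def split_def)
  qed
qed (auto simp: base_kernel_def pi_add pi_scaleC pi_closed form_add form_smult)

definition extend ::
    "('v \<times> 'a list \<Rightarrow> 'v \<times> 'a list \<Rightarrow> 'a \<Rightarrow> complex) \<Rightarrow>
      'v \<times> 'a list \<Rightarrow> 'v \<times> 'a list \<Rightarrow> 'a \<Rightarrow> complex" where
  "extend \<phi> = (SOME \<psi>. cp_kernel \<psi> \<and> (\<forall>i j a. \<psi> i j (\<alpha> a) = \<phi> i j a))"

lemma
  assumes "cp_kernel \<phi>"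
  shows cp_extend: "cp_kernel (extend \<phi>)" and extend_hom: "extend \<phi> i j (\<alpha> a) = \<phi> i j a"
proof -
  have "\<exists>\<psi>. cp_kernel \<psi> \<and> (\<forall>i j a. \<psi> i j (\<alpha> a) = \<phi> i j a)"
    using cp_kernel_extension[OF assms] by metis
  from someI_ex[OF this] show "cp_kernel (extend \<phi>)" "extend \<phi> i j (\<alpha> a) = \<phi> i j a"
    unfolding extend_def by blast+
qed

text \<open>The kernel of the \<open>n\<close>-th defect summand, at lists of length \<open>n\<close>. Level
  0 is the defect space with the action of \<open>\<pi>\<close>. At level \<open>n + 1\<close>
  the algebra acts through an extension of the representation at level \<open>n\<close> along
  \<open>\<alpha>\<close>, and the index \<open>(x, a # as)\<close> stands for
  \<open>\<rho>(a)\<close> applied to the image of the vector with index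
  \<open>(x, as)\<close>.\<close>

primrec level :: "nat \<Rightarrow> 'v \<times> 'a list \<Rightarrow> 'v \<times> 'a list \<Rightarrow> 'a \<Rightarrow> complex" where
  "level 0 = base_kernel 1"
| "level (Suc n) = (\<lambda>p q c. extend (level n) (fst p, tl (snd p)) (fst q, tl (snd q))
      (cstar (hd (snd q)) * c * hd (snd p)))"

lemma cp_level: "cp_kernel (level n)"
proof (induction n)
  case 0
  then show ?case using cp_base_kernel[of 1] by simp
next
  case (Suc n)
  then show ?case
    using cp_kernel_pullback[OF cp_extend, of "level n" "\<lambda>p. (fst p, tl (snd p))" "\<lambda>p. hd (snd p)"] by simp
qed

text \<open>The direct sum of \<open>H\<close>, at the empty list, and of the levels from 1 on. The defect
  space itself, level 0, is not a summand: it is embedded in level 1.\<close>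

definition \<Theta> :: "'v \<times> 'a list \<Rightarrow> 'v \<times> 'a list \<Rightarrow> 'a \<Rightarrow> complex" where
  "\<Theta> p q c = (if length (snd p) = length (snd q)
     then (if snd p = [] then base_kernel 0 else level (length (snd p))) p q c else 0)"

lemma cp_Theta: "cp_kernel \<Theta>"
proof -
  have "cp_kernel (if n = 0 then base_kernel 0 else level n)" for n
    using cp_base_kernel[of 0] cp_level by simp
  from cp_kernel_block_diagonal[of "\<lambda>n. if n = 0 then base_kernel 0 else level n" "\<lambda>p. length (snd p)", OF this]
  show ?thesis unfolding \<Theta>_def[abs_def] length_0_conv .
qed

text \<open>Where \<open>x\<close> is outside the carrier, \<open>\<pi> c x\<close> could lie in it, and
  \<open>x\<close> is left alone for this reason.\<close>

primrec act_list :: "'a \<Rightarrow> 'v \<Rightarrow> 'a list \<Rightarrow> 'v \<times> 'a list" where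
  "act_list c x [] = ((if x \<in> carrier H then \<pi> c x else x), [])"
| "act_list c x (a # as) = (x, c * a # as)"

definition act :: "'a \<Rightarrow> 'v \<times> 'a list \<Rightarrow> 'v \<times> 'a list" where
  "act c p = act_list c (fst p) (snd p)"

lemma act_Nil: "act c (x, []) = ((if x \<in> carrier H then \<pi> c x else x), [])"
  and act_Cons: "act c (x, a # as) = (x, c * a # as)"
  by (simp_all add: act_def)

lemma length_act: "length (snd (act c p)) = length (snd p)"
  by (cases p; cases "snd p") (auto simp: act_def)

lemma base_kernel_act: "base_kernel t (fst (act c (x, [])), as) q d = base_kernel t (x, as) q (d * c)"
  by (auto simp: act_Nil base_kernel_def pi_closed pi_mult)

lemma level_act:
  assumes "length (snd p) = n" shows "level n (act c p) q d = level n p q (d * c)"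
proof (cases n)
  case 0
  then have "p = (fst p, [])" using assms by (cases p) auto
  then show ?thesis using 0 base_kernel_act[of 1 c "fst p" "[]" q d] by (metis act_Nil fst_conv level.simps(1))
next
  case (Suc m)
  then obtain x a as where "p = (x, a # as)" using assms by (cases p) (auto simp: length_Suc_conv)
  then show ?thesis using Suc by (simp add: act_Cons mult.assoc)
qed

sublocale cp_action \<Theta> act
proof
  show "cp_kernel \<Theta>" by (rule cp_Theta)
  show "\<Theta> (act c p) q d = \<Theta> p q (d * c)" for c p q d
  proof (cases "snd p")
    case Nil
    then have p: "p = (fst p, [])" by (cases p) auto
    show ?thesis using base_kernel_act[of 0 c "fst p" "[]" q d]
      by (subst (1 2) p) (simp add: \<Theta>_def act_Nil)
  next
    case (Cons a as)
    then have ne: "snd p \<noteq> []" "snd (act c p) \<noteq> []" using length_act[of c p] by auto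
    have "level (length (snd p)) (act c p) q d = level (length (snd p)) p q (d * c)"
      by (rule level_act[OF refl])
    then show ?thesis
      using ne by (cases "length (snd p) = length (snd q)") (simp_all add: \<Theta>_def length_act)
  qed
qed

text \<open>The isometry from one level to the next.\<close>

definition push :: "'v \<times> 'a list \<Rightarrow> 'v \<times> 'a list" where
  "push p = (fst p, 1 # snd p)"

abbreviation "\<kappa> p q \<equiv> \<Theta> p q 1"

lemma kappa_Cons:
  assumes "length as = n" "length bs = n"
  shows "\<kappa> (x, a # as) (y, b # bs) = extend (level n) (x, as) (y, bs) (cstar b * a)"
  using assms by (simp add: \<Theta>_def)

lemma kappa_length: "length (snd p) \<noteq> length (snd q) \<Longrightarrow> \<kappa> p q = 0"
  by (simp add: \<Theta>_def)

lemma kappa_Nil: "\<kappa> (x, []) (y, []) = (if x \<in> carrier H \<and> y \<in> carrier H then hinner H x y else 0)"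
  by (simp add: \<Theta>_def base_kernel_def form_def pi_one)

lemma kappa_push:
  assumes "length (snd p) = n" "length (snd q) = n" shows "\<kappa> (push p) (push q) = level n p q 1"
proof -
  have "\<kappa> (push p) (push q) = extend (level n) p q (\<alpha> 1)"
    unfolding push_def using kappa_Cons[OF assms] by (simp add: hom_one)
  then show ?thesis by (simp only: extend_hom[OF cp_level])
qed

text \<open>Covariance of the isometry between consecutive levels: the vectors
  \<open>W \<rho>(c) e\<^sub>p\<close> and \<open>\<rho>(\<alpha>(c)) W e\<^sub>p\<close>
  coincide. All inner products that occur in the squared norm of their difference are values of
  the extended kernel on \<open>\<alpha>(A)\<close>, where it is the kernel of the lower level;
  there they all equal \<open>\<parallel>\<rho>(c) e\<^sub>p\<parallel>\<^sup>2\<close>.\<close>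

lemma push_act:
  assumes f: "f \<in> rkhs" shows "f (push (act c p)) = f (act (\<alpha> c) (push p))"
proof -
  let ?n = "length (snd p)"
  let ?r = "act c p"
  have r: "length (snd ?r) = ?n" by (rule length_act)
  have s: "act (\<alpha> c) (push p) = (fst p, \<alpha> c # snd p)" by (simp add: push_def act_Cons)
  have aa: "\<kappa> (fst p, \<alpha> c # snd p) (fst p, \<alpha> c # snd p) = level ?n p p (cstar c * c)"
    using kappa_Cons[of "snd p" ?n "snd p" "fst p" "\<alpha> c" "fst p" "\<alpha> c"]
      extend_hom[OF cp_level, of ?n p p "cstar c * c"] by (simp add: hom_mult hom_cstar)
  have ab: "\<kappa> (fst p, \<alpha> c # snd p) (push ?r) = level ?n p p (cstar c * c)"
  proof -
    have "\<kappa> (fst p, \<alpha> c # snd p) (push ?r) = extend (level ?n) p ?r (\<alpha> c)"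
      using kappa_Cons[of "snd p" ?n "snd ?r" "fst p" "\<alpha> c" "fst ?r" 1] r by (simp add: push_def)
    also have "\<dots> = cnj (level ?n ?r p (cstar c))"
      unfolding extend_hom[OF cp_level] using cp_cstar[OF cp_level, of ?n p ?r "cstar c"]
      by (simp add: cstar_cstar)
    also have "\<dots> = cnj (level ?n p p (cstar c * c))" by (simp add: level_act)
    also have "\<dots> = level ?n p p (cstar c * c)"
      by (simp add: cstar_simps flip: cp_cstar[OF cp_level])
    finally show ?thesis .
  qed
  have bb: "\<kappa> (push ?r) (push ?r) = level ?n p p (cstar c * c)"
  proof -
    have "\<kappa> (push ?r) (push ?r) = level ?n ?r ?r 1" by (rule kappa_push[OF r r])
    also have "\<dots> = level ?n p ?r c" by (simp add: level_act)
    also have "\<dots> = cnj (level ?n ?r p (cstar c))"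
      using cp_cstar[OF cp_level, of ?n p ?r "cstar c"] by (simp add: cstar_cstar)
    also have "\<dots> = cnj (level ?n p p (cstar c * c))" by (simp add: level_act)
    also have "\<dots> = level ?n p p (cstar c * c)"
      by (simp add: cstar_simps flip: cp_cstar[OF cp_level])
    finally show ?thesis .
  qed
  have ba: "\<kappa> (push ?r) (fst p, \<alpha> c # snd p) = level ?n p p (cstar c * c)"
    using k_herm[of "push ?r" "(fst p, \<alpha> c # snd p)"] ab cp_cstar[OF cp_level, of ?n p p "cstar c * c"]
    by (simp add: cstar_simps)
  have "sqnorm [(push ?r, 1), ((fst p, \<alpha> c # snd p), - 1)] = 0"
    unfolding sqnorm_def gram_eq_sum by (simp add: aa ab ba bb)
  then have "ev f [(push ?r, 1), ((fst p, \<alpha> c # snd p), - 1)] = 0" by (rule ev_null[OF f])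
  then show ?thesis by (simp add: s)
qed

text \<open>The isometry \<open>V\<^sup>*\<close> on basis vectors: a vector of \<open>H\<close> goes to
  \<open>T\<^sup>* x\<close> plus its defect part in level 1, and the levels are shifted.
  Indices outside the carrier represent the zero vector.\<close>

definition Vstar :: "'v \<times> 'a list \<Rightarrow> (('v \<times> 'a list) \<times> complex) list" where
  "Vstar p = (if snd p = [] then
     (if fst p \<in> carrier H then [((S (fst p), []), 1), (push p, 1)] else []) else [(push p, 1)])"

text \<open>On \<open>H\<close> the computation is
  \<open>\<langle>T\<^sup>* x, T\<^sup>* y\<rangle> + \<langle>(1 - T T\<^sup>*) x, y\<rangle> = \<langle>x, y\<rangle>\<close>;
  on the levels it is the isometry of \<open>push\<close>.\<close>

lemma gram_Vstar: "gram (Vstar p) (Vstar r) = \<kappa> p r"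
proof -
  have len: "length (snd (push s)) = Suc (length (snd s))" for s by (simp add: push_def)
  obtain x as y bs where p: "p = (x, as)" and r: "r = (y, bs)" by (cases p; cases r)
  show ?thesis
  proof (cases "length as = length bs")
    case False
    then show ?thesis
      by (auto simp: gram_eq_sum Vstar_def p r kappa_length len)
  next
    case True
    have pr: "\<kappa> (push p) (push r) = level (length as) p r 1"
      using True by (intro kappa_push) (simp_all add: p r)
    show ?thesis
    proof (cases "as = []")
      case False
      then have "bs \<noteq> []" using True by auto
      then have "\<kappa> p r = level (length as) p r 1" using False True by (simp add: \<Theta>_def p r)
      then show ?thesis
        using False \<open>bs \<noteq> []\<close> pr by (simp add: gram_eq_sum Vstar_def p r)
    next
      case Nil: True
      then have bs: "bs = []" using True by simp
      have b: "\<kappa> (push p) (push r) = base_kernel 1 p r 1" using pr Nil by simp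
      have z: "\<kappa> (u, []) (push s) = 0" "\<kappa> (push s) (u, []) = 0" for u s
        by (auto intro!: kappa_length simp: len)
      show ?thesis
        by (auto simp: gram_eq_sum Vstar_def z b) (auto simp: p r Nil bs kappa_Nil base_kernel_def form_def pi_one S_closed)
    qed
  qed
qed

definition V :: "('v, 'a) extension_vector \<Rightarrow> ('v, 'a) extension_vector" where
  "V = pull Vstar"

definition J :: "'v \<Rightarrow> ('v, 'a) extension_vector" where
  "J x = emb [((x, []), 1)]"

lemma J_apply: "J x p = \<kappa> (x, []) p"
  by (simp add: J_def)

text \<open>On \<open>H\<close> this is the adjoint covariance relation for \<open>T\<^sup>*\<close>
  together with the covariance of \<open>push\<close>.\<close>

lemma V_rep:
  assumes f: "f \<in> rkhs" shows "V (rep (\<alpha> a) f) = rep a (V f)"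
proof
  fix p
  have ps: "f (act (cstar (\<alpha> a)) (push p)) = f (push (act (cstar a) p))"
    unfolding hom_cstar[symmetric] by (rule push_act[OF f, symmetric])
  show "V (rep (\<alpha> a) f) p = rep a (V f) p"
  proof (cases "snd p = []")
    case False
    then have "snd (act (cstar a) p) \<noteq> []" using length_act[of "cstar a" p] by auto
    then show ?thesis using False ps by (simp add: V_def pull_def rep_def Vstar_def)
  next
    case True
    then obtain x where p: "p = (x, [])" by (cases p) auto
    show ?thesis
    proof (cases "x \<in> carrier H")
      case False
      then show ?thesis by (simp add: V_def pull_def rep_def Vstar_def p act_Nil)
    next
      case True
      then show ?thesis
        using ps S_pi[OF True, of "cstar a"]
        by (simp add: V_def pull_def rep_def Vstar_def p act_Nil S_closed pi_closed hom_cstar)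
    qed
  qed
qed

lemma V_J: assumes x: "x \<in> carrier H" shows "V (J x) = J (T x)"
proof
  fix p
  have len: "length (snd (push s)) = Suc (length (snd s))" for s by (simp add: push_def)
  have z: "\<kappa> (u, []) (push s) = 0" for u s by (rule kappa_length) (simp add: len)
  show "V (J x) p = J (T x) p"
  proof (cases "snd p = []")
    case False
    then have "\<kappa> (T x, []) p = 0" by (intro kappa_length) simp
    then show ?thesis using False z by (simp add: V_def pull_def Vstar_def J_apply)
  next
    case True
    then obtain y where p: "p = (y, [])" by (cases p) auto
    show ?thesis
      using x z by (auto simp: V_def pull_def Vstar_def J_apply p kappa_Nil S_closed T_closed T_adjoint)
  qed
qed

lemma rep_J: assumes x: "x \<in> carrier H" shows "rep a (J x) = J (\<pi> a x)"
proof -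
  have "rep (cstar (cstar a)) (J x) = J (\<pi> a x)"
    unfolding J_def rep_emb using x by (simp add: lift_def lscale_def act_Nil cstar_cstar)
  then show ?thesis by (simp add: cstar_cstar)
qed

lemma embedding_J: "hilbert_embedding H RK J"
proof (rule hilbert_embeddingI[OF hilbert_space_axioms RK_inner])
  have add: "J (x \<oplus> y) = (\<lambda>p. J x p + J y p)" if "x \<in> carrier H" "y \<in> carrier H" for x y
  proof
    show "J (x \<oplus> y) p = J x p + J y p" for p
      using that by (cases p) (auto simp: J_apply \<Theta>_def base_kernel_def form_def pi_one hinner_add_left)
  qed
  have smult: "J (c \<odot> x) = (\<lambda>p. c * J x p)" if "x \<in> carrier H" for c x
  proof
    show "J (c \<odot> x) p = c * J x p" for p
      using that by (cases p)
        (auto simp: J_apply \<Theta>_def base_kernel_def form_def pi_one hinner_smult_left smult_closed_complex)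
  qed
  show "hlinear H RK J"
    using add smult emb_rkhs by (auto simp: hlinear_def) (simp add: J_def emb_rkhs)
  show "hinner RK (J x) (J y) = hinner H x y" if "x \<in> carrier H" "y \<in> carrier H" for x y
    using that ip_emb[OF emb_rkhs, of "[((x, []), 1)]" "[((y, []), 1)]"]
    by (simp add: J_def kappa_Nil)
qed

theorem coisometric_extension:
  "hilbert_space RK" "hilbert_embedding H RK J"
  "coisometric_covariant_representation \<alpha> RK rep V" "extends_via J H rep V \<pi> T"
proof -
  show "hilbert_space RK" by (rule RK_hilbert)
  show "hilbert_embedding H RK J" by (rule embedding_J)
  show "coisometric_covariant_representation \<alpha> RK rep V"
    unfolding coisometric_covariant_representation_def covariant_representation_def
    using representation_rep pull_coisometry[OF gram_Vstar] V_rep by (simp add: V_def)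
  show "extends_via J H rep V \<pi> T"
    unfolding extends_via_def using rep_J V_J pi_closed T_closed by auto
qed

end

theorem theorem1p2:
  fixes \<alpha> :: "'a::cstar_algebra \<Rightarrow> 'a"
    and H :: "'v hilbert"
    and \<pi> :: "'a \<Rightarrow> 'v \<Rightarrow> 'v"
    and T :: "'v \<Rightarrow> 'v"
  assumes "unital_star_endomorphism \<alpha>"
    and "inj \<alpha>"
    and "hilbert_space H"
    and "covariant_representation \<alpha> H \<pi> T"
  shows "\<exists>(K :: ('v, 'a) extension_vector hilbert) J \<rho> V.
           hilbert_space K \<and>
           hilbert_embedding H K J \<and>
           coisometric_covariant_representation \<alpha> K \<rho> V \<and>
           extends_via J H \<rho> V \<pi> T"
proof -
  interpret H: hilbert_space H by fact
  obtain S where S: "is_adjoint H T S"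
    using assms(4) H.adjoint_exists
    unfolding covariant_representation_def contraction_def by blast
  interpret contractive_covariant \<alpha> H \<pi> T S
    using assms S by unfold_locales auto
  show ?thesis using coisometric_extension by blast
qed

end
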